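(* 1. In a type theory with a propositional truncation operation $\|{-}\|$, for every type $A$ there is an equivalence $\{A\}_\infty\simeq\|A\|$. 2. In a type theory without a propositional truncation operation, one can define it by $\|A\|:\equiv\{A\}_\infty$; that is, this definition, with $|{-}|:\equiv i_0:A\to\{A\}_\infty$, satisfies the rules of the propositional truncation: $\{A\}_\infty$ lives in the same universe as $A$, it is a mere proposition, and for every $P:\{A\}_\infty\to\mathrm{Prop}$ and $h:\Pi(a:A),\ P(i_0(a))$ there is $k:\Pi(x:\{A\}_\infty),\ P(x)$ with $k(i_0(a))\equiv h(a)$ judgmentally.
   Context: We work in homotopy type theory (intensional Martin-Löf type theory with universes and the two non-recursive higher inductive types (HITs) described below), assuming function extensionality; the Univalence Axiom is not assumed. $x=y$ denotes the identity type, $\equiv$ judgmental equality, $\simeq$ equivalence of types. The induction principles of HITs have judgmental computation rules on point constructors. A type $X$ is a mere proposition if $\Pi(x,y:X),\ x=y$; $\mathrm{Prop}:\equiv\Sigma(X:\mathcal{U}),\ \mathrm{isprop}(X)$, and an element of $\mathrm{Prop}$ is identified with its underlying type. The propositional truncation $\|A\|$ is the HIT with constructors $|{-}|:A\to\|A\|$ and $\varepsilon:\Pi(x,y:\|A\|),\ x=y$. One-step truncation: for a type $A$, $\{A\}$ is the HIT (in the same universe as $A$) with constructors $f:A\to\{A\}$ and $e:\Pi(x,y:A),\ f(x)=f(y)$. Sequential colimit: for $A:\mathbb{N}\to\mathcal{U}$ and $f:\Pi(n:\mathbb{N}),\ A_n\to A_{n+1}$, $\mathrm{colim}(A,f):\mathcal{U}$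 is the HIT with constructors $i:\Pi(n:\mathbb{N}),\ A_n\to\mathrm{colim}(A,f)$ and $g:\Pi(n:\mathbb{N}),\Pi(a:A_n),\ i_{n+1}(f_n(a))=i_n(a)$. Definition of $\{A\}_\infty$: put $\{A\}_0:\equiv A$, $\{A\}_{n+1}:\equiv\{\{A\}_n\}$, let $f_n:\{A\}_n\to\{A\}_{n+1}$ be the point constructor $f$ of the one-step truncation of $\{A\}_n$, and set $\{A\}_\infty:\equiv\mathrm{colim}(\{A\}_{-},f_{-})$, with constructors $i_n$ and $g_n$. *)

theory Defs
  imports Main
begin

text \<open>
  A deep embedding of intensional Martin-Loef type theory in the style of the appendix of the
  HoTT book: cumulative universes a la Russell, dependent functions with judgmental
  \<open>\<beta>\<close> and \<open>\<eta>\<close>, dependent pairs, coproducts, empty type, unit type,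
  natural numbers, identity types, and the function extensionality axiom (no univalence),
  extended with the one-step truncation and the sequential colimit. The propositional
  truncation is present only in the theory \<open>With_Trunc\<close>.
\<close>

section \<open>Raw syntax\<close>

text \<open>
  All type and term formers other than universes and functions are constants, used in
  curried form; their types are given by \<open>const_type\<close> below.
\<close>

datatype const =
    cSigma | cPair | cSigma_ind
  | cSum | cInl | cInr | cSum_ind
  | cEmpty | cEmpty_ind
  | cUnit | cStar | cUnit_ind
  | cNat | cZero | cSucc | cNat_ind
  | cId | cRefl | cId_ind
  | cFunext
  | cOne | cOne_f | cOne_e | cOne_ind | cOne_path
  | cColim | cColim_i | cColim_g | cColim_ind | cColim_path
  | cTrunc | cTrunc_in | cTrunc_eps | cTrunc_ind | cTrunc_path

datatype tm =
    Var nat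
  | U nat
  | Pi tm tm
  | Lam tm tm
  | App tm tm
  | Const const

primrec shift :: "nat \<Rightarrow> tm \<Rightarrow> tm" where
  "shift k (Var n) = (if n < k then Var n else Var (Suc n))"
| "shift k (U i) = U i"
| "shift k (Pi A B) = Pi (shift k A) (shift (Suc k) B)"
| "shift k (Lam A b) = Lam (shift k A) (shift (Suc k) b)"
| "shift k (App f a) = App (shift k f) (shift k a)"
| "shift k (Const c) = Const c"

text \<open>\<open>inst k s t\<close> substitutes \<open>s\<close> for variable \<open>k\<close> in \<open>t\<close> and removes that variable.\<close>

primrec inst :: "nat \<Rightarrow> tm \<Rightarrow> tm \<Rightarrow> tm" where
  "inst k s (Var n) = (if n < k then Var n else if n = k then s else Var (n - 1))"
| "inst k s (U i) = U i"
| "inst k s (Pi A B) = Pi (inst k s A) (inst (Suc k) (shift 0 s) B)"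
| "inst k s (Lam A b) = Lam (inst k s A) (inst (Suc k) (shift 0 s) b)"
| "inst k s (App f a) = App (inst k s f) (inst k s a)"
| "inst k s (Const c) = Const c"

section \<open>Writing terms with named binders\<close>

text \<open>
  A scoped term over an ambient context \<open>\<Gamma>\<close> maps a number \<open>d\<close> to a raw term over \<open>\<Gamma>\<close> extended
  by \<open>d\<close> further variables. Binders of the object language can then be written with \<open>\<lambda>\<close>: the
  variable bound at depth \<open>d\<close> has de Bruijn index \<open>d' - Suc d\<close> when it is used at depth \<open>d'\<close>.
  \<open>emb t\<close> is the raw term \<open>t\<close> over \<open>\<Gamma>\<close>, weakened as needed; \<open>raw p\<close> is the raw term over
  \<open>\<Gamma>\<close> denoted by \<open>p\<close>; \<open>body b\<close> is a raw term over \<open>\<Gamma>\<close> extended by one variable.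
\<close>

type_synonym scoped = "nat \<Rightarrow> tm"

definition emb :: "tm \<Rightarrow> scoped" where "emb t = (\<lambda>d. (shift 0 ^^ d) t)"
definition raw :: "scoped \<Rightarrow> tm" where "raw p = p 0"

definition bind :: "(scoped \<Rightarrow> scoped) \<Rightarrow> scoped" where
  "bind b = (\<lambda>d. b (\<lambda>d'. Var (d' - Suc d)) (Suc d))"
definition body :: "(scoped \<Rightarrow> scoped) \<Rightarrow> tm" where "body b = bind b 0"

definition univ :: "nat \<Rightarrow> scoped" where "univ i = (\<lambda>d. U i)"
definition cst :: "const \<Rightarrow> scoped" where "cst c = (\<lambda>d. Const c)"
definition pi :: "scoped \<Rightarrow> (scoped \<Rightarrow> scoped) \<Rightarrow> scoped" where
  "pi A B = (\<lambda>d. Pi (A d) (bind B d))"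
definition fn :: "scoped \<Rightarrow> (scoped \<Rightarrow> scoped) \<Rightarrow> scoped" where
  "fn A b = (\<lambda>d. Lam (A d) (bind b d))"
definition ap :: "scoped \<Rightarrow> scoped \<Rightarrow> scoped" (infixl "\<cdot>" 100) where
  "f \<cdot> a = (\<lambda>d. App (f d) (a d))"
definition arr :: "scoped \<Rightarrow> scoped \<Rightarrow> scoped" (infixr "\<rightarrowtriangle>" 60) where
  "A \<rightarrowtriangle> B = pi A (\<lambda>_. B)"

section \<open>Derived notions\<close>

definition sigma :: "scoped \<Rightarrow> (scoped \<Rightarrow> scoped) \<Rightarrow> scoped" where
  "sigma A B = cst cSigma \<cdot> A \<cdot> fn A B"

definition pr1 :: "scoped \<Rightarrow> (scoped \<Rightarrow> scoped) \<Rightarrow> scoped \<Rightarrow> scoped" where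
  "pr1 A B p = cst cSigma_ind \<cdot> A \<cdot> fn A B \<cdot> fn (sigma A B) (\<lambda>_. A)
                 \<cdot> fn A (\<lambda>a. fn (B a) (\<lambda>_. a)) \<cdot> p"

definition Idt :: "scoped \<Rightarrow> scoped \<Rightarrow> scoped \<Rightarrow> scoped" where
  "Idt A x y = cst cId \<cdot> A \<cdot> x \<cdot> y"

definition id_refl :: "scoped \<Rightarrow> scoped \<Rightarrow> scoped" where
  "id_refl A x = cst cRefl \<cdot> A \<cdot> x"

definition path_ind ::
  "scoped \<Rightarrow> (scoped \<Rightarrow> scoped \<Rightarrow> scoped \<Rightarrow> scoped) \<Rightarrow> (scoped \<Rightarrow> scoped)
     \<Rightarrow> scoped \<Rightarrow> scoped \<Rightarrow> scoped \<Rightarrow> scoped" where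
  "path_ind A C c x y p =
     cst cId_ind \<cdot> A \<cdot> fn A (\<lambda>x. fn A (\<lambda>y. fn (Idt A x y) (\<lambda>p. C x y p))) \<cdot> fn A c \<cdot> x \<cdot> y \<cdot> p"

text \<open>For \<open>P : A \<rightarrow> U\<close> and \<open>p : x = y\<close>, \<open>transport A P x y p : P x \<rightarrow> P y\<close>; for
  \<open>f : \<Pi>(x:A). P x\<close>, \<open>apd A P f x y p : transport A P x y p (f x) = f y\<close>.\<close>

definition transport :: "scoped \<Rightarrow> scoped \<Rightarrow> scoped \<Rightarrow> scoped \<Rightarrow> scoped \<Rightarrow> scoped" where
  "transport A P x y p =
     path_ind A (\<lambda>x y p. P \<cdot> x \<rightarrowtriangle> P \<cdot> y) (\<lambda>x. fn (P \<cdot> x) (\<lambda>u. u)) x y p"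

definition apd :: "scoped \<Rightarrow> scoped \<Rightarrow> scoped \<Rightarrow> scoped \<Rightarrow> scoped \<Rightarrow> scoped \<Rightarrow> scoped" where
  "apd A P f x y p =
     path_ind A (\<lambda>x y p. Idt (P \<cdot> y) (transport A P x y p \<cdot> (f \<cdot> x)) (f \<cdot> y))
                (\<lambda>x. id_refl (P \<cdot> x) (f \<cdot> x)) x y p"

definition isprop :: "scoped \<Rightarrow> scoped" where
  "isprop A = pi A (\<lambda>x. pi A (\<lambda>y. Idt A x y))"

definition hProp :: "nat \<Rightarrow> scoped" where
  "hProp j = sigma (univ j) isprop"

text \<open>The underlying type of an element of \<open>hProp j\<close>.\<close>

definition underlying :: "nat \<Rightarrow> scoped \<Rightarrow> scoped" where
  "underlying j X = pr1 (univ j) isprop X"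

text \<open>A function is an equivalence if it has a right inverse and a left inverse.\<close>

definition isequiv :: "scoped \<Rightarrow> scoped \<Rightarrow> scoped \<Rightarrow> scoped" where
  "isequiv A B f =
     sigma (sigma (B \<rightarrowtriangle> A) (\<lambda>g. pi B (\<lambda>y. Idt B (f \<cdot> (g \<cdot> y)) y)))
           (\<lambda>_. sigma (B \<rightarrowtriangle> A) (\<lambda>h. pi A (\<lambda>x. Idt A (h \<cdot> (f \<cdot> x)) x)))"

definition equivalence :: "scoped \<Rightarrow> scoped \<Rightarrow> scoped" where
  "equivalence A B = sigma (A \<rightarrowtriangle> B) (\<lambda>f. isequiv A B f)"

text \<open>For \<open>f, g : \<Pi>(x:A). B x\<close>, \<open>happly A B f g : f = g \<rightarrow> \<Pi>(x:A). f x = g x\<close>.\<close>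

definition happly :: "scoped \<Rightarrow> scoped \<Rightarrow> scoped \<Rightarrow> scoped \<Rightarrow> scoped" where
  "happly A B f g =
     fn (Idt (pi A (\<lambda>x. B \<cdot> x)) f g) (\<lambda>p.
       path_ind (pi A (\<lambda>x. B \<cdot> x))
         (\<lambda>f g p. pi A (\<lambda>x. Idt (B \<cdot> x) (f \<cdot> x) (g \<cdot> x)))
         (\<lambda>f. fn A (\<lambda>x. id_refl (B \<cdot> x) (f \<cdot> x))) f g p)"

section \<open>Types of the constants\<close>

text \<open>
  The definitions named \<open>\<dots>_case\<close> are the types of the methods of the induction principles, one
  for each constructor.
\<close>

definition pair_case :: "scoped \<Rightarrow> scoped \<Rightarrow> scoped \<Rightarrow> scoped" where
  "pair_case A B C = pi A (\<lambda>a. pi (B \<cdot> a) (\<lambda>b. C \<cdot> (cst cPair \<cdot> A \<cdot> B \<cdot> a \<cdot> b)))"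

definition inl_case :: "scoped \<Rightarrow> scoped \<Rightarrow> scoped \<Rightarrow> scoped" where
  "inl_case A B C = pi A (\<lambda>a. C \<cdot> (cst cInl \<cdot> A \<cdot> B \<cdot> a))"
definition inr_case :: "scoped \<Rightarrow> scoped \<Rightarrow> scoped \<Rightarrow> scoped" where
  "inr_case A B C = pi B (\<lambda>b. C \<cdot> (cst cInr \<cdot> A \<cdot> B \<cdot> b))"

definition succ_case :: "scoped \<Rightarrow> scoped" where
  "succ_case C = pi (cst cNat) (\<lambda>n. C \<cdot> n \<rightarrowtriangle> C \<cdot> (cst cSucc \<cdot> n))"

definition id_motive :: "nat \<Rightarrow> scoped \<Rightarrow> scoped" where
  "id_motive j A = pi A (\<lambda>x. pi A (\<lambda>y. Idt A x y \<rightarrowtriangle> univ j))"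
definition refl_case :: "scoped \<Rightarrow> scoped \<Rightarrow> scoped" where
  "refl_case A C = pi A (\<lambda>x. C \<cdot> x \<cdot> x \<cdot> id_refl A x)"

definition one :: "scoped \<Rightarrow> scoped" where "one A = cst cOne \<cdot> A"
definition one_f :: "scoped \<Rightarrow> scoped \<Rightarrow> scoped" where "one_f A x = cst cOne_f \<cdot> A \<cdot> x"
definition one_e :: "scoped \<Rightarrow> scoped \<Rightarrow> scoped \<Rightarrow> scoped" where
  "one_e A x y = cst cOne_e \<cdot> A \<cdot> x \<cdot> y"

definition one_f_case :: "scoped \<Rightarrow> scoped \<Rightarrow> scoped" where
  "one_f_case A P = pi A (\<lambda>x. P \<cdot> one_f A x)"
definition one_e_case :: "scoped \<Rightarrow> scoped \<Rightarrow> scoped \<Rightarrow> scoped" where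
  "one_e_case A P h = pi A (\<lambda>x. pi A (\<lambda>y.
     Idt (P \<cdot> one_f A y)
       (transport (one A) P (one_f A x) (one_f A y) (one_e A x y) \<cdot> (h \<cdot> x)) (h \<cdot> y)))"

definition colim_map :: "scoped \<Rightarrow> scoped" where
  "colim_map A = pi (cst cNat) (\<lambda>n. A \<cdot> n \<rightarrowtriangle> A \<cdot> (cst cSucc \<cdot> n))"
definition colim :: "scoped \<Rightarrow> scoped \<Rightarrow> scoped" where
  "colim A f = cst cColim \<cdot> A \<cdot> f"
definition colim_i :: "scoped \<Rightarrow> scoped \<Rightarrow> scoped \<Rightarrow> scoped" where
  "colim_i A f n = cst cColim_i \<cdot> A \<cdot> f \<cdot> n"
definition colim_g :: "scoped \<Rightarrow> scoped \<Rightarrow> scoped \<Rightarrow> scoped \<Rightarrow> scoped" where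
  "colim_g A f n a = cst cColim_g \<cdot> A \<cdot> f \<cdot> n \<cdot> a"

definition colim_i_case :: "scoped \<Rightarrow> scoped \<Rightarrow> scoped \<Rightarrow> scoped" where
  "colim_i_case A f P = pi (cst cNat) (\<lambda>n. pi (A \<cdot> n) (\<lambda>a. P \<cdot> (colim_i A f n \<cdot> a)))"
definition colim_g_case :: "scoped \<Rightarrow> scoped \<Rightarrow> scoped \<Rightarrow> scoped \<Rightarrow> scoped" where
  "colim_g_case A f P h = pi (cst cNat) (\<lambda>n. pi (A \<cdot> n) (\<lambda>a.
     Idt (P \<cdot> (colim_i A f n \<cdot> a))
       (transport (colim A f) P
          (colim_i A f (cst cSucc \<cdot> n) \<cdot> (f \<cdot> n \<cdot> a)) (colim_i A f n \<cdot> a) (colim_g A f n a)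
          \<cdot> (h \<cdot> (cst cSucc \<cdot> n) \<cdot> (f \<cdot> n \<cdot> a)))
       (h \<cdot> n \<cdot> a)))"

definition trunc :: "scoped \<Rightarrow> scoped" where "trunc A = cst cTrunc \<cdot> A"
definition trunc_in :: "scoped \<Rightarrow> scoped \<Rightarrow> scoped" where
  "trunc_in A a = cst cTrunc_in \<cdot> A \<cdot> a"
definition trunc_eps :: "scoped \<Rightarrow> scoped \<Rightarrow> scoped \<Rightarrow> scoped" where
  "trunc_eps A x y = cst cTrunc_eps \<cdot> A \<cdot> x \<cdot> y"

definition trunc_in_case :: "scoped \<Rightarrow> scoped \<Rightarrow> scoped" where
  "trunc_in_case A P = pi A (\<lambda>a. P \<cdot> trunc_in A a)"
definition trunc_eps_case :: "scoped \<Rightarrow> scoped \<Rightarrow> scoped" where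
  "trunc_eps_case A P = pi (trunc A) (\<lambda>x. pi (trunc A) (\<lambda>y. pi (P \<cdot> x) (\<lambda>u. pi (P \<cdot> y) (\<lambda>v.
     Idt (P \<cdot> y) (transport (trunc A) P x y (trunc_eps A x y) \<cdot> u) v))))"

datatype tt = Without_Trunc | With_Trunc

text \<open>
  A constant has one type for each choice of the universe levels \<open>i\<close> and \<open>j\<close>. The constants
  \<open>\<dots>_path\<close> are the (propositional) computation rules of the higher inductive types on path
  constructors; the judgmental computation rules are part of the equality judgment.
\<close>

inductive const_type :: "tt \<Rightarrow> const \<Rightarrow> tm \<Rightarrow> bool" for T where
  "const_type T cSigma (raw (pi (univ i) (\<lambda>A. (A \<rightarrowtriangle> univ i) \<rightarrowtriangle> univ i)))"
| "const_type T cPair (raw (pi (univ i) (\<lambda>A. pi (A \<rightarrowtriangle> univ i) (\<lambda>B.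
     pi A (\<lambda>a. B \<cdot> a \<rightarrowtriangle> cst cSigma \<cdot> A \<cdot> B)))))"
| "const_type T cSigma_ind (raw (pi (univ i) (\<lambda>A. pi (A \<rightarrowtriangle> univ i) (\<lambda>B.
     pi (cst cSigma \<cdot> A \<cdot> B \<rightarrowtriangle> univ j) (\<lambda>C.
       pair_case A B C \<rightarrowtriangle> pi (cst cSigma \<cdot> A \<cdot> B) (\<lambda>p. C \<cdot> p))))))"

| "const_type T cSum (raw (univ i \<rightarrowtriangle> univ i \<rightarrowtriangle> univ i))"
| "const_type T cInl (raw (pi (univ i) (\<lambda>A. pi (univ i) (\<lambda>B. A \<rightarrowtriangle> cst cSum \<cdot> A \<cdot> B))))"
| "const_type T cInr (raw (pi (univ i) (\<lambda>A. pi (univ i) (\<lambda>B. B \<rightarrowtriangle> cst cSum \<cdot> A \<cdot> B))))"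
| "const_type T cSum_ind (raw (pi (univ i) (\<lambda>A. pi (univ i) (\<lambda>B.
     pi (cst cSum \<cdot> A \<cdot> B \<rightarrowtriangle> univ j) (\<lambda>C.
       inl_case A B C \<rightarrowtriangle> inr_case A B C \<rightarrowtriangle> pi (cst cSum \<cdot> A \<cdot> B) (\<lambda>s. C \<cdot> s))))))"

| "const_type T cEmpty (U i)"
| "const_type T cEmpty_ind (raw (pi (cst cEmpty \<rightarrowtriangle> univ j) (\<lambda>C. pi (cst cEmpty) (\<lambda>x. C \<cdot> x))))"

| "const_type T cUnit (U i)"
| "const_type T cStar (Const cUnit)"
| "const_type T cUnit_ind (raw (pi (cst cUnit \<rightarrowtriangle> univ j) (\<lambda>C.
     C \<cdot> cst cStar \<rightarrowtriangle> pi (cst cUnit) (\<lambda>x. C \<cdot> x))))"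

| "const_type T cNat (U i)"
| "const_type T cZero (Const cNat)"
| "const_type T cSucc (raw (cst cNat \<rightarrowtriangle> cst cNat))"
| "const_type T cNat_ind (raw (pi (cst cNat \<rightarrowtriangle> univ j) (\<lambda>C.
     C \<cdot> cst cZero \<rightarrowtriangle> succ_case C \<rightarrowtriangle> pi (cst cNat) (\<lambda>n. C \<cdot> n))))"

| "const_type T cId (raw (pi (univ i) (\<lambda>A. A \<rightarrowtriangle> A \<rightarrowtriangle> univ i)))"
| "const_type T cRefl (raw (pi (univ i) (\<lambda>A. pi A (\<lambda>x. Idt A x x))))"
| "const_type T cId_ind (raw (pi (univ i) (\<lambda>A. pi (id_motive j A) (\<lambda>C.
     refl_case A C \<rightarrowtriangle> pi A (\<lambda>x. pi A (\<lambda>y. pi (Idt A x y) (\<lambda>p. C \<cdot> x \<cdot> y \<cdot> p)))))))"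

| "const_type T cFunext (raw (pi (univ i) (\<lambda>A. pi (A \<rightarrowtriangle> univ i) (\<lambda>B.
     pi (pi A (\<lambda>x. B \<cdot> x)) (\<lambda>f. pi (pi A (\<lambda>x. B \<cdot> x)) (\<lambda>g.
       isequiv (Idt (pi A (\<lambda>x. B \<cdot> x)) f g) (pi A (\<lambda>x. Idt (B \<cdot> x) (f \<cdot> x) (g \<cdot> x)))
         (happly A B f g)))))))"

| "const_type T cOne (raw (univ i \<rightarrowtriangle> univ i))"
| "const_type T cOne_f (raw (pi (univ i) (\<lambda>A. A \<rightarrowtriangle> one A)))"
| "const_type T cOne_e (raw (pi (univ i) (\<lambda>A. pi A (\<lambda>x. pi A (\<lambda>y.
     Idt (one A) (one_f A x) (one_f A y))))))"
| "const_type T cOne_ind (raw (pi (univ i) (\<lambda>A. pi (one A \<rightarrowtriangle> univ j) (\<lambda>P.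
     pi (one_f_case A P) (\<lambda>h. one_e_case A P h \<rightarrowtriangle> pi (one A) (\<lambda>x. P \<cdot> x))))))"
| "const_type T cOne_path (raw (pi (univ i) (\<lambda>A. pi (one A \<rightarrowtriangle> univ j) (\<lambda>P.
     pi (one_f_case A P) (\<lambda>h. pi (one_e_case A P h) (\<lambda>q. pi A (\<lambda>x. pi A (\<lambda>y.
       Idt (Idt (P \<cdot> one_f A y)
              (transport (one A) P (one_f A x) (one_f A y) (one_e A x y) \<cdot> (h \<cdot> x)) (h \<cdot> y))
         (apd (one A) P (cst cOne_ind \<cdot> A \<cdot> P \<cdot> h \<cdot> q) (one_f A x) (one_f A y) (one_e A x y))
         (q \<cdot> x \<cdot> y)))))))))"

| "const_type T cColim (raw (pi (cst cNat \<rightarrowtriangle> univ i) (\<lambda>A. colim_map A \<rightarrowtriangle> univ i)))"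
| "const_type T cColim_i (raw (pi (cst cNat \<rightarrowtriangle> univ i) (\<lambda>A. pi (colim_map A) (\<lambda>f.
     pi (cst cNat) (\<lambda>n. A \<cdot> n \<rightarrowtriangle> colim A f)))))"
| "const_type T cColim_g (raw (pi (cst cNat \<rightarrowtriangle> univ i) (\<lambda>A. pi (colim_map A) (\<lambda>f.
     pi (cst cNat) (\<lambda>n. pi (A \<cdot> n) (\<lambda>a. Idt (colim A f)
       (colim_i A f (cst cSucc \<cdot> n) \<cdot> (f \<cdot> n \<cdot> a)) (colim_i A f n \<cdot> a)))))))"
| "const_type T cColim_ind (raw (pi (cst cNat \<rightarrowtriangle> univ i) (\<lambda>A. pi (colim_map A) (\<lambda>f.
     pi (colim A f \<rightarrowtriangle> univ j) (\<lambda>P. pi (colim_i_case A f P) (\<lambda>h.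
       colim_g_case A f P h \<rightarrowtriangle> pi (colim A f) (\<lambda>x. P \<cdot> x)))))))"
| "const_type T cColim_path (raw (pi (cst cNat \<rightarrowtriangle> univ i) (\<lambda>A. pi (colim_map A) (\<lambda>f.
     pi (colim A f \<rightarrowtriangle> univ j) (\<lambda>P. pi (colim_i_case A f P) (\<lambda>h.
       pi (colim_g_case A f P h) (\<lambda>q. pi (cst cNat) (\<lambda>n. pi (A \<cdot> n) (\<lambda>a.
         Idt (Idt (P \<cdot> (colim_i A f n \<cdot> a))
                (transport (colim A f) P
                   (colim_i A f (cst cSucc \<cdot> n) \<cdot> (f \<cdot> n \<cdot> a)) (colim_i A f n \<cdot> a)
                   (colim_g A f n a)
                   \<cdot> (h \<cdot> (cst cSucc \<cdot> n) \<cdot> (f \<cdot> n \<cdot> a)))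
                (h \<cdot> n \<cdot> a))
           (apd (colim A f) P (cst cColim_ind \<cdot> A \<cdot> f \<cdot> P \<cdot> h \<cdot> q)
              (colim_i A f (cst cSucc \<cdot> n) \<cdot> (f \<cdot> n \<cdot> a)) (colim_i A f n \<cdot> a) (colim_g A f n a))
           (q \<cdot> n \<cdot> a))))))))))"

| "T = With_Trunc \<Longrightarrow> const_type T cTrunc (raw (univ i \<rightarrowtriangle> univ i))"
| "T = With_Trunc \<Longrightarrow> const_type T cTrunc_in (raw (pi (univ i) (\<lambda>A. A \<rightarrowtriangle> trunc A)))"
| "T = With_Trunc \<Longrightarrow> const_type T cTrunc_eps (raw (pi (univ i) (\<lambda>A.
     pi (trunc A) (\<lambda>x. pi (trunc A) (\<lambda>y. Idt (trunc A) x y)))))"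
| "T = With_Trunc \<Longrightarrow> const_type T cTrunc_ind (raw (pi (univ i) (\<lambda>A.
     pi (trunc A \<rightarrowtriangle> univ j) (\<lambda>P.
       trunc_in_case A P \<rightarrowtriangle> trunc_eps_case A P \<rightarrowtriangle> pi (trunc A) (\<lambda>x. P \<cdot> x)))))"
| "T = With_Trunc \<Longrightarrow> const_type T cTrunc_path (raw (pi (univ i) (\<lambda>A.
     pi (trunc A \<rightarrowtriangle> univ j) (\<lambda>P. pi (trunc_in_case A P) (\<lambda>h. pi (trunc_eps_case A P) (\<lambda>q.
       pi (trunc A) (\<lambda>x. pi (trunc A) (\<lambda>y.
         Idt (Idt (P \<cdot> y)
                (transport (trunc A) P x y (trunc_eps A x y)
                   \<cdot> (cst cTrunc_ind \<cdot> A \<cdot> P \<cdot> h \<cdot> q \<cdot> x))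
                (cst cTrunc_ind \<cdot> A \<cdot> P \<cdot> h \<cdot> q \<cdot> y))
           (apd (trunc A) P (cst cTrunc_ind \<cdot> A \<cdot> P \<cdot> h \<cdot> q) x y (trunc_eps A x y))
           (q \<cdot> x \<cdot> y \<cdot> (cst cTrunc_ind \<cdot> A \<cdot> P \<cdot> h \<cdot> q \<cdot> x)
                  \<cdot> (cst cTrunc_ind \<cdot> A \<cdot> P \<cdot> h \<cdot> q \<cdot> y))))))))))"

section \<open>Judgments\<close>

text \<open>
  Contexts list the most recent variable first. The judgments are: \<open>\<Gamma>\<close> is a context,
  \<open>a\<close> has type \<open>A\<close>, and \<open>a\<close> and \<open>b\<close> are judgmentally equal at type \<open>A\<close>. A type is a
  term of type \<open>U i\<close> for some \<open>i\<close>. Weakening and substitution are admissible but listed, as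
  structural rules, among the primitive ones.
\<close>

inductive
  ctx :: "tt \<Rightarrow> tm list \<Rightarrow> bool" ("_ \<turnstile> _ ctx" [61, 61] 60) and
  typing :: "tt \<Rightarrow> tm list \<Rightarrow> tm \<Rightarrow> tm \<Rightarrow> bool" ("_; _ \<turnstile> _ \<Colon> _" [61, 61, 61, 61] 60) and
  jeq :: "tt \<Rightarrow> tm list \<Rightarrow> tm \<Rightarrow> tm \<Rightarrow> tm \<Rightarrow> bool"
    ("_; _ \<turnstile> _ \<equiv> _ \<Colon> _" [61, 61, 61, 61, 61] 60)
  for T
where
  ctx_empty: "T \<turnstile> [] ctx"
| ctx_ext: "T; \<Gamma> \<turnstile> A \<Colon> U i \<Longrightarrow> T \<turnstile> A # \<Gamma> ctx"

| ty_var: "T \<turnstile> \<Gamma> ctx \<Longrightarrow> n < length \<Gamma> \<Longrightarrow> T; \<Gamma> \<turnstile> Var n \<Colon> (shift 0 ^^ Suc n) (\<Gamma> ! n)"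
| ty_const: "T \<turnstile> \<Gamma> ctx \<Longrightarrow> const_type T c A \<Longrightarrow> T; \<Gamma> \<turnstile> Const c \<Colon> A"
| ty_univ: "T \<turnstile> \<Gamma> ctx \<Longrightarrow> T; \<Gamma> \<turnstile> U i \<Colon> U (Suc i)"
| ty_cumul: "T; \<Gamma> \<turnstile> A \<Colon> U i \<Longrightarrow> T; \<Gamma> \<turnstile> A \<Colon> U (Suc i)"
| ty_pi: "T; \<Gamma> \<turnstile> A \<Colon> U i \<Longrightarrow> T; A # \<Gamma> \<turnstile> B \<Colon> U i \<Longrightarrow> T; \<Gamma> \<turnstile> Pi A B \<Colon> U i"
| ty_lam: "T; A # \<Gamma> \<turnstile> b \<Colon> B \<Longrightarrow> T; \<Gamma> \<turnstile> Lam A b \<Colon> Pi A B"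
| ty_app: "T; \<Gamma> \<turnstile> f \<Colon> Pi A B \<Longrightarrow> T; \<Gamma> \<turnstile> a \<Colon> A \<Longrightarrow> T; \<Gamma> \<turnstile> App f a \<Colon> inst 0 a B"
| ty_conv: "T; \<Gamma> \<turnstile> a \<Colon> A \<Longrightarrow> T; \<Gamma> \<turnstile> A \<equiv> B \<Colon> U i \<Longrightarrow> T; \<Gamma> \<turnstile> a \<Colon> B"
| ty_weaken: "T; \<Gamma> \<turnstile> a \<Colon> A \<Longrightarrow> T; \<Gamma> \<turnstile> B \<Colon> U i \<Longrightarrow> T; B # \<Gamma> \<turnstile> shift 0 a \<Colon> shift 0 A"
| ty_subst: "T; B # \<Gamma> \<turnstile> a \<Colon> A \<Longrightarrow> T; \<Gamma> \<turnstile> b \<Colon> B \<Longrightarrow> T; \<Gamma> \<turnstile> inst 0 b a \<Colon> inst 0 b A"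

| eq_refl: "T; \<Gamma> \<turnstile> a \<Colon> A \<Longrightarrow> T; \<Gamma> \<turnstile> a \<equiv> a \<Colon> A"
| eq_sym: "T; \<Gamma> \<turnstile> a \<equiv> b \<Colon> A \<Longrightarrow> T; \<Gamma> \<turnstile> b \<equiv> a \<Colon> A"
| eq_trans: "T; \<Gamma> \<turnstile> a \<equiv> b \<Colon> A \<Longrightarrow> T; \<Gamma> \<turnstile> b \<equiv> c \<Colon> A \<Longrightarrow> T; \<Gamma> \<turnstile> a \<equiv> c \<Colon> A"
| eq_cumul: "T; \<Gamma> \<turnstile> A \<equiv> B \<Colon> U i \<Longrightarrow> T; \<Gamma> \<turnstile> A \<equiv> B \<Colon> U (Suc i)"
| eq_conv: "T; \<Gamma> \<turnstile> a \<equiv> b \<Colon> A \<Longrightarrow> T; \<Gamma> \<turnstile> A \<equiv> B \<Colon> U i \<Longrightarrow> T; \<Gamma> \<turnstile> a \<equiv> b \<Colon> B"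
| eq_weaken: "T; \<Gamma> \<turnstile> a \<equiv> b \<Colon> A \<Longrightarrow> T; \<Gamma> \<turnstile> B \<Colon> U i \<Longrightarrow>
    T; B # \<Gamma> \<turnstile> shift 0 a \<equiv> shift 0 b \<Colon> shift 0 A"
| eq_subst: "T; B # \<Gamma> \<turnstile> a \<equiv> a' \<Colon> A \<Longrightarrow> T; \<Gamma> \<turnstile> b \<Colon> B \<Longrightarrow>
    T; \<Gamma> \<turnstile> inst 0 b a \<equiv> inst 0 b a' \<Colon> inst 0 b A"
| eq_pi: "T; \<Gamma> \<turnstile> A \<equiv> A' \<Colon> U i \<Longrightarrow> T; A # \<Gamma> \<turnstile> B \<equiv> B' \<Colon> U i \<Longrightarrow>
    T; \<Gamma> \<turnstile> Pi A B \<equiv> Pi A' B' \<Colon> U i"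
| eq_lam: "T; \<Gamma> \<turnstile> A \<equiv> A' \<Colon> U i \<Longrightarrow> T; A # \<Gamma> \<turnstile> b \<equiv> b' \<Colon> B \<Longrightarrow>
    T; \<Gamma> \<turnstile> Lam A b \<equiv> Lam A' b' \<Colon> Pi A B"
| eq_app: "T; \<Gamma> \<turnstile> f \<equiv> f' \<Colon> Pi A B \<Longrightarrow> T; \<Gamma> \<turnstile> a \<equiv> a' \<Colon> A \<Longrightarrow>
    T; \<Gamma> \<turnstile> App f a \<equiv> App f' a' \<Colon> inst 0 a B"
| eq_beta: "T; A # \<Gamma> \<turnstile> b \<Colon> B \<Longrightarrow> T; \<Gamma> \<turnstile> a \<Colon> A \<Longrightarrow>
    T; \<Gamma> \<turnstile> App (Lam A b) a \<equiv> inst 0 a b \<Colon> inst 0 a B"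
| eq_eta: "T; \<Gamma> \<turnstile> f \<Colon> Pi A B \<Longrightarrow> T; \<Gamma> \<turnstile> f \<equiv> Lam A (App (shift 0 f) (Var 0)) \<Colon> Pi A B"

| eq_pair: "T; \<Gamma> \<turnstile> A \<Colon> U i \<Longrightarrow> T; \<Gamma> \<turnstile> B \<Colon> raw (emb A \<rightarrowtriangle> univ i) \<Longrightarrow>
    T; \<Gamma> \<turnstile> C \<Colon> raw (cst cSigma \<cdot> emb A \<cdot> emb B \<rightarrowtriangle> univ j) \<Longrightarrow>
    T; \<Gamma> \<turnstile> c \<Colon> raw (pair_case (emb A) (emb B) (emb C)) \<Longrightarrow>
    T; \<Gamma> \<turnstile> a \<Colon> A \<Longrightarrow> T; \<Gamma> \<turnstile> b \<Colon> App B a \<Longrightarrow>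
    T; \<Gamma> \<turnstile> raw (cst cSigma_ind \<cdot> emb A \<cdot> emb B \<cdot> emb C \<cdot> emb c
                    \<cdot> (cst cPair \<cdot> emb A \<cdot> emb B \<cdot> emb a \<cdot> emb b))
        \<equiv> raw (emb c \<cdot> emb a \<cdot> emb b)
        \<Colon> raw (emb C \<cdot> (cst cPair \<cdot> emb A \<cdot> emb B \<cdot> emb a \<cdot> emb b))"

| eq_inl: "T; \<Gamma> \<turnstile> A \<Colon> U i \<Longrightarrow> T; \<Gamma> \<turnstile> B \<Colon> U i \<Longrightarrow>
    T; \<Gamma> \<turnstile> C \<Colon> raw (cst cSum \<cdot> emb A \<cdot> emb B \<rightarrowtriangle> univ j) \<Longrightarrow>
    T; \<Gamma> \<turnstile> c \<Colon> raw (inl_case (emb A) (emb B) (emb C)) \<Longrightarrow>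
    T; \<Gamma> \<turnstile> d \<Colon> raw (inr_case (emb A) (emb B) (emb C)) \<Longrightarrow>
    T; \<Gamma> \<turnstile> a \<Colon> A \<Longrightarrow>
    T; \<Gamma> \<turnstile> raw (cst cSum_ind \<cdot> emb A \<cdot> emb B \<cdot> emb C \<cdot> emb c \<cdot> emb d
                    \<cdot> (cst cInl \<cdot> emb A \<cdot> emb B \<cdot> emb a))
        \<equiv> raw (emb c \<cdot> emb a) \<Colon> raw (emb C \<cdot> (cst cInl \<cdot> emb A \<cdot> emb B \<cdot> emb a))"
| eq_inr: "T; \<Gamma> \<turnstile> A \<Colon> U i \<Longrightarrow> T; \<Gamma> \<turnstile> B \<Colon> U i \<Longrightarrow>
    T; \<Gamma> \<turnstile> C \<Colon> raw (cst cSum \<cdot> emb A \<cdot> emb B \<rightarrowtriangle> univ j) \<Longrightarrow>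
    T; \<Gamma> \<turnstile> c \<Colon> raw (inl_case (emb A) (emb B) (emb C)) \<Longrightarrow>
    T; \<Gamma> \<turnstile> d \<Colon> raw (inr_case (emb A) (emb B) (emb C)) \<Longrightarrow>
    T; \<Gamma> \<turnstile> b \<Colon> B \<Longrightarrow>
    T; \<Gamma> \<turnstile> raw (cst cSum_ind \<cdot> emb A \<cdot> emb B \<cdot> emb C \<cdot> emb c \<cdot> emb d
                    \<cdot> (cst cInr \<cdot> emb A \<cdot> emb B \<cdot> emb b))
        \<equiv> raw (emb d \<cdot> emb b) \<Colon> raw (emb C \<cdot> (cst cInr \<cdot> emb A \<cdot> emb B \<cdot> emb b))"

| eq_star: "T; \<Gamma> \<turnstile> C \<Colon> raw (cst cUnit \<rightarrowtriangle> univ j) \<Longrightarrow> T; \<Gamma> \<turnstile> c \<Colon> raw (emb C \<cdot> cst cStar) \<Longrightarrow>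
    T; \<Gamma> \<turnstile> raw (cst cUnit_ind \<cdot> emb C \<cdot> emb c \<cdot> cst cStar) \<equiv> c \<Colon> raw (emb C \<cdot> cst cStar)"

| eq_zero: "T; \<Gamma> \<turnstile> C \<Colon> raw (cst cNat \<rightarrowtriangle> univ j) \<Longrightarrow> T; \<Gamma> \<turnstile> c \<Colon> raw (emb C \<cdot> cst cZero) \<Longrightarrow>
    T; \<Gamma> \<turnstile> s \<Colon> raw (succ_case (emb C)) \<Longrightarrow>
    T; \<Gamma> \<turnstile> raw (cst cNat_ind \<cdot> emb C \<cdot> emb c \<cdot> emb s \<cdot> cst cZero) \<equiv> c \<Colon> raw (emb C \<cdot> cst cZero)"
| eq_succ: "T; \<Gamma> \<turnstile> C \<Colon> raw (cst cNat \<rightarrowtriangle> univ j) \<Longrightarrow> T; \<Gamma> \<turnstile> c \<Colon> raw (emb C \<cdot> cst cZero) \<Longrightarrow>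
    T; \<Gamma> \<turnstile> s \<Colon> raw (succ_case (emb C)) \<Longrightarrow> T; \<Gamma> \<turnstile> n \<Colon> Const cNat \<Longrightarrow>
    T; \<Gamma> \<turnstile> raw (cst cNat_ind \<cdot> emb C \<cdot> emb c \<cdot> emb s \<cdot> (cst cSucc \<cdot> emb n))
        \<equiv> raw (emb s \<cdot> emb n \<cdot> (cst cNat_ind \<cdot> emb C \<cdot> emb c \<cdot> emb s \<cdot> emb n))
        \<Colon> raw (emb C \<cdot> (cst cSucc \<cdot> emb n))"

| eq_id: "T; \<Gamma> \<turnstile> A \<Colon> U i \<Longrightarrow> T; \<Gamma> \<turnstile> C \<Colon> raw (id_motive j (emb A)) \<Longrightarrow>
    T; \<Gamma> \<turnstile> c \<Colon> raw (refl_case (emb A) (emb C)) \<Longrightarrow> T; \<Gamma> \<turnstile> a \<Colon> A \<Longrightarrow>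
    T; \<Gamma> \<turnstile> raw (cst cId_ind \<cdot> emb A \<cdot> emb C \<cdot> emb c \<cdot> emb a \<cdot> emb a \<cdot> id_refl (emb A) (emb a))
        \<equiv> raw (emb c \<cdot> emb a) \<Colon> raw (emb C \<cdot> emb a \<cdot> emb a \<cdot> id_refl (emb A) (emb a))"

| eq_one: "T; \<Gamma> \<turnstile> A \<Colon> U i \<Longrightarrow> T; \<Gamma> \<turnstile> P \<Colon> raw (one (emb A) \<rightarrowtriangle> univ j) \<Longrightarrow>
    T; \<Gamma> \<turnstile> h \<Colon> raw (one_f_case (emb A) (emb P)) \<Longrightarrow>
    T; \<Gamma> \<turnstile> q \<Colon> raw (one_e_case (emb A) (emb P) (emb h)) \<Longrightarrow> T; \<Gamma> \<turnstile> a \<Colon> A \<Longrightarrow>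
    T; \<Gamma> \<turnstile> raw (cst cOne_ind \<cdot> emb A \<cdot> emb P \<cdot> emb h \<cdot> emb q \<cdot> one_f (emb A) (emb a))
        \<equiv> raw (emb h \<cdot> emb a) \<Colon> raw (emb P \<cdot> one_f (emb A) (emb a))"

| eq_colim: "T; \<Gamma> \<turnstile> A \<Colon> raw (cst cNat \<rightarrowtriangle> univ i) \<Longrightarrow> T; \<Gamma> \<turnstile> f \<Colon> raw (colim_map (emb A)) \<Longrightarrow>
    T; \<Gamma> \<turnstile> P \<Colon> raw (colim (emb A) (emb f) \<rightarrowtriangle> univ j) \<Longrightarrow>
    T; \<Gamma> \<turnstile> h \<Colon> raw (colim_i_case (emb A) (emb f) (emb P)) \<Longrightarrow>
    T; \<Gamma> \<turnstile> q \<Colon> raw (colim_g_case (emb A) (emb f) (emb P) (emb h)) \<Longrightarrow>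
    T; \<Gamma> \<turnstile> n \<Colon> Const cNat \<Longrightarrow> T; \<Gamma> \<turnstile> a \<Colon> App A n \<Longrightarrow>
    T; \<Gamma> \<turnstile> raw (cst cColim_ind \<cdot> emb A \<cdot> emb f \<cdot> emb P \<cdot> emb h \<cdot> emb q
                    \<cdot> (colim_i (emb A) (emb f) (emb n) \<cdot> emb a))
        \<equiv> raw (emb h \<cdot> emb n \<cdot> emb a)
        \<Colon> raw (emb P \<cdot> (colim_i (emb A) (emb f) (emb n) \<cdot> emb a))"

| eq_trunc: "T = With_Trunc \<Longrightarrow>
    T; \<Gamma> \<turnstile> A \<Colon> U i \<Longrightarrow> T; \<Gamma> \<turnstile> P \<Colon> raw (trunc (emb A) \<rightarrowtriangle> univ j) \<Longrightarrow>
    T; \<Gamma> \<turnstile> h \<Colon> raw (trunc_in_case (emb A) (emb P)) \<Longrightarrow>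
    T; \<Gamma> \<turnstile> q \<Colon> raw (trunc_eps_case (emb A) (emb P)) \<Longrightarrow> T; \<Gamma> \<turnstile> a \<Colon> A \<Longrightarrow>
    T; \<Gamma> \<turnstile> raw (cst cTrunc_ind \<cdot> emb A \<cdot> emb P \<cdot> emb h \<cdot> emb q \<cdot> trunc_in (emb A) (emb a))
        \<equiv> raw (emb h \<cdot> emb a) \<Colon> raw (emb P \<cdot> trunc_in (emb A) (emb a))"

section \<open>The iterated one-step truncation and its colimit\<close>

text \<open>For \<open>A : U i\<close>: \<open>iter i A n\<close> is the \<open>n\<close>-fold one-step truncation of \<open>A\<close>, defined by
  recursion on the internal natural number \<open>n\<close> into \<open>U i\<close>; \<open>one_inf i A\<close> is its colimit and
  \<open>inf_i0 i A\<close> the map from \<open>A\<close> to it.\<close>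

definition iter :: "nat \<Rightarrow> scoped \<Rightarrow> scoped \<Rightarrow> scoped" where
  "iter i A n = cst cNat_ind \<cdot> fn (cst cNat) (\<lambda>_. univ i) \<cdot> A
                  \<cdot> fn (cst cNat) (\<lambda>_. fn (univ i) (\<lambda>X. one X)) \<cdot> n"

definition iter_seq :: "nat \<Rightarrow> scoped \<Rightarrow> scoped" where
  "iter_seq i A = fn (cst cNat) (\<lambda>n. iter i A n)"

definition iter_map :: "nat \<Rightarrow> scoped \<Rightarrow> scoped" where
  "iter_map i A = fn (cst cNat) (\<lambda>n. fn (iter i A n) (\<lambda>x. one_f (iter i A n) x))"

definition one_inf :: "nat \<Rightarrow> scoped \<Rightarrow> scoped" where
  "one_inf i A = colim (iter_seq i A) (iter_map i A)"

definition inf_i0 :: "nat \<Rightarrow> scoped \<Rightarrow> scoped" where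
  "inf_i0 i A = colim_i (iter_seq i A) (iter_map i A) (cst cZero)"

end

theory Submission
  imports Defs
begin

text \<open>
  Why \<open>{A}\<^sub>\<infinity>\<close> is the propositional truncation. The maps of the sequence \<open>{A}\<^sub>n\<close> are weakly constant:
  the constructor \<open>e\<close> gives a path between any two values. It has to be shown that the colimit \<open>X\<close>
  of the sequence is a mere proposition, and that one can eliminate from it into families of mere
  propositions. The elimination is simple: by recursion on \<open>n\<close> the given function on \<open>A\<close> is extended
  to all \<open>{A}\<^sub>n\<close>, the method for \<open>e\<close> being free of charge in a mere proposition, and so is the
  coherence along the paths \<open>g\<close> of the colimit. On \<open>A = {A}\<^sub>0\<close> the recursion returns the given
  function judgmentally, which is the computation rule (\<open>colim_elim\<close>).

  For the first claim, the type \<open>\<Pi>y. x = y\<close> is a mere proposition for every \<open>x : X\<close>, by function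
  extensionality (\<open>isprop_paths\<close>). By the elimination just described it is therefore enough to
  inhabit it for \<open>x = i 0 a\<close>, that is, to give a section of the family \<open>i 0 a = y\<close> over \<open>y : X\<close>. More
  generally, an element of \<open>Q (i 0 a)\<close> extends to a section of an arbitrary family \<open>Q\<close> over \<open>X\<close>
  (\<open>extension\<close>): transport the element up to level \<open>n + 1\<close>, move it there from the image of \<open>a\<close> to the
  image of \<open>x : {A}\<^sub>n\<close> along the weak constancy, and come back to level \<open>n\<close> along \<open>g\<close>. These values fit
  together because transport along \<open>g\<close> is natural (\<open>naturality\<close>, \<open>coherence\<close>). Naturality is
  proved by path induction, and this works because the paths of weak constancy can be corrected to
  be reflexivity on the diagonal: replace \<open>e(x, y)\<close> by \<open>e(x, x)\<inverse> \<cdot> e(x, y)\<close>. If there is a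
  propositional truncation as well, both types are mere propositions with maps in both
  directions, so they are equivalent (\<open>trunc_equiv\<close>).

  How this becomes a derivation. The theorem asserts that certain judgments are derivable, and
  the derivations are far too large to be written down. They are replaced by computation: a
  type checker for the fragment of the theory that is needed is defined as a function, and it
  is proved that each positive answer yields derivable judgments (\<open>run_sound\<close>). Whether the
  checker is complete or terminates is irrelevant, since only finitely many runs with a bounded recursion
  depth are used. Soundness is stated for the interpretations of the terms under all well-typed
  substitutions. This has two advantages: no metatheorem on the type theory is required, such as
  injectivity of product types or confluence, and one run for a type variable \<open>A\<close> serves for all types
  \<open>A\<close> over all contexts. The proof above is then written as a table of proof terms, each
  of which is accepted by the checker, and the theorem is read off from a few further runs.
\<close>

section \<open>A type checker\<close>

text \<open>
  A universe code \<open>0\<close> or \<open>1\<close> stands for one of two arbitrary levels \<open>i\<close> and \<open>j\<close>, which are the levels of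
  the type \<open>A\<close> and of the family \<open>P\<close> of the theorem, and a code \<open>k + 2\<close> for the level
  \<open>max i j + 1 + k\<close>. So \<open>0\<close> and \<open>1\<close> are incomparable, and both are below \<open>2\<close>. With these codes one run
  of the checker covers all universe levels.

  Code is evaluated by rewriting, where only the condition of \<open>if\<close> and the scrutinee of \<open>case\<close>
  are evaluated first. This is why conjunctions below are written as nested conditionals.
\<close>

definition level_suc :: "nat \<Rightarrow> nat" where "level_suc n = (if n < 2 then 2 else Suc n)"
definition level_le :: "nat \<Rightarrow> nat \<Rightarrow> bool" where "level_le a b = (if a = b then True else if 2 \<le> b then a \<le> b else False)"
definition level_max :: "nat \<Rightarrow> nat \<Rightarrow> nat" where "level_max a b = (if a = b then a else max 2 (max a b))"

primrec lift :: "nat \<Rightarrow> nat \<Rightarrow> tm \<Rightarrow> tm" where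
  "lift m k (Var n) = (if n < k then Var n else Var (n + m))"
| "lift m k (U i) = U i"
| "lift m k (Pi A B) = Pi (lift m k A) (lift m (Suc k) B)"
| "lift m k (Lam A b) = Lam (lift m k A) (lift m (Suc k) b)"
| "lift m k (App f a) = App (lift m k f) (lift m k a)"
| "lift m k (Const c) = Const c"

text \<open>
  \<open>plug xs p 0 t\<close> substitutes the list \<open>xs\<close> for the first variables of \<open>t\<close>. The other variables of \<open>t\<close>
  are raised by \<open>p\<close>: this is \<open>0\<close> when \<open>t\<close> lives over the current context, and the length of the
  current context when \<open>t\<close> is the body of a global definition.
\<close>

primrec pick :: "tm list \<Rightarrow> nat \<Rightarrow> nat \<Rightarrow> nat \<Rightarrow> tm" where
  "pick [] p k n = Var (n + (p + k))"
| "pick (x # xs) p k n = (case n of 0 \<Rightarrow> lift k 0 x | Suc m \<Rightarrow> pick xs p k m)"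

primrec plug :: "tm list \<Rightarrow> nat \<Rightarrow> nat \<Rightarrow> tm \<Rightarrow> tm" where
  "plug xs p k (Var n) = (if n < k then Var n else pick xs p k (n - k))"
| "plug xs p k (U i) = U i"
| "plug xs p k (Pi A B) = Pi (plug xs p k A) (plug xs p (Suc k) B)"
| "plug xs p k (Lam A b) = Lam (plug xs p k A) (plug xs p (Suc k) b)"
| "plug xs p k (App f a) = App (plug xs p k f) (plug xs p k a)"
| "plug xs p k (Const c) = Const c"

primrec spine :: "tm \<Rightarrow> tm list \<Rightarrow> tm \<times> tm list" where
  "spine (App f a) xs = spine f (a # xs)"
| "spine (Var n) xs = (Var n, xs)"
| "spine (U n) xs = (U n, xs)"
| "spine (Pi A B) xs = (Pi A B, xs)"
| "spine (Lam A b) xs = (Lam A b, xs)"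
| "spine (Const c) xs = (Const c, xs)"

text \<open>
  A constant has a type for every choice of levels; the checker uses the one at code \<open>2\<close>, which is
  enough by cumulativity, except that the natural numbers are put into the universe of code \<open>0\<close>.
  Only the type former \<open>{-}\<close> needs its finer typing, because it is iterated
  inside \<open>U i\<close>; the functions \<open>infer\<close> and \<open>equal_parts\<close> treat its application separately.
\<close>

definition const_ty :: "tt \<Rightarrow> const \<Rightarrow> tm option" where
  "const_ty w c = (case c of
     cSigma \<Rightarrow> Some (raw (pi (univ 2) (\<lambda>A. (A \<rightarrowtriangle> univ 2) \<rightarrowtriangle> univ 2)))
   | cPair \<Rightarrow> Some (raw (pi (univ 2) (\<lambda>A. pi (A \<rightarrowtriangle> univ 2) (\<lambda>B. pi A (\<lambda>a. B \<cdot> a \<rightarrowtriangle> cst cSigma \<cdot> A \<cdot> B)))))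
   | cSigma_ind \<Rightarrow> Some (raw (pi (univ 2) (\<lambda>A. pi (A \<rightarrowtriangle> univ 2) (\<lambda>B.
     pi (cst cSigma \<cdot> A \<cdot> B \<rightarrowtriangle> univ 2) (\<lambda>C.
       pair_case A B C \<rightarrowtriangle> pi (cst cSigma \<cdot> A \<cdot> B) (\<lambda>p. C \<cdot> p))))))
   | cNat \<Rightarrow> Some (U 0)
   | cZero \<Rightarrow> Some (Const cNat)
   | cSucc \<Rightarrow> Some (raw (cst cNat \<rightarrowtriangle> cst cNat))
   | cNat_ind \<Rightarrow> Some (raw (pi (cst cNat \<rightarrowtriangle> univ 2) (\<lambda>C.
     C \<cdot> cst cZero \<rightarrowtriangle> succ_case C \<rightarrowtriangle> pi (cst cNat) (\<lambda>n. C \<cdot> n))))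
   | cId \<Rightarrow> Some (raw (pi (univ 2) (\<lambda>A. A \<rightarrowtriangle> A \<rightarrowtriangle> univ 2)))
   | cRefl \<Rightarrow> Some (raw (pi (univ 2) (\<lambda>A. pi A (\<lambda>x. Idt A x x))))
   | cId_ind \<Rightarrow> Some (raw (pi (univ 2) (\<lambda>A. pi (id_motive 2 A) (\<lambda>C.
     refl_case A C \<rightarrowtriangle> pi A (\<lambda>x. pi A (\<lambda>y. pi (Idt A x y) (\<lambda>p. C \<cdot> x \<cdot> y \<cdot> p)))))))
   | cFunext \<Rightarrow> Some (raw (pi (univ 2) (\<lambda>A. pi (A \<rightarrowtriangle> univ 2) (\<lambda>B.
     pi (pi A (\<lambda>x. B \<cdot> x)) (\<lambda>f. pi (pi A (\<lambda>x. B \<cdot> x)) (\<lambda>g.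
       isequiv (Idt (pi A (\<lambda>x. B \<cdot> x)) f g) (pi A (\<lambda>x. Idt (B \<cdot> x) (f \<cdot> x) (g \<cdot> x)))
         (happly A B f g)))))))
   | cOne \<Rightarrow> Some (raw (univ 2 \<rightarrowtriangle> univ 2))
   | cOne_f \<Rightarrow> Some (raw (pi (univ 2) (\<lambda>A. A \<rightarrowtriangle> one A)))
   | cOne_e \<Rightarrow> Some (raw (pi (univ 2) (\<lambda>A. pi A (\<lambda>x. pi A (\<lambda>y. Idt (one A) (one_f A x) (one_f A y))))))
   | cOne_ind \<Rightarrow> Some (raw (pi (univ 2) (\<lambda>A. pi (one A \<rightarrowtriangle> univ 2) (\<lambda>P.
     pi (one_f_case A P) (\<lambda>h. one_e_case A P h \<rightarrowtriangle> pi (one A) (\<lambda>x. P \<cdot> x))))))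
   | cColim \<Rightarrow> Some (raw (pi (cst cNat \<rightarrowtriangle> univ 2) (\<lambda>A. colim_map A \<rightarrowtriangle> univ 2)))
   | cColim_i \<Rightarrow> Some (raw (pi (cst cNat \<rightarrowtriangle> univ 2) (\<lambda>A. pi (colim_map A) (\<lambda>f.
     pi (cst cNat) (\<lambda>n. A \<cdot> n \<rightarrowtriangle> colim A f)))))
   | cColim_g \<Rightarrow> Some (raw (pi (cst cNat \<rightarrowtriangle> univ 2) (\<lambda>A. pi (colim_map A) (\<lambda>f.
     pi (cst cNat) (\<lambda>n. pi (A \<cdot> n) (\<lambda>a. Idt (colim A f)
       (colim_i A f (cst cSucc \<cdot> n) \<cdot> (f \<cdot> n \<cdot> a)) (colim_i A f n \<cdot> a)))))))
   | cColim_ind \<Rightarrow> Some (raw (pi (cst cNat \<rightarrowtriangle> univ 2) (\<lambda>A. pi (colim_map A) (\<lambda>f.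
     pi (colim A f \<rightarrowtriangle> univ 2) (\<lambda>P. pi (colim_i_case A f P) (\<lambda>h.
       colim_g_case A f P h \<rightarrowtriangle> pi (colim A f) (\<lambda>x. P \<cdot> x)))))))
   | cTrunc \<Rightarrow> (case w of With_Trunc \<Rightarrow> Some (raw (univ 2 \<rightarrowtriangle> univ 2)) | _ \<Rightarrow> None)
   | cTrunc_in \<Rightarrow> (case w of With_Trunc \<Rightarrow> Some (raw (pi (univ 2) (\<lambda>A. A \<rightarrowtriangle> trunc A))) | _ \<Rightarrow> None)
   | cTrunc_eps \<Rightarrow> (case w of With_Trunc \<Rightarrow> Some (raw (pi (univ 2) (\<lambda>A.
       pi (trunc A) (\<lambda>x. pi (trunc A) (\<lambda>y. Idt (trunc A) x y))))) | _ \<Rightarrow> None)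
   | cTrunc_ind \<Rightarrow> (case w of With_Trunc \<Rightarrow> Some (raw (pi (univ 2) (\<lambda>A.
     pi (trunc A \<rightarrowtriangle> univ 2) (\<lambda>P.
       trunc_in_case A P \<rightarrowtriangle> trunc_eps_case A P \<rightarrowtriangle> pi (trunc A) (\<lambda>x. P \<cdot> x))))) | _ \<Rightarrow> None)
   | _ \<Rightarrow> None)"

text \<open>The number of arguments of an eliminator before the one that it inspects. Only the eliminators
  with a computation rule that the proof terms rely on are listed.\<close>

fun arity :: "const \<Rightarrow> nat option" where
  "arity cId_ind = Some 5"
| "arity cNat_ind = Some 3"
| "arity cSigma_ind = Some 4"
| "arity cColim_ind = Some 5"
| "arity _ = None"

text \<open>
  An instance of a computation rule is given as \<open>(s, ps, A, u)\<close>: the equation \<open>s \<equiv> u : A\<close> and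
  its premises \<open>ps\<close>, to be read as typings. The left side \<open>s\<close> is rebuilt from the parameters of the
  eliminator, since a constructor in the term at hand may carry different, although
  judgmentally equal, parameters.
\<close>

type_synonym redex = "tm \<times> (tm \<times> tm) list \<times> tm \<times> tm"

definition id_redex :: "tm list \<Rightarrow> tm \<Rightarrow> redex option" where
  "id_redex xs p = (case xs of [A, C, c, x, y] \<Rightarrow> (case p of App q z \<Rightarrow> (case q of App h B \<Rightarrow> if h = Const cRefl then
      Some (raw (cst cId_ind \<cdot> emb A \<cdot> emb C \<cdot> emb c \<cdot> emb x \<cdot> emb x \<cdot> id_refl (emb A) (emb x)),
         [(A, U 2), (C, raw (id_motive 2 (emb A))), (c, raw (refl_case (emb A) (emb C))), (x, A)],
         raw (emb C \<cdot> emb x \<cdot> emb x \<cdot> id_refl (emb A) (emb x)), raw (emb c \<cdot> emb x))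
      else None | _ \<Rightarrow> None) | _ \<Rightarrow> None) | _ \<Rightarrow> None)"

definition nat_redex :: "tm list \<Rightarrow> tm \<Rightarrow> redex option" where
  "nat_redex xs n = (case xs of [C, c, s] \<Rightarrow> (case n of
      Const z \<Rightarrow> if z = cZero then
         Some (raw (cst cNat_ind \<cdot> emb C \<cdot> emb c \<cdot> emb s \<cdot> cst cZero),
           [(C, raw (cst cNat \<rightarrowtriangle> univ 2)), (c, raw (emb C \<cdot> cst cZero)), (s, raw (succ_case (emb C)))],
           raw (emb C \<cdot> cst cZero), c) else None
    | App h m \<Rightarrow> if h = Const cSucc then
         Some (raw (cst cNat_ind \<cdot> emb C \<cdot> emb c \<cdot> emb s \<cdot> (cst cSucc \<cdot> emb m)),
           [(C, raw (cst cNat \<rightarrowtriangle> univ 2)), (c, raw (emb C \<cdot> cst cZero)), (s, raw (succ_case (emb C))), (m, Const cNat)],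
           raw (emb C \<cdot> (cst cSucc \<cdot> emb m)),
           raw (emb s \<cdot> emb m \<cdot> (cst cNat_ind \<cdot> emb C \<cdot> emb c \<cdot> emb s \<cdot> emb m))) else None
    | _ \<Rightarrow> None) | _ \<Rightarrow> None)"

definition sigma_redex :: "tm list \<Rightarrow> tm \<Rightarrow> redex option" where
  "sigma_redex xs p = (case xs of [A, B, C, c] \<Rightarrow> (case spine p [] of (h, ys) \<Rightarrow> if h = Const cPair then
      (case ys of [A', B', a, b] \<Rightarrow>
      Some (raw (cst cSigma_ind \<cdot> emb A \<cdot> emb B \<cdot> emb C \<cdot> emb c \<cdot> (cst cPair \<cdot> emb A \<cdot> emb B \<cdot> emb a \<cdot> emb b)),
         [(A, U 2), (B, raw (emb A \<rightarrowtriangle> univ 2)), (C, raw (cst cSigma \<cdot> emb A \<cdot> emb B \<rightarrowtriangle> univ 2)),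
          (c, raw (pair_case (emb A) (emb B) (emb C))), (a, A), (b, App B a)],
         raw (emb C \<cdot> (cst cPair \<cdot> emb A \<cdot> emb B \<cdot> emb a \<cdot> emb b)),
         raw (emb c \<cdot> emb a \<cdot> emb b)) | _ \<Rightarrow> None)
      else None) | _ \<Rightarrow> None)"

definition colim_redex :: "tm list \<Rightarrow> tm \<Rightarrow> redex option" where
  "colim_redex xs p = (case xs of [A, f, P, h, q] \<Rightarrow> (case spine p [] of (k, ys) \<Rightarrow> if k = Const cColim_i then
      (case ys of [A', f', n, a] \<Rightarrow>
      Some (raw (cst cColim_ind \<cdot> emb A \<cdot> emb f \<cdot> emb P \<cdot> emb h \<cdot> emb q \<cdot> (colim_i (emb A) (emb f) (emb n) \<cdot> emb a)),
         [(A, raw (cst cNat \<rightarrowtriangle> univ 2)), (f, raw (colim_map (emb A))), (P, raw (colim (emb A) (emb f) \<rightarrowtriangle> univ 2)),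
          (h, raw (colim_i_case (emb A) (emb f) (emb P))), (q, raw (colim_g_case (emb A) (emb f) (emb P) (emb h))),
          (n, Const cNat), (a, App A n)],
         raw (emb P \<cdot> (colim_i (emb A) (emb f) (emb n) \<cdot> emb a)),
         raw (emb h \<cdot> emb n \<cdot> emb a)) | _ \<Rightarrow> None)
      else None) | _ \<Rightarrow> None)"

fun redex :: "const \<Rightarrow> tm list \<Rightarrow> tm \<Rightarrow> redex option" where
  "redex cId_ind xs p = id_redex xs p"
| "redex cNat_ind xs p = nat_redex xs p"
| "redex cSigma_ind xs p = sigma_redex xs p"
| "redex cColim_ind xs p = colim_redex xs p"
| "redex _ xs p = None"

text \<open>
  The type checker is written in open recursion: it takes a \<open>runner\<close> that answers the
  recursive questions, and \<open>run\<close> ties the knot with a bound on the depth. Every answer is a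
  term and a type. \<open>Infer t\<close> answers with a type of \<open>t\<close>, \<open>Whnf t\<close> with a reduct of \<open>t\<close> and a type at
  which \<open>t\<close> and the reduct are equal, \<open>Equal s t\<close> with a type at which \<open>s\<close> and \<open>t\<close> are equal.
  \<open>Conv S T\<close> asks whether every term of type \<open>S\<close> has type \<open>T\<close>, and \<open>Equal_at s t A\<close> whether
  \<open>s\<close> and \<open>t\<close> are equal at the given type \<open>A\<close>.

  An environment lists types, and for transparent entries also bodies, of global names. The
  name \<open>n\<close> is the variable \<open>n + length G\<close> over the local context \<open>G\<close>.
\<close>

datatype job = Infer tm | Check tm tm | Conv tm tm | Whnf tm | Equal tm tm | Equal_at tm tm tm

type_synonym env = "nat \<Rightarrow> (tm \<times> tm option) option"
type_synonym runner = "tm list \<Rightarrow> job \<Rightarrow> (tm \<times> tm) option"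

primrec nth_opt :: "'a list \<Rightarrow> nat \<Rightarrow> 'a option" where
  "nth_opt [] n = None"
| "nth_opt (x # xs) n = (case n of 0 \<Rightarrow> Some x | Suc m \<Rightarrow> nth_opt xs m)"

definition lookup :: "env \<Rightarrow> tm list \<Rightarrow> nat \<Rightarrow> tm option" where
  "lookup E G n = (case nth_opt G n of Some A \<Rightarrow> Some (lift (Suc n) 0 A)
     | None \<Rightarrow> (case E (n - length G) of Some (A, d) \<Rightarrow> Some (lift (length G) 0 A) | None \<Rightarrow> None))"

definition unfold :: "env \<Rightarrow> tm list \<Rightarrow> nat \<Rightarrow> (tm \<times> tm) option" where
  "unfold E G n = (if n < length G then None
     else (case E (n - length G) of Some (A, d) \<Rightarrow> (case d of Some e \<Rightarrow> Some (e, A) | None \<Rightarrow> None) | None \<Rightarrow> None))"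

definition reducible :: "env \<Rightarrow> tm list \<Rightarrow> tm \<Rightarrow> bool" where
  "reducible E G t = (case spine t [] of (h, xs) \<Rightarrow> (case h of
      Lam A b \<Rightarrow> (case xs of [] \<Rightarrow> False | _ \<Rightarrow> True)
    | Var n \<Rightarrow> (case unfold E G n of Some _ \<Rightarrow> True | None \<Rightarrow> False)
    | Const c \<Rightarrow> (case arity c of Some m \<Rightarrow> m < length xs | None \<Rightarrow> False)
    | _ \<Rightarrow> False))"

definition to_univ :: "runner \<Rightarrow> tm list \<Rightarrow> tm \<Rightarrow> nat option" where
  "to_univ r G T = (case T of U n \<Rightarrow> Some n
     | _ \<Rightarrow> (case r G (Whnf T) of None \<Rightarrow> None | Some (T', K) \<Rightarrow>
         (case T' of U n \<Rightarrow> (case K of U k \<Rightarrow> Some n | _ \<Rightarrow> None) | _ \<Rightarrow> None)))"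

definition to_pi :: "runner \<Rightarrow> tm list \<Rightarrow> tm \<Rightarrow> (tm \<times> tm) option" where
  "to_pi r G T = (case T of Pi A B \<Rightarrow> Some (A, B)
     | _ \<Rightarrow> (case r G (Whnf T) of None \<Rightarrow> None | Some (T', K) \<Rightarrow>
         (case T' of Pi A B \<Rightarrow> (case K of U k \<Rightarrow> Some (A, B) | _ \<Rightarrow> None) | _ \<Rightarrow> None)))"

definition level_of :: "runner \<Rightarrow> tm list \<Rightarrow> tm \<Rightarrow> nat option" where
  "level_of r G A = (case r G (Infer A) of None \<Rightarrow> None | Some (_, T) \<Rightarrow> to_univ r G T)"

definition join :: "runner \<Rightarrow> tm list \<Rightarrow> tm \<Rightarrow> tm \<Rightarrow> tm option" where
  "join r G S T = (if S = T then Some T else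
     (case (case S of U n \<Rightarrow> True | _ \<Rightarrow> (case T of U n \<Rightarrow> True | _ \<Rightarrow> False)) of
        True \<Rightarrow> (case to_univ r G S of None \<Rightarrow> None | Some m \<Rightarrow>
          (case to_univ r G T of None \<Rightarrow> None | Some n \<Rightarrow> Some (U (level_max m n))))
      | False \<Rightarrow> (case r G (Conv S T) of None \<Rightarrow> None | Some _ \<Rightarrow> Some T)))"

text \<open>
  Reduction has to produce a typing derivation of the contraction, and typing is not known to
  be invertible: from a type of \<open>App (Lam A b) a\<close> one cannot read off that \<open>a : A\<close>. So every
  contraction checks its arguments again. The function \<open>beta_args\<close> contracts the arguments \<open>xs\<close> of
  nested abstractions at once, with the arguments \<open>ys\<close> already consumed kept in a substitution
  that is carried out only at the end; \<open>apply_args\<close> applies a term to the arguments that are left.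
\<close>

primrec apply_args :: "runner \<Rightarrow> tm list \<Rightarrow> tm list \<Rightarrow> tm \<Rightarrow> tm \<Rightarrow> (tm \<times> tm) option" where
  "apply_args r G [] t T = Some (t, T)"
| "apply_args r G (x # xs) t T = (case to_pi r G T of None \<Rightarrow> None | Some (A, B) \<Rightarrow>
     (case r G (Check x A) of None \<Rightarrow> None | Some _ \<Rightarrow> apply_args r G xs (App t x) (plug [x] 0 0 B)))"

primrec beta_args :: "runner \<Rightarrow> tm list \<Rightarrow> nat \<Rightarrow> tm list \<Rightarrow> tm list \<Rightarrow> tm \<Rightarrow> tm \<Rightarrow> (tm \<times> tm) option" where
  "beta_args r G p [] ys t T = Some (plug ys p 0 t, plug ys p 0 T)"
| "beta_args r G p (x # xs) ys t T =
     (case (case t of Lam A b \<Rightarrow> (case T of Pi A' B \<Rightarrow> if A' = A then Some (A, b, B) else None | _ \<Rightarrow> None) | _ \<Rightarrow> None) of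
        Some (A, b, B) \<Rightarrow> (case r G (Check x (plug ys p 0 A)) of None \<Rightarrow> None | Some _ \<Rightarrow> beta_args r G p xs (x # ys) b B)
      | None \<Rightarrow> apply_args r G (x # xs) (plug ys p 0 t) (plug ys p 0 T))"

primrec check_all :: "runner \<Rightarrow> tm list \<Rightarrow> (tm \<times> tm) list \<Rightarrow> bool" where
  "check_all r G [] = True"
| "check_all r G (p # ps) = (case p of (t, T) \<Rightarrow> (case r G (Check t T) of Some _ \<Rightarrow> check_all r G ps | None \<Rightarrow> False))"

primrec apps :: "tm \<Rightarrow> tm list \<Rightarrow> tm" where
  "apps f [] = f"
| "apps f (x # xs) = apps (App f x) xs"

primrec split_args :: "nat \<Rightarrow> tm list \<Rightarrow> tm list \<Rightarrow> (tm list \<times> tm \<times> tm list) option" where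
  "split_args 0 xs ys = (case ys of [] \<Rightarrow> None | y # zs \<Rightarrow> Some (rev xs, y, zs))"
| "split_args (Suc n) xs ys = (case ys of [] \<Rightarrow> None | y # zs \<Rightarrow> split_args n (y # xs) zs)"

definition eliminate :: "runner \<Rightarrow> tm list \<Rightarrow> const \<Rightarrow> tm list \<Rightarrow> tm \<Rightarrow> tm list \<Rightarrow> (tm \<times> tm) option" where
  "eliminate r G c xs a zs = (case redex c xs (case r G (Whnf a) of Some (a', _) \<Rightarrow> a' | None \<Rightarrow> a) of None \<Rightarrow> None
     | Some (s, ps, T, u) \<Rightarrow> (case check_all r G ps of False \<Rightarrow> None | True \<Rightarrow>
         (case (if App (apps (Const c) xs) a = s then Some T else
             (case r G (Equal (App (apps (Const c) xs) a) s) of None \<Rightarrow> None | Some (_, S) \<Rightarrow> join r G S T))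
          of None \<Rightarrow> None | Some R \<Rightarrow> apply_args r G zs u R)))"

definition head_step :: "env \<Rightarrow> runner \<Rightarrow> tm list \<Rightarrow> tm \<Rightarrow> (tm \<times> tm) option" where
  "head_step E r G t = (case spine t [] of (h, xs) \<Rightarrow> (case h of
      Lam A b \<Rightarrow> (case xs of [] \<Rightarrow> None | _ \<Rightarrow>
        (case r G (Infer h) of None \<Rightarrow> None | Some (_, T) \<Rightarrow> beta_args r G 0 xs [] h T))
    | Var n \<Rightarrow> (case unfold E G n of Some (e, A) \<Rightarrow> beta_args r G (length G) xs [] e A | None \<Rightarrow> None)
    | Const c \<Rightarrow> (case arity c of None \<Rightarrow> None | Some m \<Rightarrow>
        (case split_args m [] xs of None \<Rightarrow> None | Some (ys, a, zs) \<Rightarrow> eliminate r G c ys a zs))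
    | _ \<Rightarrow> None))"

definition whnf :: "env \<Rightarrow> runner \<Rightarrow> tm list \<Rightarrow> tm \<Rightarrow> (tm \<times> tm) option" where
  "whnf E r G t = (case head_step E r G t of None \<Rightarrow> None | Some (u, T) \<Rightarrow>
     (case r G (Whnf u) of None \<Rightarrow> Some (u, T) | Some (v, S) \<Rightarrow>
        (case join r G S T of None \<Rightarrow> None | Some R \<Rightarrow> Some (v, R))))"

definition infer :: "tt \<Rightarrow> env \<Rightarrow> runner \<Rightarrow> tm list \<Rightarrow> tm \<Rightarrow> (tm \<times> tm) option" where
  "infer w E r G t = (case t of
      Var n \<Rightarrow> (case lookup E G n of None \<Rightarrow> None | Some A \<Rightarrow> Some (t, A))
    | U n \<Rightarrow> Some (t, U (level_suc n))
    | Pi A B \<Rightarrow> (case level_of r G A of None \<Rightarrow> None | Some m \<Rightarrow>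
        (case level_of r (A # G) B of None \<Rightarrow> None | Some n \<Rightarrow> Some (t, U (level_max m n))))
    | Lam A b \<Rightarrow> (case level_of r G A of None \<Rightarrow> None | Some _ \<Rightarrow>
        (case r (A # G) (Infer b) of None \<Rightarrow> None | Some (_, B) \<Rightarrow> Some (t, Pi A B)))
    | App f a \<Rightarrow> (if f = Const cOne then (case level_of r G a of None \<Rightarrow> None | Some n \<Rightarrow> Some (t, U n)) else
        (case r G (Infer f) of None \<Rightarrow> None | Some (_, F) \<Rightarrow> apply_args r G [a] f F))
    | Const c \<Rightarrow> (case const_ty w c of None \<Rightarrow> None | Some A \<Rightarrow> Some (t, A)))"

definition check :: "runner \<Rightarrow> tm list \<Rightarrow> tm \<Rightarrow> tm \<Rightarrow> (tm \<times> tm) option" where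
  "check r G t T = (case t of
      Lam A b \<Rightarrow> (case to_pi r G T of None \<Rightarrow> None | Some (A', B) \<Rightarrow>
        (case level_of r G A of None \<Rightarrow> None | Some _ \<Rightarrow>
        (case (if A' = A then Some 0 else (case r G (Equal A A') of None \<Rightarrow> None | Some (_, K) \<Rightarrow>
              (case to_univ r G K of None \<Rightarrow> None | Some _ \<Rightarrow> level_of r (A # G) B))) of None \<Rightarrow> None | Some _ \<Rightarrow>
        (case r (A # G) (Check b B) of None \<Rightarrow> None | Some _ \<Rightarrow> Some (t, T)))))
    | _ \<Rightarrow> (case r G (Infer t) of None \<Rightarrow> None | Some (_, S) \<Rightarrow>
        (case r G (Conv S T) of None \<Rightarrow> None | Some _ \<Rightarrow> Some (t, T))))"

definition conv :: "runner \<Rightarrow> tm list \<Rightarrow> tm \<Rightarrow> tm \<Rightarrow> (tm \<times> tm) option" where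
  "conv r G S T = (if S = T then Some (S, T) else
     (case (case S of U n \<Rightarrow> True | _ \<Rightarrow> (case T of U n \<Rightarrow> True | _ \<Rightarrow> False)) of
        True \<Rightarrow> (case to_univ r G S of None \<Rightarrow> None | Some m \<Rightarrow>
          (case to_univ r G T of None \<Rightarrow> None | Some n \<Rightarrow> if level_le m n then Some (S, T) else None))
      | False \<Rightarrow> (case r G (Equal S T) of None \<Rightarrow> None | Some (_, K) \<Rightarrow>
          (case to_univ r G K of None \<Rightarrow> None | Some _ \<Rightarrow> Some (S, T)))))"

text \<open>
  Arguments are compared with \<open>Equal_at\<close>, at the domain of the type of the function. A type that
  is merely found for the arguments could lie in a universe above the domain, and for the
  codomain of a function there is no cumulativity rule by which this could be repaired.
\<close>

definition equal_parts :: "runner \<Rightarrow> tm list \<Rightarrow> tm \<Rightarrow> tm \<Rightarrow> (tm \<times> tm) option" where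
  "equal_parts r G s t = (case s of
      Pi A B \<Rightarrow> (case t of Pi A' B' \<Rightarrow>
        (case r G (Equal A A') of None \<Rightarrow> None | Some (_, K) \<Rightarrow> (case to_univ r G K of None \<Rightarrow> None | Some m \<Rightarrow>
        (case level_of r G A of None \<Rightarrow> None | Some _ \<Rightarrow>
        (case r (A # G) (Equal B B') of None \<Rightarrow> None | Some (_, L) \<Rightarrow> (case to_univ r (A # G) L of None \<Rightarrow> None | Some n \<Rightarrow>
          Some (t, U (level_max m n))))))) | _ \<Rightarrow> None)
    | Lam A b \<Rightarrow> (case t of Lam A' b' \<Rightarrow>
        (case r G (Equal A A') of None \<Rightarrow> None | Some (_, K) \<Rightarrow> (case to_univ r G K of None \<Rightarrow> None | Some m \<Rightarrow>
        (case level_of r G A of None \<Rightarrow> None | Some _ \<Rightarrow>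
        (case r (A # G) (Equal b b') of None \<Rightarrow> None | Some (_, B) \<Rightarrow> Some (t, Pi A B))))) | _ \<Rightarrow> None)
    | App f a \<Rightarrow> (case t of App g b \<Rightarrow>
        (if f = Const cOne then (if g = Const cOne then (case r G (Equal a b) of None \<Rightarrow> None | Some (_, K) \<Rightarrow>
            (case to_univ r G K of None \<Rightarrow> None | Some m \<Rightarrow> Some (t, U m))) else None) else
        (case r G (Equal f g) of None \<Rightarrow> None | Some (_, F) \<Rightarrow> (case to_pi r G F of None \<Rightarrow> None | Some (A, B) \<Rightarrow>
          (case r G (Equal_at a b A) of None \<Rightarrow> None | Some _ \<Rightarrow>
            Some (t, plug [a] 0 0 B))))) | _ \<Rightarrow> None)
    | _ \<Rightarrow> None)"

definition reduce_equal :: "runner \<Rightarrow> tm list \<Rightarrow> tm \<Rightarrow> tm \<Rightarrow> (tm \<times> tm) option" where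
  "reduce_equal r G s t = (case r G (Whnf s) of
      Some (s', S) \<Rightarrow> (case r G (Whnf t) of
          Some (t', T) \<Rightarrow> (case r G (Equal s' t') of None \<Rightarrow> None | Some (_, R) \<Rightarrow>
             (case join r G S R of None \<Rightarrow> None | Some R' \<Rightarrow> (case join r G T R' of None \<Rightarrow> None | Some R'' \<Rightarrow> Some (t, R''))))
        | None \<Rightarrow> (case r G (Equal s' t) of None \<Rightarrow> None | Some (_, R) \<Rightarrow>
             (case join r G S R of None \<Rightarrow> None | Some R' \<Rightarrow> Some (t, R'))))
    | None \<Rightarrow> (case r G (Whnf t) of
          Some (t', T) \<Rightarrow> (case r G (Equal s t') of None \<Rightarrow> None | Some (_, R) \<Rightarrow>
             (case join r G T R of None \<Rightarrow> None | Some R' \<Rightarrow> Some (t, R')))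
        | None \<Rightarrow> None))"

text \<open>
  Reducible terms with the same head are compared part by part before they are reduced. Most of
  the terms that arise are instances of the same transparent entry, and unfolding it is costly.
\<close>

definition equal :: "env \<Rightarrow> runner \<Rightarrow> tm list \<Rightarrow> tm \<Rightarrow> tm \<Rightarrow> (tm \<times> tm) option" where
  "equal E r G s t = (if s = t then r G (Infer s) else
     (case reducible E G s of
        True \<Rightarrow> (case reducible E G t of
            True \<Rightarrow> (if fst (spine s []) = fst (spine t []) then
                (case equal_parts r G s t of Some x \<Rightarrow> Some x | None \<Rightarrow> reduce_equal r G s t)
               else reduce_equal r G s t)
          | False \<Rightarrow> reduce_equal r G s t)
      | False \<Rightarrow> (case reducible E G t of True \<Rightarrow> reduce_equal r G s t | False \<Rightarrow> equal_parts r G s t)))"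

definition equal_at :: "runner \<Rightarrow> tm list \<Rightarrow> tm \<Rightarrow> tm \<Rightarrow> tm \<Rightarrow> (tm \<times> tm) option" where
  "equal_at r G s t A = (if s = t then r G (Check s A) else
     (case (case r G (Equal s t) of None \<Rightarrow> None | Some (_, S) \<Rightarrow> r G (Conv S A)) of
        Some _ \<Rightarrow> Some (t, A)
      | None \<Rightarrow> (case r G (Whnf s) of
          Some (s', S) \<Rightarrow> (case r G (Conv S A) of None \<Rightarrow> None | Some _ \<Rightarrow> r G (Equal_at s' t A))
        | None \<Rightarrow> (case r G (Whnf t) of
            Some (t', S) \<Rightarrow> (case r G (Conv S A) of None \<Rightarrow> None | Some _ \<Rightarrow> r G (Equal_at s t' A))
          | None \<Rightarrow> None))))"

definition step :: "tt \<Rightarrow> env \<Rightarrow> runner \<Rightarrow> runner" where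
  "step w E r G j = (case j of
      Infer t \<Rightarrow> infer w E r G t
    | Check t T \<Rightarrow> check r G t T
    | Conv S T \<Rightarrow> conv r G S T
    | Whnf t \<Rightarrow> whnf E r G t
    | Equal s t \<Rightarrow> equal E r G s t
    | Equal_at s t A \<Rightarrow> equal_at r G s t A)"

primrec run :: "tt \<Rightarrow> env \<Rightarrow> nat \<Rightarrow> runner" where
  "run w E 0 = (\<lambda>_ _. None)"
| "run w E (Suc n) = step w E (run w E n)"

text \<open>Fully applied equations, so that evaluation does not build the function \<open>run w E n\<close> first.\<close>

lemma run_code [code]:
  "run w E 0 G j = None"
  "run w E (Suc n) G j = step w E (run w E n) G j"
  by simp_all

definition checks :: "tt \<Rightarrow> env \<Rightarrow> nat \<Rightarrow> tm list \<Rightarrow> tm \<Rightarrow> tm \<Rightarrow> bool" where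
  "checks w E n G t A = (case run w E n G (Check t A) of None \<Rightarrow> False | Some _ \<Rightarrow> True)"

definition equates :: "tt \<Rightarrow> env \<Rightarrow> nat \<Rightarrow> tm list \<Rightarrow> tm \<Rightarrow> tm \<Rightarrow> tm \<Rightarrow> bool" where
  "equates w E n G s t A = (case run w E n G (Equal s t) of None \<Rightarrow> False | Some (_, S) \<Rightarrow>
     (case run w E n G (Conv S A) of None \<Rightarrow> False | Some _ \<Rightarrow> True))"

definition subsumes :: "tt \<Rightarrow> env \<Rightarrow> nat \<Rightarrow> tm list \<Rightarrow> tm \<Rightarrow> tm \<Rightarrow> bool" where
  "subsumes w E n G A B = (case run w E n G (Conv A B) of None \<Rightarrow> False | Some _ \<Rightarrow> True)"

primrec checks_args :: "tt \<Rightarrow> env \<Rightarrow> nat \<Rightarrow> tm list \<Rightarrow> tm list \<Rightarrow> tm list \<Rightarrow> bool" where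
  "checks_args w E n G [] H = (case H of [] \<Rightarrow> True | _ \<Rightarrow> False)"
| "checks_args w E n G (t # ts) H = (case H of [] \<Rightarrow> False
     | A # K \<Rightarrow> if checks w E n G t (plug ts (length G) 0 A) then checks_args w E n G ts K else False)"

section \<open>Interpretation of checked terms\<close>

lemma shift_shift: "k \<le> l \<Longrightarrow> shift (Suc l) (shift k t) = shift k (shift l t)"
  by (induction t arbitrary: k l) auto

lemma inst_shift: "inst k s (shift k t) = t"
  by (induction t arbitrary: k s) auto

lemma inst_Suc_shift: "k \<le> l \<Longrightarrow> inst (Suc l) (shift k s) (shift k t) = shift k (inst l s t)"
  by (induction t arbitrary: k l s) (auto simp: shift_shift[symmetric])

definition scons :: "tm \<Rightarrow> (nat \<Rightarrow> tm) \<Rightarrow> nat \<Rightarrow> tm" where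
  "scons x \<sigma> n = (case n of 0 \<Rightarrow> x | Suc m \<Rightarrow> \<sigma> m)"

lemma scons_simps [simp]: "scons x \<sigma> 0 = x" "scons x \<sigma> (Suc n) = \<sigma> n"
  by (simp_all add: scons_def)

definition up :: "(nat \<Rightarrow> tm) \<Rightarrow> nat \<Rightarrow> tm" where
  "up \<sigma> = scons (Var 0) (\<lambda>n. shift 0 (\<sigma> n))"

lemma up_simps [simp]: "up \<sigma> 0 = Var 0" "up \<sigma> (Suc n) = shift 0 (\<sigma> n)"
  by (simp_all add: up_def)

text \<open>
  The terms of the checker are read as raw terms: universe codes are replaced by levels, and all
  variables, those of the context as well as the global names, by raw terms. Working with
  arbitrary substitutions throughout makes the results of the checker applicable to arbitrary
  \<open>\<Gamma>\<close>, \<open>A\<close>, \<open>P\<close> and \<open>h\<close> without any metatheory of the type theory.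
\<close>

primrec interp :: "(nat \<Rightarrow> nat) \<Rightarrow> (nat \<Rightarrow> tm) \<Rightarrow> tm \<Rightarrow> tm" where
  "interp \<rho> \<sigma> (Var n) = \<sigma> n"
| "interp \<rho> \<sigma> (U i) = U (\<rho> i)"
| "interp \<rho> \<sigma> (Pi A B) = Pi (interp \<rho> \<sigma> A) (interp \<rho> (up \<sigma>) B)"
| "interp \<rho> \<sigma> (Lam A b) = Lam (interp \<rho> \<sigma> A) (interp \<rho> (up \<sigma>) b)"
| "interp \<rho> \<sigma> (App f a) = App (interp \<rho> \<sigma> f) (interp \<rho> \<sigma> a)"
| "interp \<rho> \<sigma> (Const c) = Const c"

lemma shift_up: "(\<lambda>n. shift (Suc k) (up \<sigma> n)) = up (\<lambda>n. shift k (\<sigma> n))"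
  by (rule ext) (simp add: up_def scons_def shift_shift split: nat.split)

lemma inst_up: "(\<lambda>n. inst (Suc k) (shift 0 s) (up \<sigma> n)) = up (\<lambda>n. inst k s (\<sigma> n))"
  by (rule ext) (simp add: up_def scons_def inst_Suc_shift split: nat.split)

lemma up_raise:
  "(\<lambda>n. up \<sigma> (if n < Suc k then n else n + m)) = up (\<lambda>n. \<sigma> (if n < k then n else n + m))"
  by (rule ext) (auto simp: up_def scons_def split: nat.split)

lemma shift_interp: "shift k (interp \<rho> \<sigma> t) = interp \<rho> (\<lambda>n. shift k (\<sigma> n)) t"
  by (induction t arbitrary: k \<sigma>) (simp_all add: shift_up)

lemma inst_interp: "inst k s (interp \<rho> \<sigma> t) = interp \<rho> (\<lambda>n. inst k s (\<sigma> n)) t"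
  by (induction t arbitrary: k s \<sigma>) (simp_all add: inst_up)

lemma inst_interp_up: "inst 0 a (interp \<rho> (up \<sigma>) t) = interp \<rho> (scons a \<sigma>) t"
proof -
  have "(\<lambda>n. inst 0 a (up \<sigma> n)) = scons a \<sigma>"
    by (rule ext) (simp add: up_def scons_def inst_shift split: nat.split)
  then show ?thesis by (simp add: inst_interp)
qed

lemma interp_lift: "interp \<rho> \<sigma> (lift m k t) = interp \<rho> (\<lambda>n. \<sigma> (if n < k then n else n + m)) t"
  by (induction t arbitrary: k \<sigma>) (simp_all add: up_raise)

lemma shift_eq_lift: "shift k t = lift 1 k t"
  by (induction t arbitrary: k) auto

lemma interp_up_shift [simp]: "interp \<rho> (up \<sigma>) (shift 0 t) = shift 0 (interp \<rho> \<sigma> t)"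
  by (simp add: shift_interp shift_eq_lift[of 0 t] interp_lift)

lemma interp_up_pick: "interp \<rho> (up \<sigma>) (pick xs p (Suc k) n) = shift 0 (interp \<rho> \<sigma> (pick xs p k n))"
  by (induction xs arbitrary: n) (simp_all add: interp_lift shift_interp split: nat.split)

lemma up_pick:
  "(\<lambda>n. if n < Suc k then up \<sigma> n else interp \<rho> (up \<sigma>) (pick xs p (Suc k) (n - Suc k)))
    = up (\<lambda>n. if n < k then \<sigma> n else interp \<rho> \<sigma> (pick xs p k (n - k)))"
  by (rule ext) (auto simp: up_def scons_def interp_up_pick[unfolded up_def] split: nat.split)

lemma interp_plug:
  "interp \<rho> \<sigma> (plug xs p k t)
    = interp \<rho> (\<lambda>n. if n < k then \<sigma> n else interp \<rho> \<sigma> (pick xs p k (n - k))) t"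
  by (induction t arbitrary: k \<sigma>) (simp_all add: up_pick)

primrec bindings :: "(nat \<Rightarrow> nat) \<Rightarrow> (nat \<Rightarrow> tm) \<Rightarrow> nat \<Rightarrow> tm list \<Rightarrow> nat \<Rightarrow> tm" where
  "bindings \<rho> \<sigma> p [] = (\<lambda>n. \<sigma> (n + p))"
| "bindings \<rho> \<sigma> p (x # xs) = scons (interp \<rho> \<sigma> x) (bindings \<rho> \<sigma> p xs)"

lemma interp_plug_0: "interp \<rho> \<sigma> (plug xs p 0 t) = interp \<rho> (bindings \<rho> \<sigma> p xs) t"
proof -
  have "interp \<rho> \<sigma> (pick xs p 0 n) = bindings \<rho> \<sigma> p xs n" for n
    by (induction xs arbitrary: n) (auto simp: scons_def interp_lift split: nat.split)
  then show ?thesis by (simp add: interp_plug)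
qed

lemma apps_spine: "spine t ys = (h, xs) \<Longrightarrow> apps t ys = apps h xs"
proof (induction t arbitrary: ys)
  case (App f a) from App.IH(1)[of "a # ys"] App.prems show ?case by simp
qed simp_all

lemma interp_apps: "interp \<rho> \<sigma> (apps t xs) = apps (interp \<rho> \<sigma> t) (map (interp \<rho> \<sigma>) xs)"
  by (induction xs arbitrary: t) auto

lemma apps_append: "apps t (xs @ ys) = apps (apps t xs) ys"
  by (induction xs arbitrary: t) auto

lemma split_args_append: "split_args n xs ys = Some (us, a, zs) \<Longrightarrow> rev xs @ ys = us @ a # zs"
proof (induction n arbitrary: xs ys)
  case (Suc n)
  then obtain y ys' where "ys = y # ys'" "split_args n (y # xs) ys' = Some (us, a, zs)" by (auto split: list.splits)
  with Suc.IH[of "y # xs" ys'] show ?case by simp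
qed (auto split: list.splits)

lemma nth_opt_nth: "nth_opt xs n = (if n < length xs then Some (xs ! n) else None)"
  by (induction xs arbitrary: n) (auto split: nat.split)

section \<open>Soundness of the checker\<close>

lemmas hoas = raw_def fn_def pi_def ap_def bind_def emb_def cst_def univ_def arr_def Idt_def id_refl_def path_ind_def transport_def
  sigma_def pr1_def isprop_def hProp_def underlying_def isequiv_def equivalence_def happly_def one_def one_f_def one_e_def
  one_f_case_def one_e_case_def colim_map_def colim_def colim_i_def colim_g_def colim_i_case_def colim_g_case_def
  trunc_def trunc_in_def trunc_eps_def trunc_in_case_def trunc_eps_case_def
  pair_case_def inl_case_def inr_case_def succ_case_def id_motive_def refl_case_def
  iter_def iter_seq_def iter_map_def one_inf_def inf_i0_def

text \<open>Rules in which the terms are spelled out, so that they match interpreted terms.\<close>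

lemmas const_type_raw = const_type.intros[unfolded hoas diff_Suc_Suc minus_nat.diff_0]

locale levels =
  fixes T :: tt and i j :: nat
begin

definition \<rho> :: "nat \<Rightarrow> nat" where
  "\<rho> n = (case n of 0 \<Rightarrow> i | Suc m \<Rightarrow> (case m of 0 \<Rightarrow> j | Suc k \<Rightarrow> Suc (max i j) + k))"

lemma \<rho>_simps [simp]: "\<rho> 0 = i" "\<rho> (Suc 0) = j" "\<rho> (Suc (Suc k)) = Suc (max i j) + k"
  by (simp_all add: \<rho>_def)

lemma \<rho>_level_le: "level_le m n \<Longrightarrow> \<rho> m \<le> \<rho> n"
  by (auto simp: level_le_def \<rho>_def split: nat.splits if_splits)

lemma \<rho>_level_suc: "Suc (\<rho> n) \<le> \<rho> (level_suc n)"
  by (auto simp: level_suc_def \<rho>_def numeral_2_eq_2 split: nat.splits if_splits)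

lemma \<rho>_level_max: "\<rho> m \<le> \<rho> (level_max m n)" "\<rho> n \<le> \<rho> (level_max m n)"
  by (auto intro!: \<rho>_level_le simp: level_le_def level_max_def)

abbreviation I :: "(nat \<Rightarrow> tm) \<Rightarrow> tm \<Rightarrow> tm" where "I \<equiv> interp \<rho>"

lemma ty_cumul_le: "m \<le> n \<Longrightarrow> T; \<Gamma> \<turnstile> A \<Colon> U m \<Longrightarrow> T; \<Gamma> \<turnstile> A \<Colon> U n"
  by (induction rule: dec_induct) (auto intro: ty_cumul)

lemma eq_cumul_le: "m \<le> n \<Longrightarrow> T; \<Gamma> \<turnstile> A \<equiv> B \<Colon> U m \<Longrightarrow> T; \<Gamma> \<turnstile> A \<equiv> B \<Colon> U n"
  by (induction rule: dec_induct) (auto intro: eq_cumul)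

text \<open>
  \<open>\<sigma>\<close> interprets the local context \<open>G\<close> and the global names \<open>E\<close> by terms over \<open>\<Gamma>\<close> of the right
  types, and a transparent name by its body, syntactically: unfolding a name is the
  identity on the interpretations.
\<close>

definition models :: "tm list \<Rightarrow> env \<Rightarrow> tm list \<Rightarrow> (nat \<Rightarrow> tm) \<Rightarrow> bool" where
  "models \<Gamma> E G \<sigma> \<longleftrightarrow> T \<turnstile> \<Gamma> ctx \<and>
     (\<forall>n < length G. T; \<Gamma> \<turnstile> \<sigma> n \<Colon> I (\<lambda>k. \<sigma> (k + Suc n)) (G ! n)) \<and>
     (\<forall>n A d. E n = Some (A, d) \<longrightarrow> T; \<Gamma> \<turnstile> \<sigma> (n + length G) \<Colon> I (\<lambda>k. \<sigma> (k + length G)) A \<and>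
        (\<forall>e. d = Some e \<longrightarrow> \<sigma> (n + length G) = I (\<lambda>k. \<sigma> (k + length G)) e))"

lemma models_ctx: "models \<Gamma> E G \<sigma> \<Longrightarrow> T \<turnstile> \<Gamma> ctx" by (simp add: models_def)

lemma models_scons:
  assumes "models \<Gamma> E G \<sigma>" "T; \<Gamma> \<turnstile> x \<Colon> I \<sigma> A"
  shows "models \<Gamma> E (A # G) (scons x \<sigma>)"
  using assms unfolding models_def by (auto simp: less_Suc_eq_0_disj)

lemma models_up:
  assumes g: "models \<Gamma> E G \<sigma>" and A: "T; \<Gamma> \<turnstile> I \<sigma> A \<Colon> U k"
  shows "models (I \<sigma> A # \<Gamma>) E (A # G) (up \<sigma>)"
proof -
  have c: "T \<turnstile> I \<sigma> A # \<Gamma> ctx" using A by (rule ctx_ext)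
  have *: "T; I \<sigma> A # \<Gamma> \<turnstile> shift 0 (\<sigma> n) \<Colon> I (\<lambda>k. shift 0 (\<sigma> (k + m))) B"
    if "T; \<Gamma> \<turnstile> \<sigma> n \<Colon> I (\<lambda>k. \<sigma> (k + m)) B" for n m B
    using ty_weaken[OF that A] by (simp add: shift_interp)
  have **: "shift 0 (\<sigma> n) = I (\<lambda>k. shift 0 (\<sigma> (k + m))) B"
    if "\<sigma> n = I (\<lambda>k. \<sigma> (k + m)) B" for n m B
    using that by (simp add: shift_interp)
  have "T; I \<sigma> A # \<Gamma> \<turnstile> Var 0 \<Colon> shift 0 (I \<sigma> A)" using ty_var[OF c, of 0] by simp
  then have "T; I \<sigma> A # \<Gamma> \<turnstile> Var 0 \<Colon> I (\<lambda>k. shift 0 (\<sigma> k)) A" by (simp add: shift_interp)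
  moreover have "T; I \<sigma> A # \<Gamma> \<turnstile> shift 0 (\<sigma> n) \<Colon> I (\<lambda>k. shift 0 (\<sigma> (Suc (k + n)))) (G ! n)" if "n < length G" for n
    using *[of n "Suc n"] g that by (simp add: models_def)
  moreover have "T; I \<sigma> A # \<Gamma> \<turnstile> shift 0 (\<sigma> (n + length G)) \<Colon> I (\<lambda>k. shift 0 (\<sigma> (k + length G))) B"
    if "E n = Some (B, d)" for n B d
    using *[of "n + length G" "length G" B] g that by (simp add: models_def)
  moreover have "shift 0 (\<sigma> (n + length G)) = I (\<lambda>k. shift 0 (\<sigma> (k + length G))) e"
    if "E n = Some (B, Some e)" for n B e
    using **[of "n + length G" "length G" e] g that by (simp add: models_def)
  ultimately show ?thesis unfolding models_def using c
    by (auto simp: less_Suc_eq_0_disj )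
qed

lemma models_base: "models \<Gamma> E G \<sigma> \<Longrightarrow> models \<Gamma> E [] (\<lambda>n. \<sigma> (n + length G))"
  by (auto simp: models_def)

text \<open>The judgments that the checker establishes hold under every interpretation.\<close>

definition has where "has E G t A \<longleftrightarrow> (\<forall>\<Gamma> \<sigma>. models \<Gamma> E G \<sigma> \<longrightarrow> T; \<Gamma> \<turnstile> I \<sigma> t \<Colon> I \<sigma> A)"
definition eqv where "eqv E G s t A \<longleftrightarrow> (\<forall>\<Gamma> \<sigma>. models \<Gamma> E G \<sigma> \<longrightarrow> T; \<Gamma> \<turnstile> I \<sigma> s \<equiv> I \<sigma> t \<Colon> I \<sigma> A)"
definition subt where "subt E G A B \<longleftrightarrow> (\<forall>\<Gamma> \<sigma>. models \<Gamma> E G \<sigma> \<longrightarrow>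
  (\<forall>t. T; \<Gamma> \<turnstile> t \<Colon> I \<sigma> A \<longrightarrow> T; \<Gamma> \<turnstile> t \<Colon> I \<sigma> B) \<and>
  (\<forall>s t. T; \<Gamma> \<turnstile> s \<equiv> t \<Colon> I \<sigma> A \<longrightarrow> T; \<Gamma> \<turnstile> s \<equiv> t \<Colon> I \<sigma> B))"

text \<open>
  \<open>\<beta>\<close>-reduction of \<open>Lam C b\<close>, known to have type \<open>Pi C B\<close>, requires a typing of \<open>b\<close>, which
  is not known to follow from the typing of the abstraction. The checker therefore establishes
  more than a typing: as long as an abstraction meets a product with syntactically the same
  domain, its body is typed by the codomain.
\<close>

primrec aligned :: "tm \<Rightarrow> env \<Rightarrow> tm list \<Rightarrow> tm \<Rightarrow> bool" where
  "aligned (Var n) E G A = has E G (Var n) A"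
| "aligned (U n) E G A = has E G (U n) A"
| "aligned (Pi C D) E G A = has E G (Pi C D) A"
| "aligned (Lam C b) E G A = (has E G (Lam C b) A \<and>
     (\<forall>B. A = Pi C B \<longrightarrow> (\<exists>n. has E G C (U n)) \<and> aligned b E (C # G) B))"
| "aligned (App f a) E G A = has E G (App f a) A"
| "aligned (Const c) E G A = has E G (Const c) A"

lemma aligned_has: "aligned t E G A \<Longrightarrow> has E G t A" by (cases t) auto

lemma subt_refl [simp]: "subt E G A A" by (simp add: subt_def)
lemma subt_trans: "subt E G A B \<Longrightarrow> subt E G B C \<Longrightarrow> subt E G A C" by (simp add: subt_def)
lemma eqv_trans: "eqv E G s t A \<Longrightarrow> eqv E G t u A \<Longrightarrow> eqv E G s u A"
  unfolding eqv_def by (blast intro: eq_trans)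
lemma eqv_sym: "eqv E G s t A \<Longrightarrow> eqv E G t s A"
  unfolding eqv_def by (blast intro: eq_sym)
lemma has_eqv: "has E G t A \<Longrightarrow> eqv E G t t A"
  unfolding eqv_def has_def by (blast intro: eq_refl)
lemma has_subt: "has E G t A \<Longrightarrow> subt E G A B \<Longrightarrow> has E G t B"
  unfolding has_def subt_def by blast
lemma eqv_subt: "eqv E G s t A \<Longrightarrow> subt E G A B \<Longrightarrow> eqv E G s t B"
  unfolding eqv_def subt_def by blast
lemma eqv_univ_subt:
  assumes "eqv E G A B (U n)" shows "subt E G A B"
  unfolding subt_def
proof (intro allI impI conjI)
  fix \<Gamma> \<sigma> s t assume "models \<Gamma> E G \<sigma>"
  with assms have e: "T; \<Gamma> \<turnstile> I \<sigma> A \<equiv> I \<sigma> B \<Colon> U (\<rho> n)" by (simp add: eqv_def)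
  show "T; \<Gamma> \<turnstile> t \<Colon> I \<sigma> B" if "T; \<Gamma> \<turnstile> t \<Colon> I \<sigma> A" using ty_conv[OF that e] .
  show "T; \<Gamma> \<turnstile> s \<equiv> t \<Colon> I \<sigma> B" if "T; \<Gamma> \<turnstile> s \<equiv> t \<Colon> I \<sigma> A" using eq_conv[OF that e] .
qed
lemma subt_univ: "\<rho> m \<le> \<rho> n \<Longrightarrow> subt E G (U m) (U n)"
  unfolding subt_def by (auto intro: ty_cumul_le eq_cumul_le)

definition typed_defs :: "env \<Rightarrow> bool" where
  "typed_defs E \<longleftrightarrow> (\<forall>n A e. E n = Some (A, Some e) \<longrightarrow> aligned e E [] A)"

definition sound_runner :: "env \<Rightarrow> runner \<Rightarrow> bool" where
  "sound_runner E r \<longleftrightarrow> (\<forall>G jb u A. r G jb = Some (u, A) \<longrightarrow> (case jb of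
      Infer t \<Rightarrow> aligned t E G A
    | Check t B \<Rightarrow> aligned t E G B
    | Conv S B \<Rightarrow> subt E G S B
    | Whnf t \<Rightarrow> eqv E G t u A
    | Equal s t \<Rightarrow> eqv E G s t A
    | Equal_at s t B \<Rightarrow> eqv E G s t B))"

lemma const_ty_sound: "w = Without_Trunc \<or> w = T \<Longrightarrow> const_ty w c = Some A \<Longrightarrow> const_type T c (I \<sigma> A)"
  by (cases c) (auto simp: const_ty_def hoas numeral_eq_Suc split: tt.splits intro: const_type_raw)

text \<open>The premises of an instance are exactly the premises of the computation rule, with all
  universe codes equal to \<open>2\<close>.\<close>

lemma redex_sound:
  assumes "redex c xs a = Some (s, ps, A, u)" "\<forall>(t, B) \<in> set ps. has E G t B"
  shows "eqv E G s u A"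
  unfolding eqv_def
proof (intro allI impI)
  fix \<Gamma> \<sigma> assume g: "models \<Gamma> E G \<sigma>"
  then have *: "\<forall>(t, B) \<in> set ps. T; \<Gamma> \<turnstile> I \<sigma> t \<Colon> I \<sigma> B"
    using assms(2) by (auto simp: has_def)
  consider "c = cId_ind" | "c = cNat_ind" | "c = cSigma_ind" | "c = cColim_ind"
    using assms(1) by (cases c) auto
  then show "T; \<Gamma> \<turnstile> I \<sigma> s \<equiv> I \<sigma> u \<Colon> I \<sigma> A"
  proof cases
    case 1
    then obtain A' C k x where ps: "ps = [(A', U 2), (C, raw (id_motive 2 (emb A'))), (k, raw (refl_case (emb A') (emb C))), (x, A')]"
      and s: "s = raw (cst cId_ind \<cdot> emb A' \<cdot> emb C \<cdot> emb k \<cdot> emb x \<cdot> emb x \<cdot> id_refl (emb A') (emb x))"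
      and A: "A = raw (emb C \<cdot> emb x \<cdot> emb x \<cdot> id_refl (emb A') (emb x))" and u: "u = raw (emb k \<cdot> emb x)"
      using assms(1) by (auto simp: id_redex_def split: list.splits tm.splits if_splits)
    show ?thesis
      using eq_id[of T \<Gamma> "I \<sigma> A'" "\<rho> 2" "I \<sigma> C" "\<rho> 2" "I \<sigma> k" "I \<sigma> x"] *
      by (simp add: ps s A u hoas)
  next
    case 2
    consider (zero) C k z where "ps = [(C, raw (cst cNat \<rightarrowtriangle> univ 2)), (k, raw (emb C \<cdot> cst cZero)), (z, raw (succ_case (emb C)))]"
      "s = raw (cst cNat_ind \<cdot> emb C \<cdot> emb k \<cdot> emb z \<cdot> cst cZero)" "A = raw (emb C \<cdot> cst cZero)" "u = k"
    | (suc) C k z m where "ps = [(C, raw (cst cNat \<rightarrowtriangle> univ 2)), (k, raw (emb C \<cdot> cst cZero)), (z, raw (succ_case (emb C))), (m, Const cNat)]"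
      "s = raw (cst cNat_ind \<cdot> emb C \<cdot> emb k \<cdot> emb z \<cdot> (cst cSucc \<cdot> emb m))" "A = raw (emb C \<cdot> (cst cSucc \<cdot> emb m))"
      "u = raw (emb z \<cdot> emb m \<cdot> (cst cNat_ind \<cdot> emb C \<cdot> emb k \<cdot> emb z \<cdot> emb m))"
      using assms(1) 2 by (auto simp: nat_redex_def split: list.splits tm.splits if_splits)
    then show ?thesis
    proof cases
      case zero
      then show ?thesis
        using eq_zero[of T \<Gamma> "I \<sigma> C" "\<rho> 2" "I \<sigma> k" "I \<sigma> z"] * by (simp add: hoas)
    next
      case suc
      then show ?thesis
        using eq_succ[of T \<Gamma> "I \<sigma> C" "\<rho> 2" "I \<sigma> k" "I \<sigma> z" "I \<sigma> m"] * by (simp add: hoas)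
    qed
  next
    case 3
    then obtain A' B C k x y where
      ps: "ps = [(A', U 2), (B, raw (emb A' \<rightarrowtriangle> univ 2)), (C, raw (cst cSigma \<cdot> emb A' \<cdot> emb B \<rightarrowtriangle> univ 2)),
          (k, raw (pair_case (emb A') (emb B) (emb C))), (x, A'), (y, App B x)]"
      and s: "s = raw (cst cSigma_ind \<cdot> emb A' \<cdot> emb B \<cdot> emb C \<cdot> emb k \<cdot> (cst cPair \<cdot> emb A' \<cdot> emb B \<cdot> emb x \<cdot> emb y))"
      and A: "A = raw (emb C \<cdot> (cst cPair \<cdot> emb A' \<cdot> emb B \<cdot> emb x \<cdot> emb y))" and u: "u = raw (emb k \<cdot> emb x \<cdot> emb y)"
      using assms(1) by (auto simp: sigma_redex_def split: list.splits prod.splits if_splits)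
    show ?thesis
      using eq_pair[of T \<Gamma> "I \<sigma> A'" "\<rho> 2" "I \<sigma> B" "I \<sigma> C" "\<rho> 2" "I \<sigma> k" "I \<sigma> x" "I \<sigma> y"] *
      by (simp add: ps s A u hoas)
  next
    case 4
    then obtain A' f P h q n x where
      ps: "ps = [(A', raw (cst cNat \<rightarrowtriangle> univ 2)), (f, raw (colim_map (emb A'))), (P, raw (colim (emb A') (emb f) \<rightarrowtriangle> univ 2)),
          (h, raw (colim_i_case (emb A') (emb f) (emb P))), (q, raw (colim_g_case (emb A') (emb f) (emb P) (emb h))),
          (n, Const cNat), (x, App A' n)]"
      and s: "s = raw (cst cColim_ind \<cdot> emb A' \<cdot> emb f \<cdot> emb P \<cdot> emb h \<cdot> emb q \<cdot> (colim_i (emb A') (emb f) (emb n) \<cdot> emb x))"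
      and A: "A = raw (emb P \<cdot> (colim_i (emb A') (emb f) (emb n) \<cdot> emb x))" and u: "u = raw (emb h \<cdot> emb n \<cdot> emb x)"
      using assms(1) by (auto simp: colim_redex_def split: list.splits prod.splits if_splits)
    show ?thesis
      using eq_colim[of T \<Gamma> "I \<sigma> A'" "\<rho> 2" "I \<sigma> f" "I \<sigma> P" "\<rho> 2" "I \<sigma> h" "I \<sigma> q" "I \<sigma> n" "I \<sigma> x"] *
      by (simp add: ps s A u hoas numeral_2_eq_2)
  qed
qed

context
  fixes E r assumes r: "sound_runner E r"
begin

lemma r_Infer: "r G (Infer t) = Some (u, A) \<Longrightarrow> aligned t E G A"
  and r_Check: "r G (Check t B) = Some (u, A) \<Longrightarrow> aligned t E G B"
  and r_Conv: "r G (Conv S B) = Some (u, A) \<Longrightarrow> subt E G S B"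
  and r_Whnf: "r G (Whnf t) = Some (u, A) \<Longrightarrow> eqv E G t u A"
  and r_Equal: "r G (Equal s t) = Some (u, A) \<Longrightarrow> eqv E G s t A"
  and r_Equal_at: "r G (Equal_at s t B) = Some (u, A) \<Longrightarrow> eqv E G s t B"
  using r unfolding sound_runner_def by fastforce+

lemma to_univ_sound: "to_univ r G A = Some n \<Longrightarrow> subt E G A (U n)"
  by (auto simp: to_univ_def split: tm.splits option.splits prod.splits dest!: r_Whnf eqv_univ_subt)

lemma univ_to_sound: "to_univ r G A = Some n \<Longrightarrow> subt E G (U n) A"
  by (auto simp: to_univ_def split: tm.splits option.splits prod.splits dest!: r_Whnf eqv_sym[THEN eqv_univ_subt])

lemma to_pi_sound: "to_pi r G F = Some (A, B) \<Longrightarrow> subt E G F (Pi A B)"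
  by (auto simp: to_pi_def split: tm.splits option.splits prod.splits dest!: r_Whnf eqv_univ_subt)

lemma pi_to_sound: "to_pi r G F = Some (A, B) \<Longrightarrow> subt E G (Pi A B) F"
  by (auto simp: to_pi_def split: tm.splits option.splits prod.splits dest!: r_Whnf eqv_sym[THEN eqv_univ_subt])

lemma level_of_sound: "level_of r G A = Some n \<Longrightarrow> has E G A (U n)"
  by (auto simp: level_of_def split: option.splits prod.splits dest!: r_Infer aligned_has to_univ_sound intro: has_subt)

lemma join_sound: "join r G A B = Some C \<Longrightarrow> subt E G A C" "join r G A B = Some C \<Longrightarrow> subt E G B C"
  by (auto simp: join_def split: if_splits bool.splits tm.splits option.splits prod.splits dest!: r_Conv to_univ_sound
      intro: subt_trans subt_univ \<rho>_level_max)

lemma app_typing: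
  assumes "T; \<Gamma> \<turnstile> f \<Colon> I \<sigma> (Pi A B)" "T; \<Gamma> \<turnstile> I \<sigma> x \<Colon> I \<sigma> A"
  shows "T; \<Gamma> \<turnstile> App f (I \<sigma> x) \<Colon> I \<sigma> (plug [x] 0 0 B)"
  using ty_app[of T \<Gamma> f "I \<sigma> A" "I (up \<sigma>) B" "I \<sigma> x"] assms
  by (simp add: inst_interp_up interp_plug_0)

lemma app_eq:
  assumes "T; \<Gamma> \<turnstile> f \<equiv> g \<Colon> I \<sigma> (Pi A B)" "T; \<Gamma> \<turnstile> I \<sigma> x \<equiv> y \<Colon> I \<sigma> A"
  shows "T; \<Gamma> \<turnstile> App f (I \<sigma> x) \<equiv> App g y \<Colon> I \<sigma> (plug [x] 0 0 B)"
  using eq_app[of T \<Gamma> f g "I \<sigma> A" "I (up \<sigma>) B" "I \<sigma> x" y] assms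
  by (simp add: inst_interp_up interp_plug_0)

lemma apply_args_typing:
  assumes g: "models \<Gamma> E G \<sigma>"
  shows "apply_args r G xs t A = Some (u, B) \<Longrightarrow> T; \<Gamma> \<turnstile> I \<sigma> t \<Colon> I \<sigma> A \<Longrightarrow> u = apps t xs \<and> T; \<Gamma> \<turnstile> I \<sigma> u \<Colon> I \<sigma> B"
proof (induction xs arbitrary: t A)
  case (Cons x xs)
  from Cons.prems(1) obtain A' B' w W where p: "to_pi r G A = Some (A', B')" and x: "r G (Check x A') = Some (w, W)"
    and rest: "apply_args r G xs (App t x) (plug [x] 0 0 B') = Some (u, B)"
    by (auto split: option.splits)
  have f: "T; \<Gamma> \<turnstile> I \<sigma> t \<Colon> I \<sigma> (Pi A' B')" using to_pi_sound[OF p] g Cons.prems(2) by (auto simp: subt_def)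
  have "T; \<Gamma> \<turnstile> I \<sigma> x \<Colon> I \<sigma> A'" using aligned_has[OF r_Check[OF x]] g by (auto simp: has_def)
  from app_typing[OF f this] have "T; \<Gamma> \<turnstile> I \<sigma> (App t x) \<Colon> I \<sigma> (plug [x] 0 0 B')" by simp
  from Cons.IH[OF rest this] show ?case unfolding apps.simps .
qed simp

lemma apply_args_sound:
  assumes g: "models \<Gamma> E G \<sigma>"
  shows "apply_args r G xs t A = Some (u, B) \<Longrightarrow> T; \<Gamma> \<turnstile> f \<equiv> I \<sigma> t \<Colon> I \<sigma> A \<Longrightarrow> T; \<Gamma> \<turnstile> apps f (map (I \<sigma>) xs) \<equiv> I \<sigma> u \<Colon> I \<sigma> B"
proof (induction xs arbitrary: f t A)
  case (Cons x xs)
  from Cons.prems(1) obtain A' B' w W where p: "to_pi r G A = Some (A', B')" and x: "r G (Check x A') = Some (w, W)"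
    and rest: "apply_args r G xs (App t x) (plug [x] 0 0 B') = Some (u, B)"
    by (auto split: option.splits)
  have f: "T; \<Gamma> \<turnstile> f \<equiv> I \<sigma> t \<Colon> I \<sigma> (Pi A' B')" using to_pi_sound[OF p] g Cons.prems(2) by (auto simp: subt_def)
  have "T; \<Gamma> \<turnstile> I \<sigma> x \<equiv> I \<sigma> x \<Colon> I \<sigma> A'" using aligned_has[OF r_Check[OF x]] g by (auto simp: has_def intro: eq_refl)
  from app_eq[OF f this] have "T; \<Gamma> \<turnstile> App f (I \<sigma> x) \<equiv> I \<sigma> (App t x) \<Colon> I \<sigma> (plug [x] 0 0 B')" by simp
  from Cons.IH[OF rest this] show ?case by simp
qed simp

text \<open>The arguments \<open>ys\<close> consumed so far extend the interpretation to the context \<open>H\<close> of the body that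
  has been reached; the equation between that body and the original application is kept along.\<close>

lemma beta_args_sound:
  assumes g: "models \<Gamma> E G \<sigma>"
  shows "beta_args r G p xs ys t A = Some (u, B) \<Longrightarrow> aligned t E H A \<Longrightarrow> models \<Gamma> E H (bindings \<rho> \<sigma> p ys) \<Longrightarrow>
    T; \<Gamma> \<turnstile> f \<equiv> I (bindings \<rho> \<sigma> p ys) t \<Colon> I (bindings \<rho> \<sigma> p ys) A \<Longrightarrow>
    T; \<Gamma> \<turnstile> apps f (map (I \<sigma>) xs) \<equiv> I \<sigma> u \<Colon> I \<sigma> B"
proof (induction xs arbitrary: f ys t A H)
  case Nil then show ?case by (auto simp: interp_plug_0)
next
  case (Cons x xs)
  show ?case
  proof (cases "\<exists>C b D. t = Lam C b \<and> A = Pi C D")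
    case True
    then obtain C b D where t: "t = Lam C b" and A: "A = Pi C D" by blast
    let ?\<tau> = "bindings \<rho> \<sigma> p ys"
    from Cons.prems(1) obtain w W where x: "r G (Check x (plug ys p 0 C)) = Some (w, W)"
      and u: "beta_args r G p xs (x # ys) b D = Some (u, B)"
      by (auto simp: t A split: option.splits)
    from Cons.prems(2) obtain n where C: "has E H C (U n)" and b: "aligned b E (C # H) D" by (auto simp: t A)
    have x': "T; \<Gamma> \<turnstile> I \<sigma> x \<Colon> I ?\<tau> C"
      using aligned_has[OF r_Check[OF x]] g by (auto simp: has_def interp_plug_0)
    have g': "models \<Gamma> E (C # H) (bindings \<rho> \<sigma> p (x # ys))" using models_scons[OF Cons.prems(3) x'] by simp
    have C': "T; \<Gamma> \<turnstile> I ?\<tau> C \<Colon> U (\<rho> n)" using C Cons.prems(3) by (auto simp: has_def)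
    have "T; I ?\<tau> C # \<Gamma> \<turnstile> I (up ?\<tau>) b \<Colon> I (up ?\<tau>) D"
      using aligned_has[OF b] models_up[OF Cons.prems(3) C'] by (auto simp: has_def)
    from eq_beta[OF this x']
    have 1: "T; \<Gamma> \<turnstile> App (I ?\<tau> t) (I \<sigma> x) \<equiv> I (bindings \<rho> \<sigma> p (x # ys)) b \<Colon> I (bindings \<rho> \<sigma> p (x # ys)) D"
      by (simp add: t inst_interp_up)
    have 2: "T; \<Gamma> \<turnstile> f \<equiv> I ?\<tau> t \<Colon> Pi (I ?\<tau> C) (I (up ?\<tau>) D)" using Cons.prems(4) by (simp add: A)
    from eq_app[OF 2 eq_refl[OF x']]
    have 3: "T; \<Gamma> \<turnstile> App f (I \<sigma> x) \<equiv> App (I ?\<tau> t) (I \<sigma> x) \<Colon> I (bindings \<rho> \<sigma> p (x # ys)) D"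
      by (simp add: inst_interp_up)
    from Cons.IH[OF u b g' eq_trans[OF 3 1]] show ?thesis by simp
  next
    case False
    then have "apply_args r G (x # xs) (plug ys p 0 t) (plug ys p 0 A) = Some (u, B)"
      using Cons.prems(1) by (auto split: tm.splits if_splits simp del: apply_args.simps)
    from apply_args_sound[OF g this] Cons.prems(4) show ?thesis by (simp add: interp_plug_0)
  qed
qed

lemma check_all_sound: "check_all r G ps \<Longrightarrow> (t, A) \<in> set ps \<Longrightarrow> has E G t A"
  by (induction ps) (auto split: option.splits dest: r_Check aligned_has)

lemma eliminate_sound:
  assumes "eliminate r G c xs a zs = Some (u, A)"
  shows "eqv E G (apps (Const c) (xs @ a # zs)) u A"
proof -
  let ?a = "case r G (Whnf a) of Some (a', _) \<Rightarrow> a' | None \<Rightarrow> a" and ?t = "App (apps (Const c) xs) a"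
  from assms obtain q where q: "redex c xs ?a = Some q"
    unfolding eliminate_def by (cases "redex c xs ?a") auto
  obtain s ps B v where red: "redex c xs ?a = Some (s, ps, B, v)" using q by (cases q) auto
  then have ps: "check_all r G ps" using assms by (simp add: eliminate_def split: bool.splits)
  let ?R = "if ?t = s then Some B else
     (case r G (Equal ?t s) of None \<Rightarrow> None | Some (_, S) \<Rightarrow> join r G S B)"
  from red ps assms obtain R where R: "?R = Some R" "apply_args r G zs v R = Some (u, A)"
    unfolding eliminate_def by (cases ?R) auto
  then have J: "?t = s \<and> R = B \<or> (\<exists>w S. r G (Equal ?t s) = Some (w, S) \<and> join r G S B = Some R)"
    by (auto split: if_splits option.splits)
  have "eqv E G s v B" using redex_sound[OF red] check_all_sound[OF ps] by fast
  then have tv: "eqv E G ?t v R"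
    using J r_Equal join_sound by (meson eqv_subt eqv_trans)
  have "apps (Const c) (xs @ a # zs) = apps ?t zs" by (simp add: apps_append)
  then show ?thesis unfolding eqv_def using apply_args_sound[OF _ R(2)] tv
    by (auto simp: eqv_def interp_apps)
qed

lemma lookup_sound:
  assumes "lookup E G n = Some A" shows "has E G (Var n) A"
  unfolding has_def
proof (intro allI impI)
  fix \<Gamma> \<sigma> assume g: "models \<Gamma> E G \<sigma>"
  show "T; \<Gamma> \<turnstile> I \<sigma> (Var n) \<Colon> I \<sigma> A"
  proof (cases "n < length G")
    case True
    then show ?thesis using g assms by (auto simp: models_def lookup_def nth_opt_nth interp_lift)
  next
    case False
    with assms obtain B d where B: "E (n - length G) = Some (B, d)" "A = lift (length G) 0 B"
      by (auto simp: lookup_def nth_opt_nth split: option.splits)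
    have "T; \<Gamma> \<turnstile> \<sigma> (n - length G + length G) \<Colon> I (\<lambda>k. \<sigma> (k + length G)) B"
      using g B(1) unfolding models_def by blast
    with False show ?thesis by (simp add: B(2) interp_lift)
  qed
qed

lemma head_step_sound:
  assumes defs: "typed_defs E"
    and "head_step E r G t = Some (u, A)"
  shows "eqv E G t u A"
proof -
  obtain h xs where sp: "spine t [] = (h, xs)" by fastforce
  have t: "t = apps h xs" using apps_spine[OF sp] by simp
  consider (lam) C b B w where "h = Lam C b" "r G (Infer h) = Some (w, B)" "beta_args r G 0 xs [] h B = Some (u, A)"
    | (unf) n e B where "h = Var n" "unfold E G n = Some (e, B)" "beta_args r G (length G) xs [] e B = Some (u, A)"
    | (elim) c m ys a zs where "h = Const c" "split_args m [] xs = Some (ys, a, zs)" "eliminate r G c ys a zs = Some (u, A)"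
    using assms(2) by (auto simp: head_step_def sp split: tm.splits list.splits option.splits prod.splits)
  then show ?thesis
  proof cases
    case lam
    have al: "aligned h E G B" using r_Infer[OF lam(2)] .
    show ?thesis unfolding eqv_def
    proof (intro allI impI)
      fix \<Gamma> \<sigma> assume g: "models \<Gamma> E G \<sigma>"
      then have "T; \<Gamma> \<turnstile> I \<sigma> h \<equiv> I \<sigma> h \<Colon> I \<sigma> B" using aligned_has[OF al] by (auto simp: has_def intro: eq_refl)
      from beta_args_sound[OF g lam(3) al, of "I \<sigma> h"] g this
      show "T; \<Gamma> \<turnstile> I \<sigma> t \<equiv> I \<sigma> u \<Colon> I \<sigma> A" by (simp add: t interp_apps)
    qed
  next
    case unf
    from unf(2) have n: "E (n - length G) = Some (B, Some e)" "\<not> n < length G"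
      by (auto simp: unfold_def split: if_splits option.splits)
    show ?thesis unfolding eqv_def
    proof (intro allI impI)
      fix \<Gamma> \<sigma> assume g: "models \<Gamma> E G \<sigma>"
      let ?\<tau> = "\<lambda>k. \<sigma> (k + length G)"
      from g n have "T; \<Gamma> \<turnstile> \<sigma> n \<Colon> I ?\<tau> B" "\<sigma> n = I ?\<tau> e"
        unfolding models_def by (metis le_add_diff_inverse2 linorder_not_less)+
      then have "T; \<Gamma> \<turnstile> I \<sigma> h \<equiv> I ?\<tau> e \<Colon> I ?\<tau> B" by (simp add: unf(1) eq_refl)
      from beta_args_sound[OF g unf(3) defs[unfolded typed_defs_def, rule_format, OF n(1)], of "I \<sigma> h"] models_base[OF g] this
      show "T; \<Gamma> \<turnstile> I \<sigma> t \<equiv> I \<sigma> u \<Colon> I \<sigma> A" by (simp add: t interp_apps)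
    qed
  next
    case elim
    with eliminate_sound[OF elim(3)] split_args_append[OF elim(2)] show ?thesis by (simp add: t)
  qed
qed

lemma whnf_sound:
  assumes defs: "typed_defs E"
    and "whnf E r G t = Some (u, A)"
  shows "eqv E G t u A"
proof -
  from assms(2) obtain v B where 1: "head_step E r G t = Some (v, B)"
    and 2: "(u, A) = (v, B) \<or> (\<exists>S. r G (Whnf v) = Some (u, S) \<and> join r G S B = Some A)"
    by (auto simp: whnf_def split: option.splits)
  have "eqv E G t v B" using head_step_sound[OF defs 1] .
  with 2 show ?thesis using r_Whnf join_sound by (metis Pair_inject eqv_subt eqv_trans)
qed

lemma has_pi:
  assumes "has E G A (U m)" "has E (A # G) B (U n)" shows "has E G (Pi A B) (U (level_max m n))"
  unfolding has_def
proof (intro allI impI)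
  fix \<Gamma> \<sigma> assume g: "models \<Gamma> E G \<sigma>"
  have A: "T; \<Gamma> \<turnstile> I \<sigma> A \<Colon> U (\<rho> m)" using assms(1) g by (simp add: has_def)
  have "T; I \<sigma> A # \<Gamma> \<turnstile> I (up \<sigma>) B \<Colon> U (\<rho> n)" using assms(2) models_up[OF g A] by (simp add: has_def)
  then show "T; \<Gamma> \<turnstile> I \<sigma> (Pi A B) \<Colon> I \<sigma> (U (level_max m n))"
    using A by (auto intro: ty_pi ty_cumul_le \<rho>_level_max)
qed

lemma has_lam:
  assumes "has E G A (U m)" "has E (A # G) b B" shows "has E G (Lam A b) (Pi A B)"
  unfolding has_def
proof (intro allI impI)
  fix \<Gamma> \<sigma> assume g: "models \<Gamma> E G \<sigma>"
  have A: "T; \<Gamma> \<turnstile> I \<sigma> A \<Colon> U (\<rho> m)" using assms(1) g by (simp add: has_def)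
  show "T; \<Gamma> \<turnstile> I \<sigma> (Lam A b) \<Colon> I \<sigma> (Pi A B)"
    using assms(2) models_up[OF g A] by (auto simp add: has_def intro: ty_lam)
qed

lemma eqv_pi:
  assumes "has E G A (U l)" "eqv E G A A' (U m)" "eqv E (A # G) B B' (U n)" shows "eqv E G (Pi A B) (Pi A' B') (U (level_max m n))"
  unfolding eqv_def
proof (intro allI impI)
  fix \<Gamma> \<sigma> assume g: "models \<Gamma> E G \<sigma>"
  have A: "T; \<Gamma> \<turnstile> I \<sigma> A \<Colon> U (\<rho> l)" using assms(1) g by (simp add: has_def)
  have A': "T; \<Gamma> \<turnstile> I \<sigma> A \<equiv> I \<sigma> A' \<Colon> U (\<rho> m)" using assms(2) g by (simp add: eqv_def)
  have "T; I \<sigma> A # \<Gamma> \<turnstile> I (up \<sigma>) B \<equiv> I (up \<sigma>) B' \<Colon> U (\<rho> n)" using assms(3) models_up[OF g A] by (simp add: eqv_def)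
  then show "T; \<Gamma> \<turnstile> I \<sigma> (Pi A B) \<equiv> I \<sigma> (Pi A' B') \<Colon> I \<sigma> (U (level_max m n))"
    using A' by (auto intro: eq_pi eq_cumul_le \<rho>_level_max)
qed

lemma eqv_lam:
  assumes "has E G A (U l)" "eqv E G A A' (U m)" "eqv E (A # G) b b' B" shows "eqv E G (Lam A b) (Lam A' b') (Pi A B)"
  unfolding eqv_def
proof (intro allI impI)
  fix \<Gamma> \<sigma> assume g: "models \<Gamma> E G \<sigma>"
  have A: "T; \<Gamma> \<turnstile> I \<sigma> A \<Colon> U (\<rho> l)" using assms(1) g by (simp add: has_def)
  have A': "T; \<Gamma> \<turnstile> I \<sigma> A \<equiv> I \<sigma> A' \<Colon> U (\<rho> m)" using assms(2) g by (simp add: eqv_def)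
  show "T; \<Gamma> \<turnstile> I \<sigma> (Lam A b) \<equiv> I \<sigma> (Lam A' b') \<Colon> I \<sigma> (Pi A B)"
    using assms(3) models_up[OF g A] A' by (auto simp add: eqv_def intro: eq_lam)
qed

lemma eqv_app:
  assumes "eqv E G f g (Pi A B)" "eqv E G a b A" shows "eqv E G (App f a) (App g b) (plug [a] 0 0 B)"
  unfolding eqv_def
proof (intro allI impI)
  fix \<Gamma> \<sigma> assume "models \<Gamma> E G \<sigma>"
  with assms app_eq[of \<Gamma> "I \<sigma> f" "I \<sigma> g" \<sigma> A B a "I \<sigma> b"]
  show "T; \<Gamma> \<turnstile> I \<sigma> (App f a) \<equiv> I \<sigma> (App g b) \<Colon> I \<sigma> (plug [a] 0 0 B)" by (simp add: eqv_def)
qed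

lemma one_typing: "T \<turnstile> \<Gamma> ctx \<Longrightarrow> T; \<Gamma> \<turnstile> Const cOne \<Colon> Pi (U m) (U m)"
  using ty_const[of T \<Gamma> cOne "raw (univ m \<rightarrowtriangle> univ m)"] const_type.intros(21)[of T m]
  by (simp add: hoas)

lemma has_one: "has E G a (U n) \<Longrightarrow> has E G (App (Const cOne) a) (U n)"
  unfolding has_def using ty_app[OF one_typing] models_ctx by fastforce

lemma eqv_one: "eqv E G a b (U n) \<Longrightarrow> eqv E G (App (Const cOne) a) (App (Const cOne) b) (U n)"
  unfolding eqv_def using eq_app[OF eq_refl[OF one_typing]] models_ctx by fastforce

lemma infer_sound:
  assumes w: "w = Without_Trunc \<or> w = T" and assms: "infer w E r G t = Some (u, A)"
  shows "aligned t E G A"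
proof (cases t)
  case (Var n) with assms show ?thesis by (auto simp: infer_def lookup_sound split: option.splits)
next
  case (U n)
  with assms have A: "A = U (level_suc n)" by (simp add: infer_def)
  have "has E G (U n) (U (level_suc n))"
    unfolding has_def by (auto dest!: models_ctx intro: ty_cumul_le[OF \<rho>_level_suc] ty_univ)
  then show ?thesis by (simp add: U A)
next
  case (Pi C B)
  with assms show ?thesis
    by (auto simp: infer_def split: option.splits dest!: level_of_sound intro: has_pi)
next
  case (Lam C b)
  with assms obtain n w B where n: "level_of r G C = Some n" and b: "r (C # G) (Infer b) = Some (w, B)" and A: "A = Pi C B"
    by (auto simp: infer_def split: option.splits)
  from level_of_sound[OF n] r_Infer[OF b] show ?thesis
    by (auto simp: Lam A intro: has_lam aligned_has)
next
  case (App f a)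
  have "has E G (App f a) A"
  proof (cases "f = Const cOne")
    case True
    with assms App show ?thesis by (auto simp: infer_def split: option.splits dest!: level_of_sound intro: has_one)
  next
    case False
    with assms App obtain w F where f: "r G (Infer f) = Some (w, F)" and rs: "apply_args r G [a] f F = Some (u, A)"
      by (auto simp: infer_def split: option.splits simp del: apply_args.simps)
    show ?thesis unfolding has_def
    proof (intro allI impI)
      fix \<Gamma> \<sigma> assume g: "models \<Gamma> E G \<sigma>"
      then have "T; \<Gamma> \<turnstile> I \<sigma> f \<Colon> I \<sigma> F" using aligned_has[OF r_Infer[OF f]] by (simp add: has_def)
      from apply_args_typing[OF g rs this] show "T; \<Gamma> \<turnstile> I \<sigma> (App f a) \<Colon> I \<sigma> A" by auto
    qed
  qed
  then show ?thesis by (simp add: App)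
next
  case (Const c)
  with assms have "const_ty w c = Some A" by (auto simp: infer_def split: option.splits)
  then have "has E G (Const c) A" unfolding has_def by (auto dest!: models_ctx intro: ty_const const_ty_sound[OF w])
  then show ?thesis by (simp add: Const)
qed

lemma check_sound:
  assumes "check r G t A = Some (u, B)"
  shows "aligned t E G A"
proof (cases "\<exists>C b. t = Lam C b")
  case True
  then obtain C b where t: "t = Lam C b" by blast
  from assms obtain C' D n w W where p: "to_pi r G A = Some (C', D)" and C: "level_of r G C = Some n"
    and dom: "C' = C \<or> (\<exists>K v m l. r G (Equal C C') = Some (v, K) \<and> to_univ r G K = Some m \<and> level_of r (C # G) D = Some l)"
    and b: "r (C # G) (Check b D) = Some (w, W)"
    by (auto simp: check_def t split: option.splits if_splits)
  have hC: "has E G C (U n)" using level_of_sound[OF C] .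
  have hb: "aligned b E (C # G) D" using r_Check[OF b] .
  have "has E G t (Pi C D)" unfolding t using has_lam[OF hC aligned_has[OF hb]] .
  moreover have "subt E G (Pi C D) (Pi C' D)"
    using dom
  proof (elim disjE exE conjE)
    fix K v m l assume "r G (Equal C C') = Some (v, K)" "to_univ r G K = Some m" "level_of r (C # G) D = Some l"
    then have "eqv E G C C' (U m)" "has E (C # G) D (U l)"
      using r_Equal to_univ_sound level_of_sound by (blast intro: eqv_subt)+
    from eqv_pi[OF hC this(1) has_eqv[OF this(2)]] show ?thesis by (rule eqv_univ_subt)
  qed simp
  ultimately have "has E G t A" using pi_to_sound[OF p] by (blast intro: has_subt subt_trans)
  moreover have "aligned b E (C # G) B'" if "A = Pi C B'" for B'
    using that p hb by (simp add: to_pi_def)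
  ultimately show ?thesis using hC by (auto simp: t)
next
  case False
  with assms obtain v w S V where "r G (Infer t) = Some (v, S)" "r G (Conv S A) = Some (w, V)"
    by (cases t) (auto simp: check_def split: option.splits)
  then have "has E G t A" using r_Infer r_Conv by (blast intro: has_subt aligned_has)
  with False show ?thesis by (cases t) auto
qed

lemma conv_sound:
  assumes "conv r G S A = Some (u, B)"
  shows "subt E G S A"
proof -
  from assms consider "S = A"
    | m n where "to_univ r G S = Some m" "to_univ r G A = Some n" "level_le m n"
    | v K m where "r G (Equal S A) = Some (v, K)" "to_univ r G K = Some m"
    by (auto simp: conv_def split: if_splits bool.splits option.splits)
  then show ?thesis
  proof cases
    case 2
    from subt_trans[OF to_univ_sound[OF 2(1)] subt_trans[OF subt_univ[OF \<rho>_level_le[OF 2(3)]] univ_to_sound[OF 2(2)]]]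
    show ?thesis .
  next
    case 3
    from eqv_subt[OF r_Equal[OF 3(1)] to_univ_sound[OF 3(2)]] show ?thesis by (rule eqv_univ_subt)
  qed simp
qed

lemma equal_parts_sound:
  assumes "equal_parts r G s t = Some (u, A)"
  shows "eqv E G s t A"
proof (cases s)
  case (Pi C B)
  with assms obtain C' B' v K m l w L n where t: "t = Pi C' B'" "A = U (level_max m n)"
    "r G (Equal C C') = Some (v, K)" "to_univ r G K = Some m" "level_of r G C = Some l"
    "r (C # G) (Equal B B') = Some (w, L)" "to_univ r (C # G) L = Some n"
    by (auto simp: equal_parts_def split: tm.splits option.splits)
  show ?thesis unfolding Pi t(1,2)
    using eqv_pi[OF level_of_sound[OF t(5)] eqv_subt[OF r_Equal[OF t(3)] to_univ_sound[OF t(4)]]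
      eqv_subt[OF r_Equal[OF t(6)] to_univ_sound[OF t(7)]]] .
next
  case (Lam C b)
  with assms obtain C' b' v K m l w B where t: "t = Lam C' b'" "A = Pi C B"
    "r G (Equal C C') = Some (v, K)" "to_univ r G K = Some m" "level_of r G C = Some l"
    "r (C # G) (Equal b b') = Some (w, B)"
    by (auto simp: equal_parts_def split: tm.splits option.splits)
  show ?thesis unfolding Lam t(1,2)
    using eqv_lam[OF level_of_sound[OF t(5)] eqv_subt[OF r_Equal[OF t(3)] to_univ_sound[OF t(4)]] r_Equal[OF t(6)]] .
next
  case (App f a)
  show ?thesis
  proof (cases "f = Const cOne")
    case True
    with assms App obtain b v K m where "t = App (Const cOne) b" "A = U m" "r G (Equal a b) = Some (v, K)" "to_univ r G K = Some m"
      by (auto simp: equal_parts_def split: tm.splits option.splits if_splits)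
    then show ?thesis unfolding App using True eqv_one[OF eqv_subt[OF r_Equal to_univ_sound]] by blast
  next
    case False
    obtain g b where t: "t = App g b"
      using assms App by (auto simp: equal_parts_def split: tm.splits)
    obtain v F C B w where f: "r G (Equal f g) = Some (v, F)" and p: "to_pi r G F = Some (C, B)"
      and a: "r G (Equal_at a b C) = Some w" and A: "A = plug [a] 0 0 B"
      using assms App False t by (auto simp: equal_parts_def split: option.splits)
    have "eqv E G f g (Pi C B)" using r_Equal[OF f] to_pi_sound[OF p] by (rule eqv_subt)
    moreover have "eqv E G a b C" using a by (cases w) (auto dest: r_Equal_at)
    ultimately show ?thesis unfolding App t A by (rule eqv_app)
  qed
qed (use assms in \<open>auto simp: equal_parts_def\<close>)

lemma reduce_equal_sound:
  assumes "reduce_equal r G s t = Some (u, A)"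
  shows "eqv E G s t A"
proof -
  have *: "eqv E G s t C" if "eqv E G s s' S" "eqv E G s' t R" "subt E G S C" "subt E G R C" for s s' t S R C
    using eqv_trans[OF eqv_subt[OF that(1,3)] eqv_subt[OF that(2,4)]] .
  have **: "eqv E G s t C" if "eqv E G t t' S" "eqv E G s t' R" "subt E G S C" "subt E G R C" for s t t' S R C
    using eqv_trans[OF eqv_subt[OF that(2,4)] eqv_sym[OF eqv_subt[OF that(1,3)]]] .
  from assms consider
    s' S t' T' v R R' where "r G (Whnf s) = Some (s', S)" "r G (Whnf t) = Some (t', T')" "r G (Equal s' t') = Some (v, R)"
      "join r G S R = Some R'" "join r G T' R' = Some A"
  | s' S v R where "r G (Whnf s) = Some (s', S)" "r G (Equal s' t) = Some (v, R)" "join r G S R = Some A"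
  | t' T' v R where "r G (Whnf t) = Some (t', T')" "r G (Equal s t') = Some (v, R)" "join r G T' R = Some A"
    by (auto simp: reduce_equal_def split: option.splits)
  then show ?thesis
  proof cases
    case 1
    from *[OF r_Whnf[OF 1(1)] r_Equal[OF 1(3)] join_sound[OF 1(4)]] have "eqv E G s t' R'" .
    from **[OF r_Whnf[OF 1(2)] this join_sound[OF 1(5)]] show ?thesis .
  next
    case 2 from *[OF r_Whnf[OF 2(1)] r_Equal[OF 2(2)] join_sound[OF 2(3)]] show ?thesis .
  next
    case 3 from **[OF r_Whnf[OF 3(1)] r_Equal[OF 3(2)] join_sound[OF 3(3)]] show ?thesis .
  qed
qed

lemma equal_sound:
  assumes "equal E r G s t = Some (u, A)"
  shows "eqv E G s t A"
  using assms
  by (auto simp: equal_def split: if_splits bool.splits option.splits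
      dest!: r_Infer aligned_has reduce_equal_sound equal_parts_sound intro: has_eqv)

lemma equal_at_sound:
  assumes "equal_at r G s t A = Some (u, B)"
  shows "eqv E G s t A"
proof -
  from assms consider w where "s = t" "r G (Check s A) = Some w"
    | v S w where "r G (Equal s t) = Some (v, S)" "r G (Conv S A) = Some w"
    | s' S v w where "r G (Whnf s) = Some (s', S)" "r G (Conv S A) = Some v" "r G (Equal_at s' t A) = Some w"
    | t' S v w where "r G (Whnf t) = Some (t', S)" "r G (Conv S A) = Some v" "r G (Equal_at s t' A) = Some w"
    by (auto simp: equal_at_def split: if_splits option.splits)
  then show ?thesis
  proof cases
    case 1
    then show ?thesis by (cases w) (auto dest: r_Check aligned_has has_eqv)
  next
    case (2 v S w)
    then show ?thesis using eqv_subt[OF r_Equal r_Conv] by (cases w) auto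
  next
    case (3 s' S v w)
    then have "eqv E G s s' A" "eqv E G s' t A"
      using eqv_subt[OF r_Whnf r_Conv] r_Equal_at by (cases v; cases w; auto)+
    then show ?thesis by (rule eqv_trans)
  next
    case (4 t' S v w)
    then have "eqv E G t t' A" "eqv E G s t' A"
      using eqv_subt[OF r_Whnf r_Conv] r_Equal_at by (cases v; cases w; auto)+
    then show ?thesis using eqv_sym eqv_trans by blast
  qed
qed

text \<open>The checker may ignore the constants of the propositional truncation: a run for the theory
  without truncation is sound for both theories.\<close>

lemma step_sound:
  assumes "typed_defs E" "w = Without_Trunc \<or> w = T"
  shows "sound_runner E (step w E r)"
  unfolding sound_runner_def
proof (intro allI impI)
  fix G jb u A assume "step w E r G jb = Some (u, A)"
  then show "case jb of Infer t \<Rightarrow> aligned t E G A | Check t B \<Rightarrow> aligned t E G B | Conv S B \<Rightarrow> subt E G S B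
    | Whnf t \<Rightarrow> eqv E G t u A | Equal s t \<Rightarrow> eqv E G s t A | Equal_at s t B \<Rightarrow> eqv E G s t B"
    by (cases jb) (simp_all add: step_def infer_sound[OF assms(2)] check_sound conv_sound whnf_sound[OF assms(1)] equal_sound equal_at_sound)
qed

end

lemma run_sound:
  assumes "typed_defs E" "w = Without_Trunc \<or> w = T"
  shows "sound_runner E (run w E k)"
proof (induction k)
  case 0 show ?case by (simp add: sound_runner_def)
next
  case (Suc k) from step_sound[OF this assms] show ?case by simp
qed

lemma checks_sound:
  assumes E: "typed_defs E" "w = Without_Trunc \<or> w = T" and c: "checks w E k G t A"
  shows "aligned t E G A"
  using c r_Check[OF run_sound[OF E]] by (auto simp: checks_def split: option.splits)

lemma subsumes_sound:
  assumes E: "typed_defs E" "w = Without_Trunc \<or> w = T" and c: "subsumes w E k G A B"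
  shows "subt E G A B"
  using c r_Conv[OF run_sound[OF E]] by (auto simp: subsumes_def split: option.splits)

lemma checks_args_sound:
  assumes E: "typed_defs E" "w = Without_Trunc \<or> w = T" and g: "models \<Gamma> E G \<sigma>"
  shows "checks_args w E k G ts H \<Longrightarrow> models \<Gamma> E H (bindings \<rho> \<sigma> (length G) ts)"
proof (induction ts arbitrary: H)
  case Nil
  with models_base[OF g] show ?case by (auto split: list.splits)
next
  case (Cons t ts)
  then obtain A K where H: "H = A # K" and t: "checks w E k G t (plug ts (length G) 0 A)"
    and ts: "checks_args w E k G ts K"
    by (auto split: list.splits if_splits)
  have "T; \<Gamma> \<turnstile> I \<sigma> t \<Colon> I (bindings \<rho> \<sigma> (length G) ts) A"
    using aligned_has[OF checks_sound[OF E t]] g by (auto simp: has_def interp_plug_0)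
  from models_scons[OF Cons.IH[OF ts] this] show ?case by (simp add: H)
qed

lemma equates_sound:
  assumes E: "typed_defs E" "w = Without_Trunc \<or> w = T" and c: "equates w E k G s t A"
  shows "eqv E G s t A"
proof -
  from c obtain u S v B where "run w E k G (Equal s t) = Some (u, S)" "run w E k G (Conv S A) = Some (v, B)"
    unfolding equates_def by (auto split: option.splits)
  from eqv_subt[OF r_Equal[OF run_sound[OF E] this(1)] r_Conv[OF run_sound[OF E] this(2)]] show ?thesis .
qed

end

section \<open>Proof terms\<close>

text \<open>
  The constructions below are written as scoped terms of type theory. They refer to one another
  through atoms: \<open>atom k\<close> is the free variable that stands for entry \<open>k\<close> of the table at the end of
  this section, and an entry uses only atoms of smaller number. An opaque entry is a
  lemma, of which later entries know only the type; a transparent entry is a definition, which the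
  type checker may unfold. Naming the transparent entries, instead of writing their bodies out,
  keeps types free of redexes, on which almost all the time of the checker is spent.

  A telescope such as \<open>family_ctx b K\<close> is a chain of binders \<open>b\<close> that ends in \<open>K\<close>; with \<open>b = pi\<close> it
  gives a statement and with \<open>b = fn\<close> the proof of that statement. The universe codes \<open>0\<close>, \<open>1\<close> and
  \<open>2\<close> stand for \<open>U i\<close>, \<open>U j\<close> and a universe above both.
\<close>

abbreviation "U2 \<equiv> univ 2"
abbreviation "NN \<equiv> cst cNat"
abbreviation "Zero \<equiv> cst cZero"
abbreviation "Succ n \<equiv> cst cSucc \<cdot> n"

definition atom :: "nat \<Rightarrow> scoped" where "atom k = (\<lambda>d. Var (d + k))"

type_synonym binding = "scoped \<Rightarrow> (scoped \<Rightarrow> scoped) \<Rightarrow> scoped"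

subsection \<open>Paths\<close>

definition family_ctx ::
  "binding \<Rightarrow> (scoped \<Rightarrow> scoped \<Rightarrow> scoped \<Rightarrow> scoped \<Rightarrow> scoped \<Rightarrow> scoped) \<Rightarrow> scoped" where
  "family_ctx b K = b U2 (\<lambda>A. b (A \<rightarrowtriangle> U2) (\<lambda>P. b A (\<lambda>x. b A (\<lambda>y. b (Idt A x y) (\<lambda>p. K A P x y p)))))"

definition fwd where "fwd A P x y p = atom 0 \<cdot> A \<cdot> P \<cdot> x \<cdot> y \<cdot> p"
definition fwd_ty where "fwd_ty = family_ctx pi (\<lambda>A P x y p. P \<cdot> x \<rightarrowtriangle> P \<cdot> y)"
definition fwd_tm where "fwd_tm = family_ctx fn transport"

definition bwd where "bwd A P x y p = atom 1 \<cdot> A \<cdot> P \<cdot> x \<cdot> y \<cdot> p"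
definition bwd_ty where "bwd_ty = family_ctx pi (\<lambda>A P x y p. P \<cdot> y \<rightarrowtriangle> P \<cdot> x)"
definition bwd_tm where
  "bwd_tm = family_ctx fn (\<lambda>A P x y p.
     path_ind A (\<lambda>x y p. P \<cdot> y \<rightarrowtriangle> P \<cdot> x) (\<lambda>x. fn (P \<cdot> x) (\<lambda>u. u)) x y p)"

text \<open>The path \<open>p\<inverse> \<cdot> q : y = z\<close> for \<open>p : x = y\<close> and \<open>q : x = z\<close>, which is \<open>q\<close> when \<open>p\<close> is
  reflexivity. It is the only operation on paths that the proof uses besides transport.\<close>

definition cotrans where "cotrans A x y z p q = atom 2 \<cdot> A \<cdot> x \<cdot> y \<cdot> z \<cdot> p \<cdot> q"
definition cotrans_ty where
  "cotrans_ty = pi U2 (\<lambda>A. pi A (\<lambda>x. pi A (\<lambda>y. pi A (\<lambda>z. Idt A x y \<rightarrowtriangle> Idt A x z \<rightarrowtriangle> Idt A y z))))"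
definition cotrans_tm where
  "cotrans_tm = fn U2 (\<lambda>A. fn A (\<lambda>x. fn A (\<lambda>y. fn A (\<lambda>z. fn (Idt A x y) (\<lambda>p.
     path_ind A (\<lambda>x y p. Idt A x z \<rightarrowtriangle> Idt A y z) (\<lambda>x. fn (Idt A x z) (\<lambda>q. q)) x y p)))))"

text \<open>Transport in the family \<open>Q \<circ> j\<close>. The types of this version mention \<open>Q\<close> and \<open>j\<close> only as
  \<open>Q (j x)\<close>, whereas transport in the function \<open>\<lambda>x. Q (j x)\<close> would put a redex into them.\<close>

definition fwd_along where "fwd_along B X j Q x y p = atom 6 \<cdot> B \<cdot> X \<cdot> j \<cdot> Q \<cdot> x \<cdot> y \<cdot> p"
definition fwd_along_ctx where
  "fwd_along_ctx b K = b U2 (\<lambda>B. b U2 (\<lambda>X. b (B \<rightarrowtriangle> X) (\<lambda>j. b (X \<rightarrowtriangle> U2) (\<lambda>Q.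
     b B (\<lambda>x. b B (\<lambda>y. b (Idt B x y) (\<lambda>p. K B X j Q x y p)))))))"
definition fwd_along_ty where
  "fwd_along_ty = fwd_along_ctx pi (\<lambda>B X j Q x y p. Q \<cdot> (j \<cdot> x) \<rightarrowtriangle> Q \<cdot> (j \<cdot> y))"
definition fwd_along_tm where
  "fwd_along_tm = fwd_along_ctx fn (\<lambda>B X j Q x y p.
     path_ind B (\<lambda>x y p. Q \<cdot> (j \<cdot> x) \<rightarrowtriangle> Q \<cdot> (j \<cdot> y)) (\<lambda>x. fn (Q \<cdot> (j \<cdot> x)) (\<lambda>u. u)) x y p)"

abbreviation "cotrans_refl \<equiv> atom 8"
definition cotrans_refl_ty where
  "cotrans_refl_ty = pi U2 (\<lambda>A. pi A (\<lambda>x. pi A (\<lambda>y. pi (Idt A x y) (\<lambda>p.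
     Idt (Idt A y y) (cotrans A x y y p p) (id_refl A y)))))"
definition cotrans_refl_tm where
  "cotrans_refl_tm = fn U2 (\<lambda>A. fn A (\<lambda>x. fn A (\<lambda>y. fn (Idt A x y) (\<lambda>p.
     path_ind A (\<lambda>x y p. Idt (Idt A y y) (cotrans A x y y p p) (id_refl A y))
       (\<lambda>x. id_refl (Idt A x x) (id_refl A x)) x y p))))"

abbreviation "fwd_bwd \<equiv> atom 9"
definition fwd_bwd_ty where
  "fwd_bwd_ty = family_ctx pi (\<lambda>A P x y p.
     pi (P \<cdot> y) (\<lambda>v. Idt (P \<cdot> y) (fwd A P x y p \<cdot> (bwd A P x y p \<cdot> v)) v))"
definition fwd_bwd_tm where
  "fwd_bwd_tm = family_ctx fn (\<lambda>A P x y p.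
     path_ind A (\<lambda>x y p. pi (P \<cdot> y) (\<lambda>v. Idt (P \<cdot> y) (fwd A P x y p \<cdot> (bwd A P x y p \<cdot> v)) v))
       (\<lambda>x. fn (P \<cdot> x) (\<lambda>v. id_refl (P \<cdot> x) v)) x y p)"

subsection \<open>Colimits of weakly constant sequences\<close>

text \<open>
  The witness \<open>c\<close> of weak constancy of a sequence \<open>f\<close> is required to be reflexivity on the diagonal.
  Every witness \<open>e\<close> can be corrected to satisfy this: take the path \<open>e(x, x)\<inverse> \<cdot> e(x, y)\<close>. The
  correction is what makes \<open>c\<close> compatible with paths in the domain of \<open>f\<close>, because path induction
  reduces such statements to the diagonal.
\<close>

definition wconst where
  "wconst A f = pi NN (\<lambda>n. pi (A \<cdot> n) (\<lambda>x. pi (A \<cdot> n) (\<lambda>y. Idt (A \<cdot> Succ n) (f \<cdot> n \<cdot> x) (f \<cdot> n \<cdot> y))))"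
definition wconst_refl where
  "wconst_refl A f c = pi NN (\<lambda>n. pi (A \<cdot> n) (\<lambda>x.
     Idt (Idt (A \<cdot> Succ n) (f \<cdot> n \<cdot> x) (f \<cdot> n \<cdot> x)) (c \<cdot> n \<cdot> x \<cdot> x) (id_refl (A \<cdot> Succ n) (f \<cdot> n \<cdot> x))))"
definition seq_ctx where
  "seq_ctx b K = b (NN \<rightarrowtriangle> U2) (\<lambda>A. b (colim_map A) (\<lambda>f. b (wconst A f) (\<lambda>c. b (wconst_refl A f c) (\<lambda>c0.
     K A f c c0))))"
definition cocone_ctx where
  "cocone_ctx b A f K = b U2 (\<lambda>X. b (pi NN (\<lambda>n. A \<cdot> n \<rightarrowtriangle> X)) (\<lambda>i.
     b (pi NN (\<lambda>n. pi (A \<cdot> n) (\<lambda>x. Idt X (i \<cdot> Succ n \<cdot> (f \<cdot> n \<cdot> x)) (i \<cdot> n \<cdot> x)))) (\<lambda>g.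
     b (X \<rightarrowtriangle> U2) (\<lambda>Q. K X i g Q))))"

text \<open>The image of \<open>a : A 0\<close> in \<open>A n\<close>, so that \<open>base_point (n + 1)\<close> is \<open>f n (base_point n)\<close> judgmentally.\<close>

definition base_point where "base_point A f a n = atom 3 \<cdot> A \<cdot> f \<cdot> a \<cdot> n"
definition base_point_ty where
  "base_point_ty = pi (NN \<rightarrowtriangle> U2) (\<lambda>A. pi (colim_map A) (\<lambda>f. pi (A \<cdot> Zero) (\<lambda>a. pi NN (\<lambda>n. A \<cdot> n))))"
definition base_point_tm where
  "base_point_tm = fn (NN \<rightarrowtriangle> U2) (\<lambda>A. fn (colim_map A) (\<lambda>f. fn (A \<cdot> Zero) (\<lambda>a. cst cNat_ind \<cdot> A \<cdot> a \<cdot> f)))"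

text \<open>The element of \<open>Q (i n (base_point n))\<close> that is obtained from \<open>t : Q (i 0 a)\<close> by going up the
  sequence along the paths \<open>g\<close>.\<close>

definition lifted where
  "lifted A f X i g Q a t n = atom 7 \<cdot> A \<cdot> f \<cdot> X \<cdot> i \<cdot> g \<cdot> Q \<cdot> a \<cdot> t \<cdot> n"
definition lifted_ctx where
  "lifted_ctx b K = b (NN \<rightarrowtriangle> U2) (\<lambda>A. b (colim_map A) (\<lambda>f. cocone_ctx b A f (\<lambda>X i g Q.
     b (A \<cdot> Zero) (\<lambda>a. b (Q \<cdot> (i \<cdot> Zero \<cdot> a)) (\<lambda>t. K A f X i g Q a t)))))"
definition lifted_ty where
  "lifted_ty = lifted_ctx pi (\<lambda>A f X i g Q a t. pi NN (\<lambda>n. Q \<cdot> (i \<cdot> n \<cdot> base_point A f a n)))"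
definition lifted_tm where
  "lifted_tm = lifted_ctx fn (\<lambda>A f X i g Q a t.
     cst cNat_ind \<cdot> fn NN (\<lambda>n. Q \<cdot> (i \<cdot> n \<cdot> base_point A f a n)) \<cdot> t
       \<cdot> fn NN (\<lambda>n. bwd X Q (i \<cdot> Succ n \<cdot> (f \<cdot> n \<cdot> base_point A f a n)) (i \<cdot> n \<cdot> base_point A f a n)
                     (g \<cdot> n \<cdot> base_point A f a n)))"

text \<open>
  Naturality of transport along \<open>g\<close>, with \<open>c x y\<close> in the place of the image \<open>k q\<close> of the path
  \<open>q : x = y\<close>. By path induction on \<open>q\<close> it is enough to consider \<open>c x x\<close>, which is reflexivity.
\<close>

definition naturality_ctx where
  "naturality_ctx b K =
     b U2 (\<lambda>B. b U2 (\<lambda>B'. b (B \<rightarrowtriangle> B') (\<lambda>k. b U2 (\<lambda>X. b (X \<rightarrowtriangle> U2) (\<lambda>Q. b (B \<rightarrowtriangle> X) (\<lambda>j. b (B' \<rightarrowtriangle> X) (\<lambda>j'.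
     b (pi B (\<lambda>x. Idt X (j' \<cdot> (k \<cdot> x)) (j \<cdot> x))) (\<lambda>g.
     b (pi B (\<lambda>x. pi B (\<lambda>y. Idt B' (k \<cdot> x) (k \<cdot> y)))) (\<lambda>c.
     b (pi B (\<lambda>x. Idt (Idt B' (k \<cdot> x) (k \<cdot> x)) (c \<cdot> x \<cdot> x) (id_refl B' (k \<cdot> x)))) (\<lambda>c0.
     b B (\<lambda>x. b B (\<lambda>y. b (Idt B x y) (\<lambda>q. K B B' k X Q j j' g c c0 x y q)))))))))))))"
definition naturality_goal where
  "naturality_goal B B' k X Q j j' g c x y q =
     pi (Q \<cdot> (j' \<cdot> (k \<cdot> x))) (\<lambda>u. Idt (Q \<cdot> (j \<cdot> y))
       (fwd X Q (j' \<cdot> (k \<cdot> y)) (j \<cdot> y) (g \<cdot> y) \<cdot> (fwd_along B' X j' Q (k \<cdot> x) (k \<cdot> y) (c \<cdot> x \<cdot> y) \<cdot> u))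
       (fwd_along B X j Q x y q \<cdot> (fwd X Q (j' \<cdot> (k \<cdot> x)) (j \<cdot> x) (g \<cdot> x) \<cdot> u)))"
abbreviation "naturality \<equiv> atom 10"
definition naturality_ty where
  "naturality_ty = naturality_ctx pi (\<lambda>B B' k X Q j j' g c c0 x y q. naturality_goal B B' k X Q j j' g c x y q)"
definition naturality_tm where
  "naturality_tm = naturality_ctx fn (\<lambda>B B' k X Q j j' g c c0 x y q.
     path_ind B (\<lambda>x y q. naturality_goal B B' k X Q j j' g c x y q)
       (\<lambda>x. fn (Q \<cdot> (j' \<cdot> (k \<cdot> x))) (\<lambda>u.
          bwd (Idt B' (k \<cdot> x) (k \<cdot> x))
              (fn (Idt B' (k \<cdot> x) (k \<cdot> x)) (\<lambda>r. Idt (Q \<cdot> (j \<cdot> x))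
                 (fwd X Q (j' \<cdot> (k \<cdot> x)) (j \<cdot> x) (g \<cdot> x) \<cdot> (fwd_along B' X j' Q (k \<cdot> x) (k \<cdot> x) r \<cdot> u))
                 (fwd X Q (j' \<cdot> (k \<cdot> x)) (j \<cdot> x) (g \<cdot> x) \<cdot> u)))
              (c \<cdot> x \<cdot> x) (id_refl B' (k \<cdot> x)) (c0 \<cdot> x)
            \<cdot> id_refl (Q \<cdot> (j \<cdot> x)) (fwd X Q (j' \<cdot> (k \<cdot> x)) (j \<cdot> x) (g \<cdot> x) \<cdot> u))) x y q)"

text \<open>
  The values of a section of \<open>Q\<close> over the colimit: for \<open>x : A n\<close>, \<open>next_value n x\<close> in \<open>Q (i (n+1) (f n x))\<close>
  is the lifted element transported along \<open>c\<close> from the image of the base point to that of \<open>x\<close>, and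
  \<open>section_value n x\<close> in \<open>Q (i n x)\<close> is \<open>next_value n x\<close> transported along \<open>g\<close>. Detouring through level
  \<open>n + 1\<close>, where all images are equal, is what makes a definition possible for arbitrary \<open>x\<close>.
\<close>

definition descend where "descend A f X i g Q n x = fwd X Q (i \<cdot> Succ n \<cdot> (f \<cdot> n \<cdot> x)) (i \<cdot> n \<cdot> x) (g \<cdot> n \<cdot> x)"
definition next_value where
  "next_value A f c X i g Q a t n x =
     fwd_along (A \<cdot> Succ n) X (i \<cdot> Succ n) Q (f \<cdot> n \<cdot> base_point A f a n) (f \<cdot> n \<cdot> x) (c \<cdot> n \<cdot> base_point A f a n \<cdot> x)
       \<cdot> lifted A f X i g Q a t (Succ n)"
definition section_value where
  "section_value A f c X i g Q a t n x = descend A f X i g Q n x \<cdot> next_value A f c X i g Q a t n x"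

text \<open>
  The values are compatible with the maps \<open>f\<close>. Unfolded, \<open>section_value (n+1) (f n x)\<close> transports along
  \<open>g\<close> after transporting along \<open>c (n+1)\<close>; naturality, applied to the path \<open>c n\<close> between images in
  \<open>A (n+1)\<close>, exchanges the two, and transport along \<open>g\<close> undoes the last step of the lifting.
\<close>

definition coherence_ctx where
  "coherence_ctx b K = seq_ctx b (\<lambda>A f c c0. cocone_ctx b A f (\<lambda>X i g Q.
     b (A \<cdot> Zero) (\<lambda>a. b (Q \<cdot> (i \<cdot> Zero \<cdot> a)) (\<lambda>t. b NN (\<lambda>n. b (A \<cdot> n) (\<lambda>x. K A f c c0 X i g Q a t n x))))))"
abbreviation "coherence \<equiv> atom 11"
definition coherence_ty where
  "coherence_ty = coherence_ctx pi (\<lambda>A f c c0 X i g Q a t n x.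
     Idt (Q \<cdot> (i \<cdot> Succ n \<cdot> (f \<cdot> n \<cdot> x)))
       (section_value A f c X i g Q a t (Succ n) (f \<cdot> n \<cdot> x)) (next_value A f c X i g Q a t n x))"
definition coherence_tm where
  "coherence_tm = coherence_ctx fn (\<lambda>A f c c0 X i g Q a t n x.
     let z = f \<cdot> n \<cdot> base_point A f a n; y = f \<cdot> n \<cdot> x; q = c \<cdot> n \<cdot> base_point A f a n \<cdot> x; D = Q \<cdot> (i \<cdot> Succ n \<cdot> z) in
     fwd D (fn D (\<lambda>u. Idt (Q \<cdot> (i \<cdot> Succ n \<cdot> y)) (section_value A f c X i g Q a t (Succ n) y)
                       (fwd_along (A \<cdot> Succ n) X (i \<cdot> Succ n) Q z y q \<cdot> u)))
         (descend A f X i g Q (Succ n) z \<cdot> lifted A f X i g Q a t (Succ (Succ n)))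
         (lifted A f X i g Q a t (Succ n))
         (fwd_bwd \<cdot> X \<cdot> Q \<cdot> (i \<cdot> Succ (Succ n) \<cdot> (f \<cdot> Succ n \<cdot> z)) \<cdot> (i \<cdot> Succ n \<cdot> z) \<cdot> (g \<cdot> Succ n \<cdot> z)
            \<cdot> lifted A f X i g Q a t (Succ n))
       \<cdot> (naturality \<cdot> (A \<cdot> Succ n) \<cdot> (A \<cdot> Succ (Succ n)) \<cdot> (f \<cdot> Succ n) \<cdot> X \<cdot> Q \<cdot> (i \<cdot> Succ n) \<cdot> (i \<cdot> Succ (Succ n))
            \<cdot> (g \<cdot> Succ n) \<cdot> (c \<cdot> Succ n) \<cdot> (c0 \<cdot> Succ n) \<cdot> z \<cdot> y \<cdot> q \<cdot> lifted A f X i g Q a t (Succ (Succ n))))"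

text \<open>An element of \<open>Q (i 0 a)\<close> extends to a section of an arbitrary family \<open>Q\<close> over the colimit.
  For \<open>Q y\<close> the type \<open>i 0 a = y\<close> this contracts the colimit to \<open>i 0 a\<close>.\<close>

definition extension_ctx where
  "extension_ctx b K = seq_ctx b (\<lambda>A f c c0. b (colim A f \<rightarrowtriangle> U2) (\<lambda>Q.
     b (A \<cdot> Zero) (\<lambda>a. b (Q \<cdot> (colim_i A f Zero \<cdot> a)) (\<lambda>t. K A f c c0 Q a t))))"
abbreviation "extension \<equiv> atom 12"
definition extension_ty where "extension_ty = extension_ctx pi (\<lambda>A f c c0 Q a t. pi (colim A f) (\<lambda>y. Q \<cdot> y))"
definition extension_tm where
  "extension_tm = extension_ctx fn (\<lambda>A f c c0 Q a t.
     let X = colim A f; i = cst cColim_i \<cdot> A \<cdot> f; g = cst cColim_g \<cdot> A \<cdot> f in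
     cst cColim_ind \<cdot> A \<cdot> f \<cdot> Q \<cdot> fn NN (\<lambda>n. fn (A \<cdot> n) (\<lambda>x. section_value A f c X i g Q a t n x))
       \<cdot> fn NN (\<lambda>n. fn (A \<cdot> n) (\<lambda>x. let D = Q \<cdot> (i \<cdot> Succ n \<cdot> (f \<cdot> n \<cdot> x)) in
           bwd D (fn D (\<lambda>z. Idt (Q \<cdot> (i \<cdot> n \<cdot> x)) (descend A f X i g Q n x \<cdot> z) (section_value A f c X i g Q a t n x)))
               (section_value A f c X i g Q a t (Succ n) (f \<cdot> n \<cdot> x)) (next_value A f c X i g Q a t n x)
               (coherence \<cdot> A \<cdot> f \<cdot> c \<cdot> c0 \<cdot> X \<cdot> i \<cdot> g \<cdot> Q \<cdot> a \<cdot> t \<cdot> n \<cdot> x)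
             \<cdot> id_refl (Q \<cdot> (i \<cdot> n \<cdot> x)) (section_value A f c X i g Q a t n x))))"

subsection \<open>The colimit is a mere proposition\<close>

text \<open>If \<open>u : \<Pi>y. x = y\<close> then every path \<open>p : x = y\<close> is equal to \<open>u(x)\<inverse> \<cdot> u(y)\<close>, as one sees by
  path induction on \<open>p\<close>.\<close>

abbreviation "path_unique \<equiv> atom 13"
definition path_unique_ty where
  "path_unique_ty = pi U2 (\<lambda>X. pi X (\<lambda>x. pi X (\<lambda>y. pi (Idt X x y) (\<lambda>p. pi (pi X (\<lambda>y. Idt X x y)) (\<lambda>u.
     Idt (Idt X x y) (cotrans X x x y (u \<cdot> x) (u \<cdot> y)) p)))))"
definition path_unique_tm where
  "path_unique_tm = fn U2 (\<lambda>X. fn X (\<lambda>x. fn X (\<lambda>y. fn (Idt X x y) (\<lambda>p.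
     path_ind X (\<lambda>x y p. pi (pi X (\<lambda>y. Idt X x y)) (\<lambda>u.
                   Idt (Idt X x y) (cotrans X x x y (u \<cdot> x) (u \<cdot> y)) p))
       (\<lambda>x. fn (pi X (\<lambda>y. Idt X x y)) (\<lambda>u. cotrans_refl \<cdot> X \<cdot> x \<cdot> x \<cdot> (u \<cdot> x))) x y p))))"

abbreviation "right_inverse \<equiv> atom 14"
definition right_inverse_ty where
  "right_inverse_ty = pi U2 (\<lambda>A. pi U2 (\<lambda>B. pi (A \<rightarrowtriangle> B) (\<lambda>f. isequiv A B f \<rightarrowtriangle> (B \<rightarrowtriangle> A))))"
definition right_inverse_tm where
  "right_inverse_tm = fn U2 (\<lambda>A. fn U2 (\<lambda>B. fn (A \<rightarrowtriangle> B) (\<lambda>f. fn (isequiv A B f) (\<lambda>e.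
     pr1 (B \<rightarrowtriangle> A) (\<lambda>g. pi B (\<lambda>y. Idt B (f \<cdot> (g \<cdot> y)) y))
       (pr1 (sigma (B \<rightarrowtriangle> A) (\<lambda>g. pi B (\<lambda>y. Idt B (f \<cdot> (g \<cdot> y)) y)))
            (\<lambda>_. sigma (B \<rightarrowtriangle> A) (\<lambda>h. pi A (\<lambda>x. Idt A (h \<cdot> (f \<cdot> x)) x))) e)))))"

abbreviation "funext \<equiv> atom 15"
definition funext_ty where
  "funext_ty = pi U2 (\<lambda>A. pi (A \<rightarrowtriangle> U2) (\<lambda>B. pi (pi A (\<lambda>x. B \<cdot> x)) (\<lambda>f. pi (pi A (\<lambda>x. B \<cdot> x)) (\<lambda>g.
     pi A (\<lambda>x. Idt (B \<cdot> x) (f \<cdot> x) (g \<cdot> x)) \<rightarrowtriangle> Idt (pi A (\<lambda>x. B \<cdot> x)) f g))))"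
definition funext_tm where
  "funext_tm = fn U2 (\<lambda>A. fn (A \<rightarrowtriangle> U2) (\<lambda>B. fn (pi A (\<lambda>x. B \<cdot> x)) (\<lambda>f. fn (pi A (\<lambda>x. B \<cdot> x)) (\<lambda>g.
     right_inverse \<cdot> Idt (pi A (\<lambda>x. B \<cdot> x)) f g \<cdot> pi A (\<lambda>x. Idt (B \<cdot> x) (f \<cdot> x) (g \<cdot> x)) \<cdot> happly A B f g
       \<cdot> (cst cFunext \<cdot> A \<cdot> B \<cdot> f \<cdot> g)))))"

text \<open>The type \<open>\<Pi>y. x = y\<close> is a mere proposition: an element of it makes all path types
  \<open>x = y\<close> mere propositions. This is where function extensionality enters.\<close>

abbreviation "isprop_paths \<equiv> atom 16"
definition isprop_paths_ty where
  "isprop_paths_ty = pi U2 (\<lambda>X. pi X (\<lambda>x. isprop (pi X (\<lambda>y. Idt X x y))))"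
definition isprop_paths_tm where
  "isprop_paths_tm = fn U2 (\<lambda>X. fn X (\<lambda>x. fn (pi X (\<lambda>y. Idt X x y)) (\<lambda>u. fn (pi X (\<lambda>y. Idt X x y)) (\<lambda>v.
     funext \<cdot> X \<cdot> fn X (\<lambda>y. Idt X x y) \<cdot> u \<cdot> v \<cdot> fn X (\<lambda>y.
       cotrans (Idt X x y) (cotrans X x x y (u \<cdot> x) (u \<cdot> y)) (u \<cdot> y) (v \<cdot> y)
         (path_unique \<cdot> X \<cdot> x \<cdot> y \<cdot> (u \<cdot> y) \<cdot> u) (path_unique \<cdot> X \<cdot> x \<cdot> y \<cdot> (v \<cdot> y) \<cdot> u))))))"

text \<open>
  Elimination from the colimit into a family \<open>P\<close> of mere propositions that is given on \<open>A 0\<close>. The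
  assumption \<open>ind\<close> is the induction principle of \<open>A (n+1)\<close> over \<open>A n\<close> for such families; for the
  iterated one-step truncation it is an instance of the induction principle of \<open>{-}\<close>. The
  function on \<open>A n\<close> is defined by recursion on \<open>n\<close>, so at \<open>n = 0\<close> it is judgmentally the given one.
\<close>

definition ind_ty where
  "ind_ty A f = pi NN (\<lambda>n. pi (A \<cdot> Succ n \<rightarrowtriangle> U2) (\<lambda>R.
     pi (A \<cdot> Succ n) (\<lambda>z. isprop (R \<cdot> z)) \<rightarrowtriangle> pi (A \<cdot> n) (\<lambda>x. R \<cdot> (f \<cdot> n \<cdot> x)) \<rightarrowtriangle> pi (A \<cdot> Succ n) (\<lambda>z. R \<cdot> z)))"
definition colim_elim_ctx where
  "colim_elim_ctx b K = b (NN \<rightarrowtriangle> U2) (\<lambda>A. b (colim_map A) (\<lambda>f. b (ind_ty A f) (\<lambda>ind.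
     b (colim A f \<rightarrowtriangle> U2) (\<lambda>P. b (pi (colim A f) (\<lambda>x. isprop (P \<cdot> x))) (\<lambda>pr.
     b (pi (A \<cdot> Zero) (\<lambda>a. P \<cdot> (colim_i A f Zero \<cdot> a))) (\<lambda>h. K A f ind P pr h))))))"
abbreviation "colim_elim \<equiv> atom 17"
definition colim_elim_ty where "colim_elim_ty = colim_elim_ctx pi (\<lambda>A f ind P pr h. pi (colim A f) (\<lambda>x. P \<cdot> x))"
definition colim_elim_tm where
  "colim_elim_tm = colim_elim_ctx fn (\<lambda>A f ind P pr h.
     let X = colim A f; src = (\<lambda>n x. colim_i A f (Succ n) \<cdot> (f \<cdot> n \<cdot> x)); tgt = (\<lambda>n x. colim_i A f n \<cdot> x);
       H = cst cNat_ind \<cdot> fn NN (\<lambda>n. pi (A \<cdot> n) (\<lambda>x. P \<cdot> tgt n x)) \<cdot> h \<cdot>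
         fn NN (\<lambda>n. fn (pi (A \<cdot> n) (\<lambda>x. P \<cdot> tgt n x)) (\<lambda>u.
           ind \<cdot> n \<cdot> fn (A \<cdot> Succ n) (\<lambda>z. P \<cdot> tgt (Succ n) z) \<cdot> fn (A \<cdot> Succ n) (\<lambda>z. pr \<cdot> tgt (Succ n) z)
            \<cdot> fn (A \<cdot> n) (\<lambda>x. bwd X P (src n x) (tgt n x) (colim_g A f n x) \<cdot> (u \<cdot> x)))) in
     cst cColim_ind \<cdot> A \<cdot> f \<cdot> P \<cdot> H
       \<cdot> fn NN (\<lambda>n. fn (A \<cdot> n) (\<lambda>x. pr \<cdot> tgt n x
           \<cdot> (fwd X P (src n x) (tgt n x) (colim_g A f n x) \<cdot> (H \<cdot> Succ n \<cdot> (f \<cdot> n \<cdot> x))) \<cdot> (H \<cdot> n \<cdot> x))))"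

text \<open>Eliminate the first of two points into the mere propositions \<open>\<Pi>y. x = y\<close>; this leaves
  the case \<open>x = i 0 a\<close>, in which the colimit is contracted to \<open>x\<close>.\<close>

definition isprop_colim_ctx where
  "isprop_colim_ctx b K = seq_ctx b (\<lambda>A f c c0. b (ind_ty A f) (\<lambda>ind. K A f c c0 ind))"
abbreviation "isprop_colim \<equiv> atom 18"
definition isprop_colim_ty where
  "isprop_colim_ty = isprop_colim_ctx pi (\<lambda>A f c c0 ind. isprop (colim A f))"
definition isprop_colim_tm where
  "isprop_colim_tm = isprop_colim_ctx fn (\<lambda>A f c c0 ind. let X = colim A f in
     colim_elim \<cdot> A \<cdot> f \<cdot> ind \<cdot> fn X (\<lambda>x. pi X (\<lambda>y. Idt X x y)) \<cdot> fn X (\<lambda>x. isprop_paths \<cdot> X \<cdot> x)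
      \<cdot> fn (A \<cdot> Zero) (\<lambda>a. extension \<cdot> A \<cdot> f \<cdot> c \<cdot> c0 \<cdot> fn X (\<lambda>y. Idt X (colim_i A f Zero \<cdot> a) y) \<cdot> a
           \<cdot> id_refl X (colim_i A f Zero \<cdot> a)))"

subsection \<open>The iterated one-step truncation\<close>

definition step_types where "step_types A = atom 4 \<cdot> A"
definition step_types_ty where "step_types_ty = pi (univ 0) (\<lambda>A. NN \<rightarrowtriangle> U2)"
definition step_types_tm where "step_types_tm = fn (univ 0) (iter_seq 0)"

definition step_maps where "step_maps A = atom 5 \<cdot> A"
definition step_maps_ty where "step_maps_ty = pi (univ 0) (\<lambda>A. colim_map (step_types A))"
definition step_maps_tm where "step_maps_tm = fn (univ 0) (iter_map 0)"

text \<open>The type \<open>one_inf 0 A\<close> and the inclusion of \<open>A\<close>, with names for the sequence and its maps.\<close>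

definition infty where "infty A = colim (step_types A) (step_maps A)"
definition infty_in where "infty_in A = colim_i (step_types A) (step_maps A) Zero"

abbreviation "one_elim \<equiv> atom 19"
definition one_elim_ty where "one_elim_ty = pi (univ 0) (\<lambda>A. ind_ty (step_types A) (step_maps A))"
definition one_elim_tm where
  "one_elim_tm = fn (univ 0) (\<lambda>A. fn NN (\<lambda>n. let B = step_types A \<cdot> n in fn (one B \<rightarrowtriangle> U2) (\<lambda>R.
     fn (pi (one B) (\<lambda>z. isprop (R \<cdot> z))) (\<lambda>pr. fn (pi B (\<lambda>x. R \<cdot> one_f B x)) (\<lambda>h.
       cst cOne_ind \<cdot> B \<cdot> R \<cdot> h \<cdot> fn B (\<lambda>x. fn B (\<lambda>y. pr \<cdot> one_f B y
         \<cdot> (fwd (one B) R (one_f B x) (one_f B y) (one_e B x y) \<cdot> (h \<cdot> x)) \<cdot> (h \<cdot> y))))))))"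

abbreviation "isprop_infty \<equiv> atom 20"
definition isprop_infty_ty where "isprop_infty_ty = pi (univ 0) (\<lambda>A. isprop (infty A))"
definition isprop_infty_tm where
  "isprop_infty_tm = fn (univ 0) (\<lambda>A. isprop_colim \<cdot> step_types A \<cdot> step_maps A
     \<cdot> fn NN (\<lambda>n. let B = step_types A \<cdot> n in fn B (\<lambda>x. fn B (\<lambda>y.
          cotrans (one B) (one_f B x) (one_f B x) (one_f B y) (one_e B x x) (one_e B x y))))
     \<cdot> fn NN (\<lambda>n. let B = step_types A \<cdot> n in fn B (\<lambda>x.
          cotrans_refl \<cdot> one B \<cdot> one_f B x \<cdot> one_f B x \<cdot> one_e B x x))
     \<cdot> (one_elim \<cdot> A))"

definition props where "props = atom 21"
definition props_ty where "props_ty = U2"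
definition props_tm where "props_tm = hProp 1"

definition carrier where "carrier Y = atom 22 \<cdot> Y"
definition carrier_ty where "carrier_ty = props \<rightarrowtriangle> univ 1"
definition carrier_tm where "carrier_tm = fn props (\<lambda>Y. underlying 1 Y)"

text \<open>The second projection of \<open>props\<close>. In the case of a pair \<open>(X, p)\<close> the proof is \<open>p\<close> itself,
  because the carrier of \<open>(X, p)\<close> is judgmentally \<open>X\<close>.\<close>

abbreviation "isprop_carrier \<equiv> atom 23"
definition isprop_carrier_ty where "isprop_carrier_ty = pi props (\<lambda>Y. isprop (carrier Y))"
definition isprop_carrier_tm where
  "isprop_carrier_tm = fn props (\<lambda>Y. cst cSigma_ind \<cdot> univ 1 \<cdot> fn (univ 1) isprop
     \<cdot> fn props (\<lambda>Y. isprop (carrier Y)) \<cdot> fn (univ 1) (\<lambda>X. fn (isprop X) (\<lambda>p. p)) \<cdot> Y)"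

definition infty_elim where
  "infty_elim A P h = colim_elim \<cdot> step_types A \<cdot> step_maps A \<cdot> (one_elim \<cdot> A)
     \<cdot> fn (infty A) (\<lambda>x. carrier (P \<cdot> x)) \<cdot> fn (infty A) (\<lambda>x. isprop_carrier \<cdot> (P \<cdot> x)) \<cdot> h"

definition prop_equiv_ctx where
  "prop_equiv_ctx b K = b U2 (\<lambda>X. b U2 (\<lambda>Y. b (isprop X) (\<lambda>p. b (isprop Y) (\<lambda>q.
     b (X \<rightarrowtriangle> Y) (\<lambda>f. b (Y \<rightarrowtriangle> X) (\<lambda>g. K X Y p q f g))))))"
definition mk_pair where "mk_pair A B a b = cst cPair \<cdot> A \<cdot> fn A B \<cdot> a \<cdot> b"
abbreviation "prop_equiv \<equiv> atom 24"
definition prop_equiv_ty where "prop_equiv_ty = prop_equiv_ctx pi (\<lambda>X Y p q f g. equivalence X Y)"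
definition prop_equiv_tm where
  "prop_equiv_tm = prop_equiv_ctx fn (\<lambda>X Y p q f g.
     mk_pair (X \<rightarrowtriangle> Y) (\<lambda>f. isequiv X Y f) f
       (mk_pair (sigma (Y \<rightarrowtriangle> X) (\<lambda>g. pi Y (\<lambda>y. Idt Y (f \<cdot> (g \<cdot> y)) y)))
             (\<lambda>_. sigma (Y \<rightarrowtriangle> X) (\<lambda>h. pi X (\<lambda>x. Idt X (h \<cdot> (f \<cdot> x)) x)))
          (mk_pair (Y \<rightarrowtriangle> X) (\<lambda>g. pi Y (\<lambda>y. Idt Y (f \<cdot> (g \<cdot> y)) y)) g (fn Y (\<lambda>y. q \<cdot> (f \<cdot> (g \<cdot> y)) \<cdot> y)))
          (mk_pair (Y \<rightarrowtriangle> X) (\<lambda>h. pi X (\<lambda>x. Idt X (h \<cdot> (f \<cdot> x)) x)) g (fn X (\<lambda>x. p \<cdot> (g \<cdot> (f \<cdot> x)) \<cdot> x)))))"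

text \<open>With a propositional truncation, the equivalence is between mere propositions, and each
  map comes from the elimination principle of its domain.\<close>

definition trunc_equiv where
  "trunc_equiv A = (let X = infty A; Y = trunc A; eps = fn Y (\<lambda>x. fn Y (\<lambda>y. trunc_eps A x y)) in
     prop_equiv \<cdot> one_inf 0 A \<cdot> Y \<cdot> (isprop_infty \<cdot> A) \<cdot> eps
       \<cdot> (colim_elim \<cdot> step_types A \<cdot> step_maps A \<cdot> (one_elim \<cdot> A) \<cdot> fn X (\<lambda>_. Y) \<cdot> fn X (\<lambda>_. eps) \<cdot> fn A (\<lambda>a. trunc_in A a))
       \<cdot> (cst cTrunc_ind \<cdot> A \<cdot> fn Y (\<lambda>_. X) \<cdot> fn A (\<lambda>a. infty_in A \<cdot> a)
            \<cdot> fn Y (\<lambda>x. fn Y (\<lambda>y. fn X (\<lambda>u. fn X (\<lambda>v.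
                isprop_infty \<cdot> A \<cdot> (transport Y (fn Y (\<lambda>_. X)) x y (trunc_eps A x y) \<cdot> u) \<cdot> v))))))"

subsection \<open>The table\<close>

definition table :: "(scoped \<times> scoped \<times> bool) list" where
  "table = [
     (fwd_ty, fwd_tm, True), (bwd_ty, bwd_tm, True), (cotrans_ty, cotrans_tm, True), (base_point_ty, base_point_tm, True),
     (step_types_ty, step_types_tm, True), (step_maps_ty, step_maps_tm, True), (fwd_along_ty, fwd_along_tm, True),
     (lifted_ty, lifted_tm, True), (cotrans_refl_ty, cotrans_refl_tm, False), (fwd_bwd_ty, fwd_bwd_tm, False),
     (naturality_ty, naturality_tm, False), (coherence_ty, coherence_tm, False), (extension_ty, extension_tm, False),
     (path_unique_ty, path_unique_tm, False), (right_inverse_ty, right_inverse_tm, False),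
     (funext_ty, funext_tm, False), (isprop_paths_ty, isprop_paths_tm, False), (colim_elim_ty, colim_elim_tm, True),
     (isprop_colim_ty, isprop_colim_tm, False), (one_elim_ty, one_elim_tm, False),
     (isprop_infty_ty, isprop_infty_tm, False), (props_ty, props_tm, True), (carrier_ty, carrier_tm, True),
     (isprop_carrier_ty, isprop_carrier_tm, False), (prop_equiv_ty, prop_equiv_tm, False)]"

definition entry :: "nat \<Rightarrow> (tm \<times> tm option) option" where
  "entry n = (if n < length table
     then (case table ! n of (A, t, transparent) \<Rightarrow> Some (raw A, if transparent then Some (raw t) else None))
     else None)"

definition atoms :: "nat \<Rightarrow> env" where "atoms N n = (if n < N then entry n else None)"

abbreviation library :: env where "library \<equiv> atoms 25"

lemmas term_defs =
  raw_def fn_def pi_def ap_def bind_def emb_def cst_def univ_def arr_def Idt_def id_refl_def path_ind_def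
  transport_def sigma_def pr1_def isprop_def hProp_def underlying_def isequiv_def equivalence_def happly_def
  one_def one_f_def one_e_def colim_map_def colim_def colim_i_def colim_g_def iter_def iter_seq_def
  iter_map_def Let_def atom_def family_ctx_def fwd_def fwd_ty_def fwd_tm_def bwd_def bwd_ty_def bwd_tm_def
  cotrans_def cotrans_ty_def cotrans_tm_def fwd_along_def fwd_along_ctx_def fwd_along_ty_def fwd_along_tm_def
  cotrans_refl_ty_def cotrans_refl_tm_def fwd_bwd_ty_def fwd_bwd_tm_def wconst_def wconst_refl_def seq_ctx_def
  cocone_ctx_def base_point_def base_point_ty_def base_point_tm_def lifted_def lifted_ctx_def lifted_ty_def
  lifted_tm_def naturality_ctx_def naturality_goal_def naturality_ty_def naturality_tm_def descend_def
  next_value_def section_value_def coherence_ctx_def coherence_ty_def coherence_tm_def extension_ctx_def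
  extension_ty_def extension_tm_def path_unique_ty_def path_unique_tm_def right_inverse_ty_def
  right_inverse_tm_def funext_ty_def funext_tm_def isprop_paths_ty_def isprop_paths_tm_def ind_ty_def
  colim_elim_ctx_def colim_elim_ty_def colim_elim_tm_def isprop_colim_ctx_def isprop_colim_ty_def
  isprop_colim_tm_def step_types_def step_types_ty_def step_types_tm_def step_maps_def step_maps_ty_def
  step_maps_tm_def infty_def one_elim_ty_def one_elim_tm_def isprop_infty_ty_def isprop_infty_tm_def props_def
  props_ty_def props_tm_def carrier_def carrier_ty_def carrier_tm_def isprop_carrier_ty_def
  isprop_carrier_tm_def prop_equiv_ctx_def mk_pair_def prop_equiv_ty_def prop_equiv_tm_def

text \<open>
  The raw terms of the entries are computed here, once and for all, and used as code equations.
  Otherwise every look-up would evaluate the scoped term anew. Numerals are turned into the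
  form \<open>Suc (\<dots> 0)\<close>, on which the checker works by pattern matching.
\<close>

lemmas numeral_Suc = numeral_eq_Suc pred_numeral_simps BitM.simps numeral_nat One_nat_def
  diff_Suc_Suc minus_nat.diff_0 diff_0_eq_0 add_0_left add_0_right add_Suc add_Suc_right

lemma entries:
  "entry 0 = (case table ! 0 of (A, t, b) \<Rightarrow> Some (raw A, if b then Some (raw t) else None))"
  "entry 1 = (case table ! 1 of (A, t, b) \<Rightarrow> Some (raw A, if b then Some (raw t) else None))"
  "entry 2 = (case table ! 2 of (A, t, b) \<Rightarrow> Some (raw A, if b then Some (raw t) else None))"
  "entry 3 = (case table ! 3 of (A, t, b) \<Rightarrow> Some (raw A, if b then Some (raw t) else None))"
  "entry 4 = (case table ! 4 of (A, t, b) \<Rightarrow> Some (raw A, if b then Some (raw t) else None))"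
  "entry 5 = (case table ! 5 of (A, t, b) \<Rightarrow> Some (raw A, if b then Some (raw t) else None))"
  "entry 6 = (case table ! 6 of (A, t, b) \<Rightarrow> Some (raw A, if b then Some (raw t) else None))"
  "entry 7 = (case table ! 7 of (A, t, b) \<Rightarrow> Some (raw A, if b then Some (raw t) else None))"
  "entry 8 = (case table ! 8 of (A, t, b) \<Rightarrow> Some (raw A, if b then Some (raw t) else None))"
  "entry 9 = (case table ! 9 of (A, t, b) \<Rightarrow> Some (raw A, if b then Some (raw t) else None))"
  "entry 10 = (case table ! 10 of (A, t, b) \<Rightarrow> Some (raw A, if b then Some (raw t) else None))"
  "entry 11 = (case table ! 11 of (A, t, b) \<Rightarrow> Some (raw A, if b then Some (raw t) else None))"
  "entry 12 = (case table ! 12 of (A, t, b) \<Rightarrow> Some (raw A, if b then Some (raw t) else None))"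
  "entry 13 = (case table ! 13 of (A, t, b) \<Rightarrow> Some (raw A, if b then Some (raw t) else None))"
  "entry 14 = (case table ! 14 of (A, t, b) \<Rightarrow> Some (raw A, if b then Some (raw t) else None))"
  "entry 15 = (case table ! 15 of (A, t, b) \<Rightarrow> Some (raw A, if b then Some (raw t) else None))"
  "entry 16 = (case table ! 16 of (A, t, b) \<Rightarrow> Some (raw A, if b then Some (raw t) else None))"
  "entry 17 = (case table ! 17 of (A, t, b) \<Rightarrow> Some (raw A, if b then Some (raw t) else None))"
  "entry 18 = (case table ! 18 of (A, t, b) \<Rightarrow> Some (raw A, if b then Some (raw t) else None))"
  "entry 19 = (case table ! 19 of (A, t, b) \<Rightarrow> Some (raw A, if b then Some (raw t) else None))"
  "entry 20 = (case table ! 20 of (A, t, b) \<Rightarrow> Some (raw A, if b then Some (raw t) else None))"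
  "entry 21 = (case table ! 21 of (A, t, b) \<Rightarrow> Some (raw A, if b then Some (raw t) else None))"
  "entry 22 = (case table ! 22 of (A, t, b) \<Rightarrow> Some (raw A, if b then Some (raw t) else None))"
  "entry 23 = (case table ! 23 of (A, t, b) \<Rightarrow> Some (raw A, if b then Some (raw t) else None))"
  "entry 24 = (case table ! 24 of (A, t, b) \<Rightarrow> Some (raw A, if b then Some (raw t) else None))"
  by (simp_all add: entry_def table_def numeral_eq_Suc)

lemmas entry_code [code] =
  entries[unfolded table_def term_defs numeral_Suc nth_Cons_0 nth_Cons_Suc nth_Cons_numeral prod.case if_True if_False]

section \<open>The runs of the checker\<close>

text \<open>
  An entry is checked without a local context, against atoms of smaller number only. A recursion
  depth of \<open>70\<close> is enough for all runs.
\<close>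

primrec bounded :: "nat \<Rightarrow> tm \<Rightarrow> bool" where
  "bounded n (Var m) = (m < n)"
| "bounded n (U i) = True"
| "bounded n (Pi A B) = (if bounded n A then bounded (Suc n) B else False)"
| "bounded n (Lam A b) = (if bounded n A then bounded (Suc n) b else False)"
| "bounded n (App f a) = (if bounded n f then bounded n a else False)"
| "bounded n (Const c) = True"

definition valid :: "nat \<Rightarrow> scoped \<Rightarrow> scoped \<Rightarrow> bool" where
  "valid n t A = (if bounded n (raw t) then if bounded n (raw A)
     then checks Without_Trunc (atoms n) 70 [] (raw t) (raw A) else False else False)"

lemma valid_fwd: "valid 0 fwd_tm fwd_ty" by code_simp
lemma valid_bwd: "valid 1 bwd_tm bwd_ty" by code_simp
lemma valid_cotrans: "valid 2 cotrans_tm cotrans_ty" by code_simp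
lemma valid_base_point: "valid 3 base_point_tm base_point_ty" by code_simp
lemma valid_step_types: "valid 4 step_types_tm step_types_ty" by code_simp
lemma valid_step_maps: "valid 5 step_maps_tm step_maps_ty" by code_simp
lemma valid_fwd_along: "valid 6 fwd_along_tm fwd_along_ty" by code_simp
lemma valid_lifted: "valid 7 lifted_tm lifted_ty" by code_simp
lemma valid_cotrans_refl: "valid 8 cotrans_refl_tm cotrans_refl_ty" by code_simp
lemma valid_fwd_bwd: "valid 9 fwd_bwd_tm fwd_bwd_ty" by code_simp
lemma valid_naturality: "valid 10 naturality_tm naturality_ty" by code_simp
lemma valid_coherence: "valid 11 coherence_tm coherence_ty" by code_simp
lemma valid_extension: "valid 12 extension_tm extension_ty" by code_simp
lemma valid_path_unique: "valid 13 path_unique_tm path_unique_ty" by code_simp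
lemma valid_right_inverse: "valid 14 right_inverse_tm right_inverse_ty" by code_simp
lemma valid_funext: "valid 15 funext_tm funext_ty" by code_simp
lemma valid_isprop_paths: "valid 16 isprop_paths_tm isprop_paths_ty" by code_simp
lemma valid_colim_elim: "valid 17 colim_elim_tm colim_elim_ty" by code_simp
lemma valid_isprop_colim: "valid 18 isprop_colim_tm isprop_colim_ty" by code_simp
lemma valid_one_elim: "valid 19 one_elim_tm one_elim_ty" by code_simp
lemma valid_isprop_infty: "valid 20 isprop_infty_tm isprop_infty_ty" by code_simp
lemma valid_props: "valid 21 props_tm props_ty" by code_simp
lemma valid_carrier: "valid 22 carrier_tm carrier_ty" by code_simp
lemma valid_isprop_carrier: "valid 23 isprop_carrier_tm isprop_carrier_ty" by code_simp
lemma valid_prop_equiv: "valid 24 prop_equiv_tm prop_equiv_ty" by code_simp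

lemma table_valid:
  assumes "n < 25"
  obtains A t b where "table ! n = (A, t, b)" "valid n t A"
proof -
  have "\<forall>n \<in> set [0..<25]. case table ! n of (A, t, b) \<Rightarrow> valid n t A"
    unfolding table_def
    using valid_fwd valid_bwd valid_cotrans valid_base_point valid_step_types valid_step_maps
      valid_fwd_along valid_lifted valid_cotrans_refl valid_fwd_bwd valid_naturality valid_coherence
      valid_extension valid_path_unique valid_right_inverse valid_funext valid_isprop_paths
      valid_colim_elim valid_isprop_colim valid_one_elim valid_isprop_infty valid_props valid_carrier
      valid_isprop_carrier valid_prop_equiv
    by (simp add: upt_rec numeral_eq_Suc)
  with assms have "case table ! n of (A, t, b) \<Rightarrow> valid n t A" by simp
  then show thesis using that by (cases "table ! n") simp
qed

text \<open>
  The remaining runs are over contexts for the variables \<open>A : U i\<close>, \<open>P\<close>, \<open>h\<close> and \<open>a : A\<close>; \<open>arg k\<close> is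
  the \<open>k\<close>-th of them from the outside. The types \<open>P_stated\<close> and \<open>h_stated\<close> are those of the theorem.
  They are replaced at once by the types \<open>P_ty\<close> and \<open>h_ty\<close>, which are judgmentally equal but short,
  because they are written with atoms.
\<close>

definition arg :: "nat \<Rightarrow> scoped" where "arg k = (\<lambda>d. Var (d - Suc k))"

definition P_stated where "P_stated = (one_inf 0 (arg 0) \<rightarrowtriangle> hProp 1) 1"
definition h_stated where "h_stated = pi (arg 0) (\<lambda>a. underlying 1 (arg 1 \<cdot> (inf_i0 0 (arg 0) \<cdot> a))) 2"
definition P_ty where "P_ty = (infty (arg 0) \<rightarrowtriangle> props) 1"
definition h_ty where "h_ty = pi (arg 0) (\<lambda>a. carrier (arg 1 \<cdot> (infty_in (arg 0) \<cdot> a))) 2"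

lemma checked_seq:
  "checks Without_Trunc (atoms 0) 70 [U 0] (iter_seq 0 (arg 0) 1) ((NN \<rightarrowtriangle> univ 0) 1)"
  by code_simp

lemma checked_map:
  "checks Without_Trunc (atoms 0) 70 [U 0] (iter_map 0 (arg 0) 1) (colim_map (iter_seq 0 (arg 0)) 1)"
  by code_simp

lemma checked_inclusion:
  "checks Without_Trunc (atoms 0) 70 [U 0] (inf_i0 0 (arg 0) 1) ((arg 0 \<rightarrowtriangle> one_inf 0 (arg 0)) 1)"
  by code_simp

lemma checked_isprop:
  "checks Without_Trunc library 70 [U 0] ((isprop_infty \<cdot> arg 0) 1) (isprop (one_inf 0 (arg 0)) 1)"
  by code_simp

lemma checked_equivalence:
  "checks With_Trunc library 70 [U 0] (trunc_equiv (arg 0) 1) (equivalence (one_inf 0 (arg 0)) (trunc (arg 0)) 1)"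
  by code_simp

lemma checked_P: "subsumes Without_Trunc library 70 [U 0] P_stated P_ty"
  by code_simp

lemma checked_h: "subsumes Without_Trunc library 70 [P_ty, U 0] h_stated h_ty"
  by code_simp

lemma checked_elim:
  "checks Without_Trunc library 70 [h_ty, P_ty, U 0] (infty_elim (arg 0) (arg 1) (arg 2) 3)
     (pi (infty (arg 0)) (\<lambda>x. carrier (arg 1 \<cdot> x)) 3)"
  by code_simp

lemma checked_elim_type:
  "subsumes Without_Trunc library 70 [h_ty, P_ty, U 0]
     (pi (infty (arg 0)) (\<lambda>x. carrier (arg 1 \<cdot> x)) 3)
     (pi (one_inf 0 (arg 0)) (\<lambda>x. underlying 1 (arg 1 \<cdot> x)) 3)"
  by code_simp

text \<open>
  The computation rule is checked for the general eliminator from colimits, with its parameters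
  as variables, and then instantiated: the induction principle of the colimit has to be given all
  its methods anew, and they are much larger in the instance.
\<close>

definition elim_params :: "tm list" where
  "elim_params =
     [(arg 0 \<cdot> Zero) 6,
      pi (arg 0 \<cdot> Zero) (\<lambda>a. arg 3 \<cdot> (colim_i (arg 0) (arg 1) Zero \<cdot> a)) 5,
      pi (colim (arg 0) (arg 1)) (\<lambda>x. isprop (arg 3 \<cdot> x)) 4,
      (colim (arg 0) (arg 1) \<rightarrowtriangle> U2) 3,
      ind_ty (arg 0) (arg 1) 2,
      colim_map (arg 0) 1,
      (NN \<rightarrowtriangle> U2) 0]"

definition elim_args :: "tm list" where
  "elim_args =
     [arg 3 4, arg 2 4,
      fn (infty (arg 0)) (\<lambda>x. isprop_carrier \<cdot> (arg 1 \<cdot> x)) 4,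
      fn (infty (arg 0)) (\<lambda>x. carrier (arg 1 \<cdot> x)) 4,
      (one_elim \<cdot> arg 0) 4, step_maps (arg 0) 4, step_types (arg 0) 4]"

lemma checked_elim_beta:
  "equates Without_Trunc library 70 elim_params
     ((colim_elim \<cdot> arg 0 \<cdot> arg 1 \<cdot> arg 2 \<cdot> arg 3 \<cdot> arg 4 \<cdot> arg 5 \<cdot> (colim_i (arg 0) (arg 1) Zero \<cdot> arg 6)) 7)
     ((arg 5 \<cdot> arg 6) 7)
     ((arg 3 \<cdot> (colim_i (arg 0) (arg 1) Zero \<cdot> arg 6)) 7)"
  by code_simp

lemma checked_elim_args:
  "checks_args Without_Trunc library 70 [arg 0 3, h_ty, P_ty, U 0] elim_args elim_params"
  by code_simp

lemma checked_point:
  "equates Without_Trunc library 70 [arg 0 3, h_ty, P_ty, U 0]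
     ((inf_i0 0 (arg 0) \<cdot> arg 3) 4) ((infty_in (arg 0) \<cdot> arg 3) 4) (one_inf 0 (arg 0) 4)"
  by code_simp

lemma checked_beta_type:
  "subsumes Without_Trunc library 70 [arg 0 3, h_ty, P_ty, U 0]
     ((fn (infty (arg 0)) (\<lambda>x. carrier (arg 1 \<cdot> x)) \<cdot> (infty_in (arg 0) \<cdot> arg 3)) 4)
     ((underlying 1 (arg 1 \<cdot> (inf_i0 0 (arg 0) \<cdot> arg 3))) 4)"
  by code_simp

section \<open>From the runs to the theorem\<close>

text \<open>A derivation that ends over \<open>A # \<Gamma>\<close> may continue over \<open>\<Gamma>\<close>, so the claim is made for all
  final segments of the context.\<close>

lemma typing_ctx_aux:
  "(T \<turnstile> \<Gamma> ctx \<longrightarrow> (\<forall>n. T \<turnstile> drop n \<Gamma> ctx)) \<and> (T; \<Delta> \<turnstile> t \<Colon> A \<longrightarrow> (\<forall>n. T \<turnstile> drop n \<Delta> ctx)) \<and> (T; \<Theta> \<turnstile> u \<equiv> v \<Colon> B \<longrightarrow> True)"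
proof -
  have *: "T \<turnstile> drop n \<Gamma> ctx" if "\<forall>n. T \<turnstile> drop n (A # \<Gamma>) ctx" for n A \<Gamma>
    using that[rule_format, of "Suc n"] by simp
  show ?thesis
proof (induction rule: ctx_typing_jeq.induct)
  case ctx_empty show ?case by (simp add: ctx_typing_jeq.ctx_empty)
next
  case (ctx_ext \<Gamma> A i)
  show ?case
  proof
    fix n show "T \<turnstile> drop n (A # \<Gamma>) ctx" using ctx_ext ctx_typing_jeq.ctx_ext by (cases n) auto
  qed
next
  case (ty_weaken \<Gamma> a A B i)
  show ?case
  proof
    fix n show "T \<turnstile> drop n (B # \<Gamma>) ctx" using ty_weaken ctx_typing_jeq.ctx_ext by (cases n) auto
  qed
qed (auto intro: *)
qed

lemma typing_ctx: "T; \<Gamma> \<turnstile> t \<Colon> A \<Longrightarrow> T \<turnstile> \<Gamma> ctx"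
  using typing_ctx_aux[of T \<Gamma> \<Gamma> t A \<Gamma> t t A] by (metis drop0)

lemma interp_bounded:
  "bounded n t \<Longrightarrow> (\<And>m. m < n \<Longrightarrow> \<sigma> m = \<tau> m) \<Longrightarrow> interp \<rho> \<sigma> t = interp \<rho> \<tau> t"
proof (induction t arbitrary: n \<sigma> \<tau>)
  case (Pi A B)
  have "interp \<rho> \<sigma> A = interp \<rho> \<tau> A"
    using Pi.prems by (intro Pi.IH(1)[of n]) (auto split: if_splits)
  moreover have "interp \<rho> (up \<sigma>) B = interp \<rho> (up \<tau>) B"
    using Pi.prems by (intro Pi.IH(2)[of "Suc n"]) (auto simp: up_def scons_def split: nat.split if_splits)
  ultimately show ?case by simp
next
  case (Lam A b)
  have "interp \<rho> \<sigma> A = interp \<rho> \<tau> A"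
    using Lam.prems by (intro Lam.IH(1)[of n]) (auto split: if_splits)
  moreover have "interp \<rho> (up \<sigma>) b = interp \<rho> (up \<tau>) b"
    using Lam.prems by (intro Lam.IH(2)[of "Suc n"]) (auto simp: up_def scons_def split: nat.split if_splits)
  ultimately show ?case by simp
next
  case (App f a)
  have "interp \<rho> \<sigma> f = interp \<rho> \<tau> f" "interp \<rho> \<sigma> a = interp \<rho> \<tau> a"
    using App.prems by (intro App.IH(1)[of n] App.IH(2)[of n]; auto split: if_splits)+
  then show ?case by simp
qed auto

context levels begin

text \<open>Adding global names only restricts the interpretations.\<close>

lemma aligned_mono:
  assumes "\<And>\<Gamma> G \<sigma>. models \<Gamma> E' G \<sigma> \<Longrightarrow> models \<Gamma> E G \<sigma>"
  shows "aligned t E G A \<Longrightarrow> aligned t E' G A"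
proof -
  have *: "has E G t A \<Longrightarrow> has E' G t A" for G t A using assms by (auto simp: has_def)
  show "aligned t E G A \<Longrightarrow> aligned t E' G A"
  proof (induction t arbitrary: G A)
    case (Lam C b)
    then show ?case using * by (simp, blast)
  qed (auto intro: *)
qed

text \<open>
  The first \<open>n\<close> entries have an interpretation over every context: each is interpreted by its
  body, under the interpretation of the atoms of smaller number.
\<close>

definition realized :: "nat \<Rightarrow> bool" where
  "realized n \<longleftrightarrow> typed_defs (atoms n) \<and> (\<forall>\<Gamma>. (T \<turnstile> \<Gamma> ctx) \<longrightarrow> (\<exists>\<sigma>. models \<Gamma> (atoms n) [] \<sigma>))
     \<and> (\<forall>m A d. atoms n m = Some (A, d) \<longrightarrow> bounded m A \<and> (\<forall>e. d = Some e \<longrightarrow> bounded m e))"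

lemma realized_Suc:
  assumes n: "realized n" and n25: "n < 25"
  shows "realized (Suc n)"
proof -
  obtain A t b where e: "table ! n = (A, t, b)" and v: "valid n t A" using table_valid[OF n25] .
  then have bd: "bounded n (raw t)" "bounded n (raw A)"
    and ck: "checks Without_Trunc (atoms n) 70 [] (raw t) (raw A)"
    by (auto simp: valid_def split: if_splits)
  have len: "n < length table" using n25 by (simp add: table_def)
  have l: "entry n = Some (raw A, if b then Some (raw t) else None)" by (simp add: entry_def e len)
  have td: "typed_defs (atoms n)" using n by (simp add: realized_def)
  have al: "aligned (raw t) (atoms n) [] (raw A)" using checks_sound[OF td _ ck] by simp
  have up_Suc: "atoms (Suc n) m = (if m = n then entry n else atoms n m)" for m by (auto simp: atoms_def)
  have un: "atoms n n = None" by (simp add: atoms_def)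
  have mono: "models \<Gamma> (atoms (Suc n)) G \<sigma> \<Longrightarrow> models \<Gamma> (atoms n) G \<sigma>" for \<Gamma> G \<sigma>
    unfolding models_def up_Suc using un by (metis option.distinct(1))
  have am: "aligned s (atoms n) G B \<Longrightarrow> aligned s (atoms (Suc n)) G B" for s G B
    by (rule aligned_mono[of "atoms (Suc n)" "atoms n"]) (rule mono)
  have "aligned e (atoms (Suc n)) [] B" if "atoms (Suc n) m = Some (B, Some e)" for m B e
  proof (rule am, cases "m = n")
    case True
    then show "aligned e (atoms n) [] B" using that al l by (auto simp: up_Suc split: if_splits)
  next
    case False
    then show "aligned e (atoms n) [] B" using that td by (auto simp: up_Suc typed_defs_def)
  qed
  then have "typed_defs (atoms (Suc n))" by (simp add: typed_defs_def)
  moreover have "\<exists>\<tau>. models \<Gamma> (atoms (Suc n)) [] \<tau>" if \<Gamma>: "T \<turnstile> \<Gamma> ctx" for \<Gamma>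
  proof -
    obtain \<sigma> where g: "models \<Gamma> (atoms n) [] \<sigma>" using n \<Gamma> by (auto simp: realized_def)
    define \<tau> where "\<tau> = \<sigma>(n := I \<sigma> (raw t))"
    have eq: "I \<tau> s = I \<sigma> s" if "bounded m s" "m \<le> n" for s m
      using that by (intro interp_bounded[of m]) (auto simp: \<tau>_def)
    have "T; \<Gamma> \<turnstile> I \<sigma> (raw t) \<Colon> I \<sigma> (raw A)" using aligned_has[OF al] g by (simp add: has_def)
    moreover have "T; \<Gamma> \<turnstile> \<sigma> m \<Colon> I \<tau> B \<and> (\<forall>e. d = Some e \<longrightarrow> \<sigma> m = I \<tau> e)" if m: "atoms n m = Some (B, d)" for m B d
    proof -
      have "m < n" using m by (auto simp: atoms_def split: if_splits)
      moreover have "bounded m B" "\<And>e. d = Some e \<Longrightarrow> bounded m e" using n m by (auto simp: realized_def)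
      ultimately show ?thesis using g m by (auto simp: models_def eq)
    qed
    moreover have "\<tau> n = I \<sigma> (raw t)" "I \<tau> (raw t) = I \<sigma> (raw t)" "I \<tau> (raw A) = I \<sigma> (raw A)"
      using eq[OF bd(1)] eq[OF bd(2)] by (auto simp: \<tau>_def)
    moreover have "\<tau> m = \<sigma> m" if "m \<noteq> n" for m using that by (simp add: \<tau>_def)
    ultimately have "models \<Gamma> (atoms (Suc n)) [] \<tau>"
      unfolding models_def up_Suc using \<Gamma> l by (auto split: if_splits)
    then show ?thesis by blast
  qed
  moreover have "bounded m B \<and> (\<forall>e. d = Some e \<longrightarrow> bounded m e)" if "atoms (Suc n) m = Some (B, d)" for m B d
    using that n bd l unfolding up_Suc by (auto simp: realized_def split: if_splits)
  ultimately show ?thesis by (auto simp: realized_def)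
qed

lemma realized_library: "realized 25"
proof -
  have "realized n" if "n \<le> 25" for n
    using that
  proof (induction n)
    case 0
    show ?case by (auto simp: realized_def typed_defs_def models_def atoms_def)
  next
    case (Suc n)
    then show ?case using realized_Suc by simp
  qed
  then show ?thesis by simp
qed

lemma library_models: "T \<turnstile> \<Gamma> ctx \<Longrightarrow> \<exists>\<sigma>. models \<Gamma> library [] \<sigma>"
  and library_defs: "typed_defs library"
  using realized_library by (auto simp: realized_def)

lemma checks_in_ctx:
  assumes "w = Without_Trunc \<or> w = T" "checks w library k G t A" "models \<Gamma> library G \<sigma>"
  shows "T; \<Gamma> \<turnstile> I \<sigma> t \<Colon> I \<sigma> A"
  using aligned_has[OF checks_sound[OF library_defs assms(1,2)]] assms(3) by (simp add: has_def)

lemma subsumes_in_ctx: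
  assumes "w = Without_Trunc \<or> w = T" "subsumes w library k G A B" "models \<Gamma> library G \<sigma>"
  shows "T; \<Gamma> \<turnstile> t \<Colon> I \<sigma> A \<Longrightarrow> T; \<Gamma> \<turnstile> t \<Colon> I \<sigma> B"
    and "T; \<Gamma> \<turnstile> s \<equiv> t \<Colon> I \<sigma> A \<Longrightarrow> T; \<Gamma> \<turnstile> s \<equiv> t \<Colon> I \<sigma> B"
  using subsumes_sound[OF library_defs assms(1,2)] assms(3) by (auto simp: subt_def)

lemma equates_in_ctx:
  assumes "w = Without_Trunc \<or> w = T" "equates w library k G s t A" "models \<Gamma> library G \<sigma>"
  shows "T; \<Gamma> \<turnstile> I \<sigma> s \<equiv> I \<sigma> t \<Colon> I \<sigma> A"
  using equates_sound[OF library_defs assms(1,2)] assms(3) by (simp add: eqv_def)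

end

lemmas final_simps = hoas arg_def atom_def body_def numeral_eq_Suc levels.\<rho>_simps

lemma equivalence_part:
  assumes A: "With_Trunc; \<Gamma> \<turnstile> A \<Colon> U i"
  shows "\<exists>e. With_Trunc; \<Gamma> \<turnstile> e \<Colon> raw (equivalence (one_inf i (emb A)) (trunc (emb A)))"
proof -
  interpret levels With_Trunc i 0 .
  obtain \<sigma> where g: "models \<Gamma> library [] \<sigma>" using library_models[OF typing_ctx[OF A]] by blast
  have "models \<Gamma> library [U 0] (scons A \<sigma>)" using models_scons[OF g, of A "U 0"] A by simp
  from checks_in_ctx[OF _ checked_equivalence this]
  have "With_Trunc; \<Gamma> \<turnstile> I (scons A \<sigma>) (trunc_equiv (arg 0) 1) \<Colon> I (scons A \<sigma>) (equivalence (one_inf 0 (arg 0)) (trunc (arg 0)) 1)"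
    by simp
  also have "I (scons A \<sigma>) (equivalence (one_inf 0 (arg 0)) (trunc (arg 0)) 1) = raw (equivalence (one_inf i (emb A)) (trunc (emb A)))"
    by (simp add: final_simps)
  finally show ?thesis by blast
qed

context
  fixes \<Gamma> A and i j :: nat assumes A: "Without_Trunc; \<Gamma> \<turnstile> A \<Colon> U i"
begin

interpretation levels Without_Trunc i j .

lemma models_type: obtains \<sigma> where "models \<Gamma> library [U 0] (scons A \<sigma>)"
proof -
  obtain \<sigma> where g: "models \<Gamma> library [] \<sigma>" using library_models[OF typing_ctx[OF A]] by blast
  from that models_scons[OF g, of A "U 0"] A show thesis by simp
qed

lemma formation_part:
  shows "Without_Trunc; \<Gamma> \<turnstile> raw (one_inf i (emb A)) \<Colon> U i"
    and "Without_Trunc; \<Gamma> \<turnstile> raw (inf_i0 i (emb A)) \<Colon> raw (emb A \<rightarrowtriangle> one_inf i (emb A))"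
    and "\<exists>m. Without_Trunc; \<Gamma> \<turnstile> m \<Colon> raw (isprop (one_inf i (emb A)))"
proof -
  have \<Gamma>: "Without_Trunc \<turnstile> \<Gamma> ctx" using typing_ctx[OF A] .
  obtain \<sigma> where g: "models \<Gamma> library [U 0] (scons A \<sigma>)" using models_type .
  have g0: "models \<Gamma> (atoms 0) [U 0] (scons A \<sigma>)" using g by (simp add: models_def atoms_def)
  have defs0: "typed_defs (atoms 0)" by (simp add: typed_defs_def atoms_def)
  note checks0 = aligned_has[OF checks_sound[OF defs0], unfolded has_def, rule_format, OF _ _ g0]
  have seq: "Without_Trunc; \<Gamma> \<turnstile> raw (iter_seq i (emb A)) \<Colon> raw (NN \<rightarrowtriangle> univ i)"
    using checks0[OF _ checked_seq] by (simp add: final_simps)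
  have map: "Without_Trunc; \<Gamma> \<turnstile> raw (iter_map i (emb A)) \<Colon> raw (colim_map (iter_seq i (emb A)))"
    using checks0[OF _ checked_map] by (simp add: final_simps)
  \<comment> \<open>The checker would place the colimit in the universe of code \<open>2\<close>, above \<open>U i\<close>.\<close>
  have "Without_Trunc; \<Gamma> \<turnstile> Const cColim \<Colon> raw (pi (NN \<rightarrowtriangle> univ i) (\<lambda>A. colim_map A \<rightarrowtriangle> univ i))"
    using \<Gamma> by (intro ty_const const_type.intros)
  then have "Without_Trunc; \<Gamma> \<turnstile> Const cColim \<Colon> Pi (raw (NN \<rightarrowtriangle> univ i)) (Pi (body colim_map) (U i))"
    by (simp add: final_simps)
  from ty_app[OF this seq]
  have "Without_Trunc; \<Gamma> \<turnstile> App (Const cColim) (raw (iter_seq i (emb A)))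
      \<Colon> Pi (raw (colim_map (iter_seq i (emb A)))) (U i)"
    by (simp add: final_simps shift_shift)
  from ty_app[OF this map]
  show "Without_Trunc; \<Gamma> \<turnstile> raw (one_inf i (emb A)) \<Colon> U i"
    by (simp add: final_simps)
  show "Without_Trunc; \<Gamma> \<turnstile> raw (inf_i0 i (emb A)) \<Colon> raw (emb A \<rightarrowtriangle> one_inf i (emb A))"
    using checks0[OF _ checked_inclusion] by (simp add: final_simps)
  have "Without_Trunc; \<Gamma> \<turnstile> I (scons A \<sigma>) ((isprop_infty \<cdot> arg 0) 1) \<Colon> raw (isprop (one_inf i (emb A)))"
    using checks_in_ctx[OF _ checked_isprop g] by (simp add: final_simps)
  then show "\<exists>m. Without_Trunc; \<Gamma> \<turnstile> m \<Colon> raw (isprop (one_inf i (emb A)))" by blast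
qed

lemma elimination_part:
  assumes P: "Without_Trunc; \<Gamma> \<turnstile> P \<Colon> raw (one_inf i (emb A) \<rightarrowtriangle> hProp j)"
    and h: "Without_Trunc; \<Gamma> \<turnstile> h \<Colon> raw (pi (emb A) (\<lambda>a. underlying j (emb P \<cdot> (inf_i0 i (emb A) \<cdot> a))))"
  shows "\<exists>k. Without_Trunc; \<Gamma> \<turnstile> k \<Colon>
           raw (pi (one_inf i (emb A)) (\<lambda>x. underlying j (emb P \<cdot> x))) \<and>
         Without_Trunc; A # \<Gamma> \<turnstile>
           body (\<lambda>a. emb k \<cdot> (inf_i0 i (emb A) \<cdot> a)) \<equiv> body (\<lambda>a. emb h \<cdot> a)
           \<Colon> body (\<lambda>a. underlying j (emb P \<cdot> (inf_i0 i (emb A) \<cdot> a)))"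
proof -
  obtain \<sigma> where gA: "models \<Gamma> library [U 0] (scons A \<sigma>)" using models_type .
  have "Without_Trunc; \<Gamma> \<turnstile> P \<Colon> I (scons A \<sigma>) P_stated" using P by (simp add: P_stated_def final_simps)
  from subsumes_in_ctx(1)[OF _ checked_P gA this]
  have gP: "models \<Gamma> library [P_ty, U 0] (scons P (scons A \<sigma>))" using models_scons[OF gA] by simp
  have "Without_Trunc; \<Gamma> \<turnstile> h \<Colon> I (scons P (scons A \<sigma>)) h_stated" using h by (simp add: h_stated_def final_simps)
  from subsumes_in_ctx(1)[OF _ checked_h gP this]
  have gh: "models \<Gamma> library [h_ty, P_ty, U 0] (scons h (scons P (scons A \<sigma>)))" using models_scons[OF gP] by simp
  define \<tau> where "\<tau> = scons h (scons P (scons A \<sigma>))"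
  note gh = gh[folded \<tau>_def]
  define k where "k = I \<tau> (infty_elim (arg 0) (arg 1) (arg 2) 3)"
  have "Without_Trunc; \<Gamma> \<turnstile> k \<Colon> I \<tau> (pi (infty (arg 0)) (\<lambda>x. carrier (arg 1 \<cdot> x)) 3)"
    using checks_in_ctx[OF _ checked_elim gh] by (simp add: k_def)
  from subsumes_in_ctx(1)[OF _ checked_elim_type gh this]
  have k: "Without_Trunc; \<Gamma> \<turnstile> k \<Colon> raw (pi (one_inf i (emb A)) (\<lambda>x. underlying j (emb P \<cdot> x)))"
    by (simp add: final_simps \<tau>_def)

  have ga: "models (A # \<Gamma>) library [arg 0 3, h_ty, P_ty, U 0] (up \<tau>)"
    using models_up[OF gh, of "arg 0 3" i] A by (simp add: final_simps \<tau>_def)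
  \<comment> \<open>The inclusion of the theorem is first exchanged for \<open>infty_in\<close>, for which the computation
    rule of \<open>colim_elim\<close> is stated.\<close>
  let ?x = "I (up \<tau>) ((infty_in (arg 0) \<cdot> arg 3) 4)" and ?x' = "I (up \<tau>) ((inf_i0 0 (arg 0) \<cdot> arg 3) 4)"
    and ?B = "I (up \<tau>) ((underlying 1 (arg 1 \<cdot> (inf_i0 0 (arg 0) \<cdot> arg 3))) 4)"
  have "Without_Trunc; A # \<Gamma> \<turnstile> shift 0 k \<Colon> Pi (I (up \<tau>) (one_inf 0 (arg 0) 4))
      (I (up (up \<tau>)) (underlying 1 (arg 1 \<cdot> arg 4) 5))"
    using ty_weaken[OF k A] by (simp add: final_simps \<tau>_def shift_shift)
  from eq_app[OF eq_refl[OF this], OF equates_in_ctx[OF _ checked_point ga]]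
  have "Without_Trunc; A # \<Gamma> \<turnstile> App (shift 0 k) ?x' \<equiv> App (shift 0 k) ?x \<Colon> ?B"
    by (simp add: final_simps inst_shift)
  moreover have "models (A # \<Gamma>) library elim_params (bindings \<rho> (up \<tau>) 4 elim_args)"
    using checks_args_sound[OF library_defs _ ga checked_elim_args] by (simp add: numeral_eq_Suc)
  from equates_in_ctx[OF _ checked_elim_beta this]
  have "Without_Trunc; A # \<Gamma> \<turnstile> App (shift 0 k) ?x \<equiv> App (shift 0 h) (Var 0)
      \<Colon> I (up \<tau>) ((fn (infty (arg 0)) (\<lambda>x. carrier (arg 1 \<cdot> x)) \<cdot> (infty_in (arg 0) \<cdot> arg 3)) 4)"
    by (simp add: final_simps \<tau>_def k_def elim_args_def infty_def infty_in_def infty_elim_def carrier_def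
        step_maps_def step_types_def shift_shift)
  from subsumes_in_ctx(2)[OF _ checked_beta_type ga this]
  have "Without_Trunc; A # \<Gamma> \<turnstile> App (shift 0 k) ?x \<equiv> App (shift 0 h) (Var 0) \<Colon> ?B" by simp
  ultimately have "Without_Trunc; A # \<Gamma> \<turnstile> App (shift 0 k) ?x' \<equiv> App (shift 0 h) (Var 0) \<Colon> ?B" by (rule eq_trans)
  then have "Without_Trunc; A # \<Gamma> \<turnstile> body (\<lambda>a. emb k \<cdot> (inf_i0 i (emb A) \<cdot> a)) \<equiv> body (\<lambda>a. emb h \<cdot> a)
       \<Colon> body (\<lambda>a. underlying j (emb P \<cdot> (inf_i0 i (emb A) \<cdot> a)))"
    by (simp add: final_simps \<tau>_def)
  with k show ?thesis by blast
qed

end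

theorem corollary5p1:
  shows "(\<forall>\<Gamma> i A. With_Trunc; \<Gamma> \<turnstile> A \<Colon> U i \<longrightarrow>
            (\<exists>e. With_Trunc; \<Gamma> \<turnstile> e \<Colon> raw (equivalence (one_inf i (emb A)) (trunc (emb A))))) \<and>
         (\<forall>\<Gamma> i A. Without_Trunc; \<Gamma> \<turnstile> A \<Colon> U i \<longrightarrow>
            Without_Trunc; \<Gamma> \<turnstile> raw (one_inf i (emb A)) \<Colon> U i \<and>
            Without_Trunc; \<Gamma> \<turnstile> raw (inf_i0 i (emb A)) \<Colon> raw (emb A \<rightarrowtriangle> one_inf i (emb A)) \<and>
            (\<exists>m. Without_Trunc; \<Gamma> \<turnstile> m \<Colon> raw (isprop (one_inf i (emb A)))) \<and>
            (\<forall>j P h.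
               Without_Trunc; \<Gamma> \<turnstile> P \<Colon> raw (one_inf i (emb A) \<rightarrowtriangle> hProp j) \<longrightarrow>
               Without_Trunc; \<Gamma> \<turnstile> h \<Colon>
                 raw (pi (emb A) (\<lambda>a. underlying j (emb P \<cdot> (inf_i0 i (emb A) \<cdot> a)))) \<longrightarrow>
               (\<exists>k. Without_Trunc; \<Gamma> \<turnstile> k \<Colon>
                      raw (pi (one_inf i (emb A)) (\<lambda>x. underlying j (emb P \<cdot> x))) \<and>
                    Without_Trunc; A # \<Gamma> \<turnstile>
                      body (\<lambda>a. emb k \<cdot> (inf_i0 i (emb A) \<cdot> a)) \<equiv> body (\<lambda>a. emb h \<cdot> a)
                      \<Colon> body (\<lambda>a. underlying j (emb P \<cdot> (inf_i0 i (emb A) \<cdot> a))))))"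
  using equivalence_part formation_part elimination_part by blast
end
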